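(* Let $(G/H,\mathbf{G})$ be a homogeneous spray manifold with a linear decomposition $\mathfrak{g}=\mathfrak{h}+\mathfrak{m}$ and let $\eta:\mathfrak{m}\backslash\{0\}\rightarrow\mathfrak{m}$ be the spray vector field. Let $\overline{\mathbf{G}}$ be a left invariant spray structure on $G$ such that its spray vector field $\overline{\eta}:\mathfrak{g}\backslash\{0\}\rightarrow\mathfrak{g}$ satisfies $\eta=\overline{\eta}|_{\mathfrak{m}\backslash\{0\}}$. Denote by $\pi:G\rightarrow G/H$ the smooth map $\pi(g)=g\cdot o$ for all $g\in G$, and by $\mathcal{L}=\cup_{g\in G}(L_g)_*(\mathfrak{m})\subset TG$ a distribution on $G$. Then $(\pi,\mathcal{L})$ is a submersion from $(G,\overline{\mathbf{G}})$ to $(G/H,\mathbf{G})$.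
   Context: A spray structure on a smooth manifold $M$ is a smooth tangent vector field $\mathbf{G}$ on the slit tangent bundle $TM\backslash 0$ which, in every standard local coordinate $(x^i,y^j)$ (i.e. $x=(x^i)\in M$, $y=y^j\partial_{x^j}\in T_xM$), has the form $\mathbf{G}=y^i\partial_{x^i}-2\mathbf{G}^i\partial_{y^i}$, where $\mathbf{G}^i(x,\lambda y)=\lambda^2\mathbf{G}^i(x,y)$ for all $\lambda>0$. A smooth curve $c(t)$ with nowhere-vanishing $\dot c(t)$ is a geodesic if $(c(t),\dot c(t))$ is an integral curve of $\mathbf{G}$. Submersion between spray structures: let $\pi:\overline{M}\to M$ be a smooth submersion of manifolds, $\overline{\mathbf{G}}$, $\mathbf{G}$ spray structures on $\overline{M}$, $M$, and $\mathcal{L}\subset T\overline{M}$ a distribution (smooth linear subbundle) each of whose fibers is a linear complement of $\ker(\pi_* )$ in the tangent space. Then $(\pi,\mathcal{L})$ is a submersion from $(\overline{M},\overline{\mathbf{G}})$ to $(M,\mathbf{G})$ if (1) $\overline{\mathbf{G}}|_{\mathcal{L}\backslash0}$ is tangent to the submanifold $\mathcal{L}\backslash 0\subset T\overline{M}\backslash 0$ everywhere; (2) for any geodesic $\overline{c}(t)$ on $(\overline{M},\overline{\mathbf{G}})$ with $(\overline{c}(t),\dot{\overline{c}}(t))\in\mathcal{L}\backslash0$, the curve $c(t)=\pi(\overline{c}(t))$ is a geodesic on $(M,\mathbf{G})$. Homogeneous spray manifold $(G/H,\mathbf{G})$: $G$ is a Lie group, $H$ a closed subgroup, $o=eH$,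 and $\mathbf{G}$ is a spray structure on $G/H$ with $(g_* )_*\mathbf{G}=\mathbf{G}$ for all $g\in G$. A linear decomposition $\mathfrak{g}=\mathfrak{h}+\mathfrak{m}$ is a direct sum of vector spaces, where $\mathfrak{g}=\mathrm{Lie}(G)=T_eG$, $\mathfrak{h}=\mathrm{Lie}(H)$; $\mathfrak{m}$ is identified with $T_o(G/H)$ via the differential at $e$ of $g\mapsto g\cdot o$. $L_g$ denotes left translation on $G$. Spray vector field: any smooth curve $c(t)$ on $G/H$ with $c(0)=o$ and nowhere-vanishing $\dot c(t)$ has a unique lift $\overline{c}(t)$ to $G$, defined around $t=0$, with $\overline{c}(0)=e$, $c(t)=\overline{c}(t)\cdot o$ and $(L_{\overline{c}(t)^{-1}})_*(\dot{\overline{c}}(t))\in\mathfrak{m}\backslash\{0\}$. For $y\in\mathfrak{m}\backslash\{0\}$ let $c_y(t)$ be the geodesic with $c_y(0)=o$, $\dot c_y(0)=y$, and $\overline{c}_y(t)$ its lift; then $\eta(y)=-\frac{\mathrm{d}}{\mathrm{d}t}|_{t=0}(L_{\overline{c}_y(t)^{-1}})_*(\dot{\overline{c}}_y(t))$, a smooth positively 2-homogeneous map. For a left invariant spray structure $\overline{\mathbf{G}}$ on $G$ (i.e. $((L_g)_* )_*\overline{\mathbf{G}}=\overline{\mathbf{G}}$ for all $g$), the spray vector field $\overline{\eta}$ is this notion for $G=G/\{e\}$ with $\mathfrak{g}=0+\mathfrak{g}$, i.e. $\overline{\eta}(y)=-\frac{\mathrm{d}}{\mathrm{d}t}|_{t=0}(L_{c(t)^{-1}})_*(\dot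 c(t))$ for the geodesic $c$ of $\overline{\mathbf{G}}$ with $c(0)=e$, $\dot c(0)=y$; equivalently, $\overline{\mathbf{G}}=\overline{\mathbf{G}}_0-\overline{\mathbf{H}}$, where $\overline{\mathbf{G}}_0$ is the bi-invariant spray structure whose geodesics are the left translates of (non-constant) one-parameter subgroups, and $\overline{\eta}=\overline{\mathbf{H}}|_{T_eG\backslash\{0\}}$. *)

theory Defs
  imports "HOL-Analysis.Analysis" "HOL-Algebra.Left_Coset"
begin

section \<open>Smooth maps between open subsets of Euclidean spaces\<close>

text \<open>Only meant for open \<open>S\<close>: the derivatives are two-sided, i.e. taken \<open>at x\<close>, not \<open>at x within S\<close>.\<close>

primrec Ck_on :: "nat \<Rightarrow> 'a::euclidean_space set \<Rightarrow> ('a \<Rightarrow> 'b::euclidean_space) \<Rightarrow> bool" where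
  "Ck_on 0 S f \<longleftrightarrow> continuous_on S f"
| "Ck_on (Suc k) S f \<longleftrightarrow> (\<forall>x\<in>S. f differentiable (at x)) \<and>
      (\<forall>v. Ck_on k S (\<lambda>x. frechet_derivative f (at x) v))"

definition smooth_on :: "'a::euclidean_space set \<Rightarrow> ('a \<Rightarrow> 'b::euclidean_space) \<Rightarrow> bool" where
  "smooth_on S f \<longleftrightarrow> (\<forall>k. Ck_on k S f)"


section \<open>Smooth manifolds\<close>

text \<open>A chart is a pair of its domain and its coordinate map; the values of the coordinate map
  outside the domain are irrelevant. The smooth structure is given by its maximal atlas.\<close>

type_synonym ('a, 'e) chart = "'a set \<times> ('a \<Rightarrow> 'e)"

record ('a, 'e) manifold =
  mtop :: "'a topology"
  charts :: "('a, 'e) chart set"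

abbreviation points :: "('a, 'e) manifold \<Rightarrow> 'a set" where
  "points M \<equiv> topspace (mtop M)"

definition chart_inv :: "('a, 'e) chart \<Rightarrow> 'e \<Rightarrow> 'a" where
  "chart_inv c = inv_into (fst c) (snd c)"

definition topological_chart :: "'a topology \<Rightarrow> ('a, 'e::euclidean_space) chart \<Rightarrow> bool" where
  "topological_chart T c \<longleftrightarrow> openin T (fst c) \<and> open (snd c ` fst c) \<and>
     homeomorphic_map (subtopology T (fst c)) (top_of_set (snd c ` fst c)) (snd c)"

definition compatible :: "('a, 'e::euclidean_space) chart \<Rightarrow> ('a, 'e) chart \<Rightarrow> bool" where
  "compatible c d \<longleftrightarrow>
     smooth_on (snd c ` (fst c \<inter> fst d)) (snd d \<circ> chart_inv c) \<and>
     smooth_on (snd d ` (fst c \<inter> fst d)) (snd c \<circ> chart_inv d)"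

definition smooth_manifold :: "('a, 'e::euclidean_space) manifold \<Rightarrow> bool" where
  "smooth_manifold M \<longleftrightarrow>
     Hausdorff_space (mtop M) \<and> second_countable (mtop M) \<and>
     (\<Union>c\<in>charts M. fst c) = points M \<and>
     (\<forall>c. c \<in> charts M \<longleftrightarrow> topological_chart (mtop M) c \<and> (\<forall>d\<in>charts M. compatible c d))"

text \<open>The manifold whose maximal atlas is generated by a given atlas.\<close>

definition manifold_of_atlas ::
    "'a topology \<Rightarrow> ('a, 'e::euclidean_space) chart set \<Rightarrow> ('a, 'e) manifold" where
  "manifold_of_atlas T A =
     \<lparr>mtop = T, charts = {c. topological_chart T c \<and> (\<forall>a\<in>A. compatible c a)}\<rparr>"

definition open_submanifold :: "('a, 'e) manifold \<Rightarrow> 'a set \<Rightarrow> ('a, 'e) manifold" where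
  "open_submanifold M W = \<lparr>mtop = subtopology (mtop M) W, charts = {c \<in> charts M. fst c \<subseteq> W}\<rparr>"

definition prod_manifold ::
    "('a, 'e::euclidean_space) manifold \<Rightarrow> ('b, 'f::euclidean_space) manifold \<Rightarrow>
     ('a \<times> 'b, 'e \<times> 'f) manifold" where
  "prod_manifold M N = manifold_of_atlas (prod_topology (mtop M) (mtop N))
     {(fst c \<times> fst d, map_prod (snd c) (snd d)) |c d. c \<in> charts M \<and> d \<in> charts N}"

definition smooth_map ::
    "('a, 'e::euclidean_space) manifold \<Rightarrow> ('b, 'f::euclidean_space) manifold \<Rightarrow>
     ('a \<Rightarrow> 'b) \<Rightarrow> bool" where
  "smooth_map M N f \<longleftrightarrow> continuous_map (mtop M) (mtop N) f \<and>
     (\<forall>c\<in>charts M. \<forall>d\<in>charts N.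
        smooth_on (snd c ` (fst c \<inter> f -` fst d)) (snd d \<circ> f \<circ> chart_inv c))"


section \<open>Tangent vectors\<close>

text \<open>A tangent vector at \<open>p\<close> is the family of its coordinate representations in all charts around
  \<open>p\<close>, related by the Jacobians of the coordinate changes. It is extended by \<open>0\<close> to all other pairs,
  so that equality of tangent vectors is equality of functions, and the vector space operations and
  derivatives of curves in a tangent space are those of functions, taken pointwise.\<close>

type_synonym ('a, 'e) tangent_vector = "('a, 'e) chart \<Rightarrow> 'e"
type_synonym ('a, 'e) tangent_point = "'a \<times> ('a, 'e) tangent_vector"

abbreviation zero_vec :: "('a, 'e::euclidean_space) tangent_vector" where
  "zero_vec \<equiv> (\<lambda>_. 0)"

definition tangent_space ::
    "('a, 'e::euclidean_space) manifold \<Rightarrow> 'a \<Rightarrow> ('a, 'e) tangent_vector set" where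
  "tangent_space M p = {v.
     (\<forall>c. \<not> (c \<in> charts M \<and> p \<in> fst c) \<longrightarrow> v c = 0) \<and>
     (\<forall>c\<in>charts M. \<forall>d\<in>charts M. p \<in> fst c \<and> p \<in> fst d \<longrightarrow>
        v d = frechet_derivative (snd d \<circ> chart_inv c) (at (snd c p)) (v c))}"

definition linear_subspace :: "('a, 'e::euclidean_space) tangent_vector set \<Rightarrow> bool" where
  "linear_subspace W \<longleftrightarrow> zero_vec \<in> W \<and>
     (\<forall>v\<in>W. \<forall>w\<in>W. (\<lambda>c. v c + w c) \<in> W) \<and> (\<forall>r. \<forall>v\<in>W. (\<lambda>c. r *\<^sub>R v c) \<in> W)"

definition direct_sum :: "('a, 'e::euclidean_space) tangent_vector set \<Rightarrow>
     ('a, 'e) tangent_vector set \<Rightarrow> ('a, 'e) tangent_vector set \<Rightarrow> bool" where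
  "direct_sum V A B \<longleftrightarrow> linear_subspace A \<and> linear_subspace B \<and> A \<inter> B = {zero_vec} \<and>
     V = {(\<lambda>c. a c + b c) |a b. a \<in> A \<and> b \<in> B}"

text \<open>The chart around \<open>p\<close> chosen here does not matter if \<open>v\<close> is tangent to \<open>M\<close> at \<open>p\<close>.\<close>

definition differential ::
    "('a, 'e::euclidean_space) manifold \<Rightarrow> ('b, 'f::euclidean_space) manifold \<Rightarrow> ('a \<Rightarrow> 'b) \<Rightarrow>
     'a \<Rightarrow> ('a, 'e) tangent_vector \<Rightarrow> ('b, 'f) tangent_vector" where
  "differential M N f p v = (\<lambda>d.
     if d \<in> charts N \<and> f p \<in> fst d
     then let c = (SOME c. c \<in> charts M \<and> p \<in> fst c)
          in frechet_derivative (snd d \<circ> f \<circ> chart_inv c) (at (snd c p)) (v c)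
     else 0)"

definition tangent_map ::
    "('a, 'e::euclidean_space) manifold \<Rightarrow> ('b, 'f::euclidean_space) manifold \<Rightarrow> ('a \<Rightarrow> 'b) \<Rightarrow>
     ('a, 'e) tangent_point \<Rightarrow> ('b, 'f) tangent_point" where
  "tangent_map M N f u = (f (fst u), differential M N f (fst u) (snd u))"

definition smooth_submersion ::
    "('a, 'e::euclidean_space) manifold \<Rightarrow> ('b, 'f::euclidean_space) manifold \<Rightarrow>
     ('a \<Rightarrow> 'b) \<Rightarrow> bool" where
  "smooth_submersion M N f \<longleftrightarrow> smooth_map M N f \<and>
     (\<forall>p\<in>points M. differential M N f p ` tangent_space M p = tangent_space N (f p))"

definition kernel_at ::
    "('a, 'e::euclidean_space) manifold \<Rightarrow> ('b, 'f::euclidean_space) manifold \<Rightarrow> ('a \<Rightarrow> 'b) \<Rightarrow>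
     'a \<Rightarrow> ('a, 'e) tangent_vector set" where
  "kernel_at M N f p = {v \<in> tangent_space M p. differential M N f p v = zero_vec}"


section \<open>Curves\<close>

definition smooth_curve ::
    "('a, 'e::euclidean_space) manifold \<Rightarrow> real set \<Rightarrow> (real \<Rightarrow> 'a) \<Rightarrow> bool" where
  "smooth_curve M I c \<longleftrightarrow> open I \<and> is_interval I \<and> continuous_map (top_of_set I) (mtop M) c \<and>
     (\<forall>d\<in>charts M. smooth_on (I \<inter> c -` fst d) (snd d \<circ> c))"

definition velocity ::
    "('a, 'e::euclidean_space) manifold \<Rightarrow> (real \<Rightarrow> 'a) \<Rightarrow> real \<Rightarrow> ('a, 'e) tangent_vector" where
  "velocity M c t = (\<lambda>d.
     if d \<in> charts M \<and> c t \<in> fst d then vector_derivative (snd d \<circ> c) (at t) else 0)"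

definition tangent_lift ::
    "('a, 'e::euclidean_space) manifold \<Rightarrow> (real \<Rightarrow> 'a) \<Rightarrow> real \<Rightarrow> ('a, 'e) tangent_point" where
  "tangent_lift M c t = (c t, velocity M c t)"

text \<open>For an embedded submanifold \<open>S\<close> of \<open>M\<close> this is the tangent space of \<open>S\<close> at \<open>p\<close>, as a subset
  of the tangent space of \<open>M\<close>.\<close>

definition tangent_space_of_subset ::
    "('a, 'e::euclidean_space) manifold \<Rightarrow> 'a set \<Rightarrow> 'a \<Rightarrow> ('a, 'e) tangent_vector set" where
  "tangent_space_of_subset M S p = {velocity M c 0 |c \<epsilon>.
     \<epsilon> > 0 \<and> smooth_curve M {-\<epsilon><..<\<epsilon>} c \<and> c 0 = p \<and> (\<forall>t\<in>{-\<epsilon><..<\<epsilon>}. c t \<in> S)}"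


section \<open>The tangent bundle\<close>

text \<open>The standard chart \<open>(x, y)\<close> of the tangent bundle induced by a chart \<open>x\<close> of \<open>M\<close>.\<close>

definition tangent_chart :: "('a, 'e::euclidean_space) manifold \<Rightarrow> ('a, 'e) chart \<Rightarrow>
     (('a, 'e) tangent_point, 'e \<times> 'e) chart" where
  "tangent_chart M c =
     ({u. fst u \<in> fst c \<and> snd u \<in> tangent_space M (fst u)}, \<lambda>u. (snd c (fst u), snd u c))"

definition tangent_topology ::
    "('a, 'e::euclidean_space) manifold \<Rightarrow> ('a, 'e) tangent_point topology" where
  "tangent_topology M = topology_generated_by
     {{u \<in> fst (tangent_chart M c). snd (tangent_chart M c) u \<in> W} |c W. c \<in> charts M \<and> open W}"

definition tangent_bundle ::
    "('a, 'e::euclidean_space) manifold \<Rightarrow> (('a, 'e) tangent_point, 'e \<times> 'e) manifold" where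
  "tangent_bundle M = manifold_of_atlas (tangent_topology M) (tangent_chart M ` charts M)"

definition slit :: "('a, 'e::euclidean_space) tangent_point set" where
  "slit = {u. snd u \<noteq> zero_vec}"

definition slit_bundle ::
    "('a, 'e::euclidean_space) manifold \<Rightarrow> (('a, 'e) tangent_point, 'e \<times> 'e) manifold" where
  "slit_bundle M = open_submanifold (tangent_bundle M) slit"

definition slit_chart :: "('a, 'e::euclidean_space) manifold \<Rightarrow> ('a, 'e) chart \<Rightarrow>
     (('a, 'e) tangent_point, 'e \<times> 'e) chart" where
  "slit_chart M c = (fst (tangent_chart M c) \<inter> slit, snd (tangent_chart M c))"

definition smooth_vector_field ::
    "('a, 'e::euclidean_space) manifold \<Rightarrow> ('a \<Rightarrow> ('a, 'e) tangent_vector) \<Rightarrow> bool" where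
  "smooth_vector_field M X \<longleftrightarrow> (\<forall>p\<in>points M. X p \<in> tangent_space M p) \<and>
     smooth_map M (tangent_bundle M) (\<lambda>p. (p, X p))"

text \<open>\<open>F\<^sub>* X = X\<close> for a diffeomorphism \<open>F\<close> of \<open>M\<close>.\<close>

definition invariant_vector_field :: "('a, 'e::euclidean_space) manifold \<Rightarrow> ('a \<Rightarrow> 'a) \<Rightarrow>
     ('a \<Rightarrow> ('a, 'e) tangent_vector) \<Rightarrow> bool" where
  "invariant_vector_field M F X \<longleftrightarrow> (\<forall>p\<in>points M. X (F p) = differential M M F p (X p))"

definition fiber :: "('a, 'e) tangent_point set \<Rightarrow> 'a \<Rightarrow> ('a, 'e) tangent_vector set" where
  "fiber L p = {v. (p, v) \<in> L}"

text \<open>A distribution is a smooth linear subbundle of the tangent bundle: a set of tangent vectors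
  which locally has a smooth frame, of constant rank \<open>k\<close>.\<close>

definition distribution ::
    "('a, 'e::euclidean_space) manifold \<Rightarrow> ('a, 'e) tangent_point set \<Rightarrow> bool" where
  "distribution M L \<longleftrightarrow> L \<subseteq> points (tangent_bundle M) \<and>
     (\<exists>k. \<forall>p\<in>points M. \<exists>W E. openin (mtop M) W \<and> p \<in> W \<and>
        (\<forall>i<k. smooth_map (open_submanifold M W) (tangent_bundle M) (\<lambda>q. (q, E i q))) \<and>
        (\<forall>q\<in>W. fiber L q = {(\<lambda>c. \<Sum>i<k. a i *\<^sub>R E i q c) |a :: nat \<Rightarrow> real. True} \<and>
           (\<forall>a :: nat \<Rightarrow> real. (\<lambda>c. \<Sum>i<k. a i *\<^sub>R E i q c) = zero_vec \<longrightarrow> (\<forall>i<k. a i = 0))))"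


section \<open>Spray structures and their submersions\<close>

type_synonym ('a, 'e) spray =
  "('a, 'e) tangent_point \<Rightarrow> (('a, 'e) tangent_point, 'e \<times> 'e) tangent_vector"

definition spray_structure ::
    "('a, 'e::euclidean_space) manifold \<Rightarrow> ('a, 'e) spray \<Rightarrow> bool" where
  "spray_structure M X \<longleftrightarrow> smooth_vector_field (slit_bundle M) X \<and>
     (\<forall>c\<in>charts M. \<exists>\<Gamma> :: 'e \<Rightarrow> 'e \<Rightarrow> 'e.
        (\<forall>x\<in>snd c ` fst c. \<forall>y r. y \<noteq> 0 \<and> r > 0 \<longrightarrow> \<Gamma> x (r *\<^sub>R y) = r\<^sup>2 *\<^sub>R \<Gamma> x y) \<and>
        (\<forall>u\<in>fst (slit_chart M c).
           X u (slit_chart M c) = (snd u c, - 2 *\<^sub>R \<Gamma> (snd c (fst u)) (snd u c))))"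

definition geodesic :: "('a, 'e::euclidean_space) manifold \<Rightarrow> ('a, 'e) spray \<Rightarrow>
     real set \<Rightarrow> (real \<Rightarrow> 'a) \<Rightarrow> bool" where
  "geodesic M X I c \<longleftrightarrow> smooth_curve M I c \<and>
     (\<forall>t\<in>I. velocity M c t \<noteq> zero_vec \<and>
        velocity (slit_bundle M) (tangent_lift M c) t = X (tangent_lift M c t))"

definition spray_submersion ::
    "('a, 'e::euclidean_space) manifold \<Rightarrow> ('a, 'e) spray \<Rightarrow>
     ('b, 'f::euclidean_space) manifold \<Rightarrow> ('b, 'f) spray \<Rightarrow>
     ('a \<Rightarrow> 'b) \<Rightarrow> ('a, 'e) tangent_point set \<Rightarrow> bool" where
  "spray_submersion N Y M X \<pi> L \<longleftrightarrow>
     smooth_manifold N \<and> spray_structure N Y \<and> smooth_manifold M \<and> spray_structure M X \<and>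
     smooth_submersion N M \<pi> \<and> distribution N L \<and>
     (\<forall>p\<in>points N. direct_sum (tangent_space N p) (kernel_at N M \<pi> p) (fiber L p)) \<and>
     (\<forall>u\<in>L \<inter> slit. Y u \<in> tangent_space_of_subset (slit_bundle N) (L \<inter> slit) u) \<and>
     (\<forall>I c. geodesic N Y I c \<and> (\<forall>t\<in>I. tangent_lift N c t \<in> L \<inter> slit) \<longrightarrow>
        geodesic M X I (\<pi> \<circ> c))"


section \<open>Lie groups and homogeneous spray manifolds\<close>

definition lie_group ::
    "('g, 'z) monoid_scheme \<Rightarrow> ('g, 'e::euclidean_space) manifold \<Rightarrow> bool" where
  "lie_group G N \<longleftrightarrow> group G \<and> smooth_manifold N \<and> points N = carrier G \<and>
     smooth_map (prod_manifold N N) N (\<lambda>(x, y). x \<otimes>\<^bsub>G\<^esub> y) \<and>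
     smooth_map N N (\<lambda>x. inv\<^bsub>G\<^esub> x)"

text \<open>\<open>M\<close> is \<open>G/H\<close>, the set of left cosets with the quotient topology and its standard smooth
  structure: the unique one for which the projection is a smooth submersion.\<close>

definition coset_manifold :: "('g, 'z) monoid_scheme \<Rightarrow> ('g, 'e::euclidean_space) manifold \<Rightarrow>
     'g set \<Rightarrow> ('g set, 'f::euclidean_space) manifold \<Rightarrow> bool" where
  "coset_manifold G N H M \<longleftrightarrow> smooth_manifold M \<and> points M = lcosets\<^bsub>G\<^esub> H \<and>
     quotient_map (mtop N) (mtop M) (\<lambda>g. g <#\<^bsub>G\<^esub> H) \<and>
     smooth_submersion N M (\<lambda>g. g <#\<^bsub>G\<^esub> H)"

definition lie_algebra :: "('g, 'z) monoid_scheme \<Rightarrow> ('g, 'e::euclidean_space) manifold \<Rightarrow>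
     ('g, 'e) tangent_vector set" where
  "lie_algebra G N = tangent_space N \<one>\<^bsub>G\<^esub>"

text \<open>The Lie algebra of a closed (hence embedded) subgroup \<open>H\<close>, as a subspace of that of \<open>G\<close>.\<close>

definition lie_subalgebra :: "('g, 'z) monoid_scheme \<Rightarrow> ('g, 'e::euclidean_space) manifold \<Rightarrow>
     'g set \<Rightarrow> ('g, 'e) tangent_vector set" where
  "lie_subalgebra G N H = tangent_space_of_subset N H \<one>\<^bsub>G\<^esub>"

definition homogeneous_spray :: "('g, 'z) monoid_scheme \<Rightarrow>
     ('g set, 'f::euclidean_space) manifold \<Rightarrow> ('g set, 'f) spray \<Rightarrow> bool" where
  "homogeneous_spray G M X \<longleftrightarrow> spray_structure M X \<and>
     (\<forall>g\<in>carrier G. invariant_vector_field (slit_bundle M) (tangent_map M M (\<lambda>A. g <#\<^bsub>G\<^esub> A)) X)"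

definition left_invariant_spray :: "('g, 'z) monoid_scheme \<Rightarrow>
     ('g, 'e::euclidean_space) manifold \<Rightarrow> ('g, 'e) spray \<Rightarrow> bool" where
  "left_invariant_spray G N Y \<longleftrightarrow> spray_structure N Y \<and>
     (\<forall>g\<in>carrier G. invariant_vector_field (slit_bundle N) (tangent_map N N (\<lambda>x. g \<otimes>\<^bsub>G\<^esub> x)) Y)"

definition left_distribution :: "('g, 'z) monoid_scheme \<Rightarrow>
     ('g, 'e::euclidean_space) manifold \<Rightarrow> ('g, 'e) tangent_vector set \<Rightarrow>
     ('g, 'e) tangent_point set" where
  "left_distribution G N \<mm> =
     {tangent_map N N (\<lambda>x. g \<otimes>\<^bsub>G\<^esub> x) (\<one>\<^bsub>G\<^esub>, v) |g v. g \<in> carrier G \<and> v \<in> \<mm>}"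

text \<open>The velocity of a curve \<open>c\<close> in \<open>G\<close> at time \<open>t\<close>, moved to the Lie algebra by the left
  translation with the inverse of \<open>c t\<close>.\<close>

definition left_velocity :: "('g, 'z) monoid_scheme \<Rightarrow> ('g, 'e::euclidean_space) manifold \<Rightarrow>
     (real \<Rightarrow> 'g) \<Rightarrow> real \<Rightarrow> ('g, 'e) tangent_vector" where
  "left_velocity G N c t =
     differential N N (\<lambda>x. inv\<^bsub>G\<^esub> (c t) \<otimes>\<^bsub>G\<^esub> x) (c t) (velocity N c t)"

text \<open>\<open>C\<close> is a lift to \<open>G\<close>, defined on \<open>I\<close>, of a curve \<open>c\<close> in \<open>G/H\<close>.\<close>

definition horizontal_lift :: "('g, 'z) monoid_scheme \<Rightarrow>
     ('g, 'e::euclidean_space) manifold \<Rightarrow> 'g set \<Rightarrow> ('g, 'e) tangent_vector set \<Rightarrow>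
     real set \<Rightarrow> (real \<Rightarrow> 'g set) \<Rightarrow> (real \<Rightarrow> 'g) \<Rightarrow> bool" where
  "horizontal_lift G N H \<mm> I c C \<longleftrightarrow> smooth_curve N I C \<and> C 0 = \<one>\<^bsub>G\<^esub> \<and>
     (\<forall>t\<in>I. c t = C t <#\<^bsub>G\<^esub> H \<and> left_velocity G N C t \<in> \<mm> - {zero_vec})"

text \<open>The geodesic \<open>c\<close> with initial velocity \<open>y\<close> and its lift \<open>C\<close> exist and are unique up to the
  choice of their interval of definition, which does not affect the derivative at \<open>0\<close>. A vector
  \<open>y\<close> of \<open>\<mm>\<close> is identified with its image under the differential of the projection.\<close>

definition spray_vector_field :: "('g, 'z) monoid_scheme \<Rightarrow>
     ('g, 'e::euclidean_space) manifold \<Rightarrow> 'g set \<Rightarrow> ('g set, 'f::euclidean_space) manifold \<Rightarrow>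
     ('g set, 'f) spray \<Rightarrow> ('g, 'e) tangent_vector set \<Rightarrow>
     (('g, 'e) tangent_vector \<Rightarrow> ('g, 'e) tangent_vector) \<Rightarrow> bool" where
  "spray_vector_field G N H M X \<mm> \<eta> \<longleftrightarrow> (\<forall>y\<in>\<mm> - {zero_vec}. \<exists>\<epsilon>>0. \<exists>c C.
     geodesic M X {-\<epsilon><..<\<epsilon>} c \<and> c 0 = \<one>\<^bsub>G\<^esub> <#\<^bsub>G\<^esub> H \<and>
     velocity M c 0 = differential N M (\<lambda>g. g <#\<^bsub>G\<^esub> H) \<one>\<^bsub>G\<^esub> y \<and>
     horizontal_lift G N H \<mm> {-\<epsilon><..<\<epsilon>} c C \<and>
     (\<forall>d. ((\<lambda>t. left_velocity G N C t d) has_vector_derivative - \<eta> y d) (at 0)))"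

text \<open>The case of the trivial subgroup, where a curve is its own lift.\<close>

definition group_spray_vector_field :: "('g, 'z) monoid_scheme \<Rightarrow>
     ('g, 'e::euclidean_space) manifold \<Rightarrow> ('g, 'e) spray \<Rightarrow>
     (('g, 'e) tangent_vector \<Rightarrow> ('g, 'e) tangent_vector) \<Rightarrow> bool" where
  "group_spray_vector_field G N Y \<eta> \<longleftrightarrow> (\<forall>y\<in>lie_algebra G N - {zero_vec}. \<exists>\<epsilon>>0. \<exists>c.
     geodesic N Y {-\<epsilon><..<\<epsilon>} c \<and> c 0 = \<one>\<^bsub>G\<^esub> \<and> velocity N c 0 = y \<and>
     (\<forall>d. ((\<lambda>t. left_velocity G N c t d) has_vector_derivative - \<eta> y d) (at 0)))"

end

theory Submission
  imports Defs
begin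

text \<open>
  Write \<open>\<pi>\<close> for the projection \<open>g \<mapsto> g H\<close>. It intertwines the left translations of \<open>G\<close> with the action
  of \<open>G\<close> on the coset space, and both sprays are invariant, so each claim about a horizontal vector
  at \<open>g\<close> reduces to the corresponding claim about a vector \<open>y \<in> \<mm>\<close>, \<open>y \<noteq> 0\<close>, at the identity.

  For such a \<open>y\<close> let \<open>C\<close> be the horizontal lift of the geodesic of the coset space with initial
  velocity \<open>d\<pi> y\<close>, and let \<open>D\<close> be the geodesic of \<open>Y\<close> with initial velocity \<open>y\<close>. Both curves start at
  the identity with velocity \<open>y\<close>, and their velocities, moved to the Lie algebra by left translation,
  have the derivatives \<open>- \<eta> y\<close> and \<open>- \<eta>' y\<close> at time \<open>0\<close>, which are equal by hypothesis. In a chart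
  this derivative is the second derivative of the curve plus a term that depends only on \<open>y\<close>. Hence
  \<open>C\<close> and \<open>D\<close> have the same 2-jet at \<open>0\<close> (\<open>second_order_jet\<close>), and the tangent lift of \<open>C\<close> has
  the velocity \<open>Y (1, y)\<close> at time \<open>0\<close> (\<open>horizontal_curve\<close>). This has two consequences. The tangent
  lift of \<open>C\<close> stays in the left invariant distribution, so \<open>Y\<close> is tangent to it
  (\<open>tangent_to_distribution\<close>). And \<open>\<pi> \<circ> C\<close> is a geodesic of \<open>X\<close>, so the differential of the tangent
  map of \<open>\<pi>\<close> takes \<open>Y (1, y)\<close> to \<open>X (\<pi> 1, d\<pi> y)\<close>. Translated to all points of \<open>G\<close>, this is the
  geodesic equation for the projection of a horizontal geodesic of \<open>Y\<close> (\<open>projected_geodesic\<close>).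

  The distribution is complementary to the kernel of \<open>d\<pi>\<close> (\<open>direct_sum_at\<close>) because \<open>d\<pi>\<close> does not
  vanish on \<open>\<mm> - {0}\<close>, its values there being velocities of geodesics, while it vanishes on the Lie
  algebra of \<open>H\<close>, whose elements are velocities of curves that \<open>\<pi>\<close> maps to a point.

  The translation on the side of the coset space uses second derivatives of the action of a group
  element, so the action has to be smooth. Locally it is \<open>\<pi>\<close> after a left translation after a smooth
  section of \<open>\<pi>\<close>, and the section comes from the inverse function theorem for smooth maps
  (\<open>smooth_local_right_inverse\<close>, \<open>smooth_map_at_action\<close>).

  Most smoothness arguments are phrased with maps from a Euclidean space into a manifold
  (\<open>smooth_into_at\<close>) and their derivatives (\<open>pushforward\<close>). Curves, inverses of charts and local
  representatives of maps are all of this kind, and so the chain rule takes one form for all of them.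
\<close>

section \<open>Calculus of maps of class \<open>C\<^sup>k\<close>\<close>

lemma has_derivative_cong_nhds:
  assumes "eventually (\<lambda>y. f y = g y) (nhds x)"
  shows "(f has_derivative D) (at x) \<longleftrightarrow> (g has_derivative D) (at x)"
proof -
  have 1: "(g has_derivative D) (at x)"
    if "(f has_derivative D) (at x)" "eventually (\<lambda>y. f y = g y) (nhds x)" for f g :: "'a \<Rightarrow> 'b"
    using that(1) eventually_nhds_x_imp_x[OF that(2)] that(2)
    by (intro has_derivative_transform_eventually[OF that(1)])
       (auto simp: at_within_def eventually_inf_principal elim: eventually_mono)
  have "eventually (\<lambda>y. g y = f y) (nhds x)" using assms by (simp add: eq_commute)
  then show ?thesis using 1 assms by blast
qed

lemma frechet_derivative_eqI:
  "(f has_derivative D) (at x) \<Longrightarrow> frechet_derivative f (at x) v = D v"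
  by (drule frechet_derivative_at) simp

lemma frechet_derivative_cong_ev:
  assumes "eventually (\<lambda>y. f y = g y) (nhds x)"
  shows "frechet_derivative f (at x) = frechet_derivative g (at x)"
proof -
  have "(f has_derivative D) (at x) \<longleftrightarrow> (g has_derivative D) (at x)" for D
    by (rule has_derivative_cong_nhds[OF assms])
  then show ?thesis
    by (simp add: frechet_derivative_def)
qed

lemma differentiable_cong_ev:
  assumes "eventually (\<lambda>y. f y = g y) (nhds x)"
  shows "f differentiable (at x) \<longleftrightarrow> g differentiable (at x)"
proof -
  have "(f has_derivative D) (at x) \<longleftrightarrow> (g has_derivative D) (at x)" for D
    by (rule has_derivative_cong_nhds[OF assms])
  then show ?thesis
    by (simp add: differentiable_def)
qed

lemma Ck_on_cong:
  assumes "open S" "\<And>x. x \<in> S \<Longrightarrow> f x = g x" "Ck_on k S f"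
  shows "Ck_on k S g"
  using assms(2,3)
proof (induction k arbitrary: f g)
  case 0
  then show ?case by (simp cong: continuous_on_cong)
next
  case (Suc k)
  have ev: "eventually (\<lambda>y. f y = g y) (nhds x)" if "x \<in> S" for x
    using that Suc.prems(1) assms(1) by (auto simp: eventually_nhds)
  have "Ck_on k S (\<lambda>x. frechet_derivative g (at x) v)" for v
    using Suc.IH[of "\<lambda>x. frechet_derivative f (at x) v" "\<lambda>x. frechet_derivative g (at x) v"]
      Suc.prems(2) frechet_derivative_cong_ev[OF ev] by auto
  then show ?case
    using Suc.prems(2) differentiable_cong_ev[OF ev] by auto
qed

lemma Ck_on_imp_continuous_on: "Ck_on k S f \<Longrightarrow> continuous_on S f"
  by (cases k) (auto simp: differentiable_imp_continuous_within continuous_at_imp_continuous_on)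

lemma Ck_on_mono: "Ck_on k S f \<Longrightarrow> T \<subseteq> S \<Longrightarrow> Ck_on k T f"
  by (induction k arbitrary: f) (auto intro: continuous_on_subset)

lemma Ck_on_Suc_imp: "Ck_on (Suc k) S f \<Longrightarrow> Ck_on k S f"
proof (induction k arbitrary: f)
  case 0
  then show ?case using Ck_on_imp_continuous_on by fastforce
next
  case (Suc k)
  have d: "\<forall>x\<in>S. f differentiable (at x)" "Ck_on (Suc k) S (\<lambda>x. frechet_derivative f (at x) v)" for v
    using Suc.prems unfolding Ck_on.simps(2)[of "Suc k"] by blast+
  then show ?case
    unfolding Ck_on.simps(2)[of k] by (intro conjI allI Suc.IH d)
qed

lemma Ck_on_Union:
  assumes "\<And>U. U \<in> \<U> \<Longrightarrow> open U \<and> Ck_on k U f"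
  shows "Ck_on k (\<Union>\<U>) f"
  using assms
proof (induction k arbitrary: f)
  case 0
  then show ?case
    using continuous_on_open_Union[of \<U> f] by simp
next
  case (Suc k)
  have "Ck_on k (\<Union>\<U>) (\<lambda>x. frechet_derivative f (at x) v)" for v
    by (rule Suc.IH) (use Suc.prems in auto)
  moreover have "f differentiable (at x)" if "x \<in> \<Union>\<U>" for x
    using that Suc.prems by auto
  ultimately show ?case by simp
qed

lemma Ck_on_Suc_has_derivative:
  "Ck_on (Suc k) S f \<Longrightarrow> x \<in> S \<Longrightarrow> (f has_derivative frechet_derivative f (at x)) (at x)"
  by (simp add: frechet_derivative_works[symmetric])

lemma Ck_on_const: "Ck_on k S (\<lambda>x. c)"
  by (induction k arbitrary: c) auto

lemma Ck_on_bounded_linear: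
  assumes "bounded_linear L"
  shows "Ck_on k S L"
proof (cases k)
  case 0
  then show ?thesis using assms by (simp add: linear_continuous_on)
next
  case (Suc n)
  have "frechet_derivative L (at x) = L" for x
    using bounded_linear_imp_has_derivative[OF assms] frechet_derivative_at by metis
  then show ?thesis
    using Suc assms by (simp add: Ck_on_const bounded_linear_imp_differentiable)
qed

lemma Ck_on_add:
  assumes "open S" "Ck_on k S f" "Ck_on k S g"
  shows "Ck_on k S (\<lambda>x. f x + g x)"
  using assms(2,3)
proof (induction k arbitrary: f g)
  case 0
  then show ?case by (auto intro: continuous_on_add)
next
  case (Suc k)
  have "Ck_on k S (\<lambda>x. frechet_derivative (\<lambda>x. f x + g x) (at x) v)" for v
  proof (rule Ck_on_cong[OF assms(1)])
    show "Ck_on k S (\<lambda>x. frechet_derivative f (at x) v + frechet_derivative g (at x) v)"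
      using Suc by auto
    show "frechet_derivative f (at x) v + frechet_derivative g (at x) v
        = frechet_derivative (\<lambda>x. f x + g x) (at x) v" if "x \<in> S" for x
    proof -
      have "((\<lambda>x. f x + g x) has_derivative
          (\<lambda>v. frechet_derivative f (at x) v + frechet_derivative g (at x) v)) (at x)"
        using that Suc.prems by (intro has_derivative_add) (auto simp: frechet_derivative_works[symmetric])
      from frechet_derivative_eqI[OF this] show ?thesis by simp
    qed
  qed
  then show ?case using Suc.prems by auto
qed

lemma Ck_on_sum:
  assumes "open S" "\<And>i. i \<in> I \<Longrightarrow> Ck_on k S (f i)"
  shows "Ck_on k S (\<lambda>x. \<Sum>i\<in>I. f i x)"
  using assms(2)
  by (induction I rule: infinite_finite_induct) (auto simp: Ck_on_const intro!: Ck_on_add[OF assms(1)])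

lemma Ck_on_scaleR:
  fixes g :: "'a::euclidean_space \<Rightarrow> 'b::euclidean_space"
  assumes "open S" "Ck_on k S f" "Ck_on k S g"
  shows "Ck_on k S (\<lambda>x. f x *\<^sub>R g x)"
  using assms(2,3)
proof (induction k arbitrary: f g)
  case 0
  then show ?case by (auto intro: continuous_on_scaleR)
next
  case (Suc k)
  have d: "((\<lambda>x. f x *\<^sub>R g x) has_derivative
      (\<lambda>v. f x *\<^sub>R frechet_derivative g (at x) v + frechet_derivative f (at x) v *\<^sub>R g x)) (at x)"
    if "x \<in> S" for x
    using has_derivative_scaleR[OF Suc.prems[THEN Ck_on_Suc_has_derivative, OF that]] .
  have "Ck_on k S (\<lambda>x. frechet_derivative (\<lambda>x. f x *\<^sub>R g x) (at x) v)" for v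
  proof (rule Ck_on_cong[OF assms(1)])
    show "Ck_on k S (\<lambda>x. f x *\<^sub>R frechet_derivative g (at x) v + frechet_derivative f (at x) v *\<^sub>R g x)"
      using Suc.prems Ck_on_Suc_imp[OF Suc.prems(1)] Ck_on_Suc_imp[OF Suc.prems(2)]
      by (intro Ck_on_add assms Suc.IH) auto
    show "f x *\<^sub>R frechet_derivative g (at x) v + frechet_derivative f (at x) v *\<^sub>R g x
        = frechet_derivative (\<lambda>x. f x *\<^sub>R g x) (at x) v" if "x \<in> S" for x
      using frechet_derivative_eqI[OF d[OF that]] by simp
  qed
  then show ?case using d by (auto simp: differentiable_def)
qed

lemma linear_expand_Basis:
  assumes "linear f"
  shows "f v = (\<Sum>i\<in>Basis. (v \<bullet> i) *\<^sub>R f (i::'a::euclidean_space))"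
  using linear_sum[OF assms, of "\<lambda>i. (v \<bullet> i) *\<^sub>R i" Basis] linear_scale[OF assms]
  by (simp add: euclidean_representation)

lemma Ck_on_compose_linear:
  assumes "bounded_linear L" "open S" "Ck_on k S f"
  shows "Ck_on k S (\<lambda>x. L (f x))"
  using assms(3)
proof (induction k arbitrary: f)
  case 0
  then show ?case using assms(1) by (simp add: bounded_linear.continuous_on)
next
  case (Suc k)
  have d: "((\<lambda>x. L (f x)) has_derivative (\<lambda>v. L (frechet_derivative f (at x) v))) (at x)" if "x \<in> S" for x
    using bounded_linear.has_derivative[OF assms(1) Ck_on_Suc_has_derivative[OF Suc.prems that]] .
  have "Ck_on k S (\<lambda>x. frechet_derivative (\<lambda>x. L (f x)) (at x) v)" for v
  proof (rule Ck_on_cong[OF assms(2)])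
    show "Ck_on k S (\<lambda>x. L (frechet_derivative f (at x) v))"
      using Suc by auto
    show "L (frechet_derivative f (at x) v)
        = frechet_derivative (\<lambda>x. L (f x)) (at x) v" if "x \<in> S" for x
      using frechet_derivative_eqI[OF d[OF that]] by simp
  qed
  then show ?case using d by (auto simp: differentiable_def)
qed

text \<open>
  The derivative of a composition is expanded in the standard basis of the middle space. Each summand
  is a product of a component of the inner derivative with a partial derivative of \<open>g\<close> composed with
  \<open>f\<close>, to which the induction hypothesis applies.
\<close>

lemma Ck_on_compose:
  fixes f :: "'a::euclidean_space \<Rightarrow> 'b::euclidean_space" and g :: "'b \<Rightarrow> 'c::euclidean_space"
  assumes "open S" "open T" "f ` S \<subseteq> T" "Ck_on k S f" "Ck_on k T g"
  shows "Ck_on k S (\<lambda>x. g (f x))"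
  using assms(4,5)
proof (induction k arbitrary: g)
  case 0
  then show ?case using assms(3) by (auto intro: continuous_on_compose2)
next
  case (Suc k)
  have fk: "Ck_on k S f" using Suc.prems Ck_on_Suc_imp by blast
  have d: "((\<lambda>x. g (f x)) has_derivative
      (\<lambda>v. frechet_derivative g (at (f x)) (frechet_derivative f (at x) v))) (at x)" if "x \<in> S" for x
    by (rule has_derivative_compose[OF Ck_on_Suc_has_derivative[OF Suc.prems(1) that]
          Ck_on_Suc_has_derivative[OF Suc.prems(2)]]) (use that assms(3) in auto)
  have "Ck_on k S (\<lambda>x. frechet_derivative (\<lambda>x. g (f x)) (at x) v)" for v
  proof (rule Ck_on_cong[OF assms(1)])
    have 1: "Ck_on k S (\<lambda>x. frechet_derivative f (at x) v \<bullet> i)" for i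
      by (rule Ck_on_compose_linear[OF bounded_linear_inner_left assms(1)]) (use Suc.prems in simp)
    show "Ck_on k S (\<lambda>x. \<Sum>i\<in>Basis. (frechet_derivative f (at x) v \<bullet> i) *\<^sub>R
        frechet_derivative g (at (f x)) i)"
      by (rule Ck_on_sum[OF assms(1) Ck_on_scaleR[OF assms(1) 1 Suc.IH[OF fk]]]) (use Suc.prems in simp)
    show "(\<Sum>i\<in>Basis. (frechet_derivative f (at x) v \<bullet> i) *\<^sub>R frechet_derivative g (at (f x)) i)
        = frechet_derivative (\<lambda>x. g (f x)) (at x) v" if "x \<in> S" for x
    proof -
      have "linear (frechet_derivative g (at (f x)))"
        using that Suc.prems assms(3) by (auto intro!: linear_frechet_derivative)
      from linear_expand_Basis[OF this, symmetric] frechet_derivative_eqI[OF d[OF that]]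
      show ?thesis by simp
    qed
  qed
  then show ?case using d by (auto simp: differentiable_def)
qed

lemma Ck_on_Pair:
  assumes "open S" "Ck_on k S f" "Ck_on k S g"
  shows "Ck_on k S (\<lambda>x. (f x, g x))"
proof -
  have "bounded_linear (\<lambda>y::'b. (y, 0::'c))" "bounded_linear (\<lambda>y::'c. (0::'b, y))"
    by (auto intro: bounded_linear_Pair bounded_linear_ident bounded_linear_zero)
  then have "Ck_on k S (\<lambda>x. (f x, 0) + (0, g x))"
    using assms by (intro Ck_on_add) (auto intro: Ck_on_compose_linear)
  then show ?thesis by simp
qed

section \<open>Smoothness at a point\<close>

text \<open>
  Smoothness near a point composes, and passes to functions that are eventually equal, without any
  bookkeeping of domains.
\<close>

definition smooth_at :: "'a::euclidean_space \<Rightarrow> ('a \<Rightarrow> 'b::euclidean_space) \<Rightarrow> bool" where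
  "smooth_at x f \<longleftrightarrow> (\<exists>U. open U \<and> x \<in> U \<and> smooth_on U f)"

lemma smooth_onD: "smooth_on S f \<Longrightarrow> T \<subseteq> S \<Longrightarrow> Ck_on k T f"
  unfolding smooth_on_def by (rule Ck_on_mono) auto

lemma smooth_on_subset: "smooth_on S f \<Longrightarrow> T \<subseteq> S \<Longrightarrow> smooth_on T f"
  unfolding smooth_on_def[of T] using smooth_onD by blast

lemma smooth_on_differentiable: "smooth_on S f \<Longrightarrow> x \<in> S \<Longrightarrow> f differentiable (at x)"
  using smooth_onD[of S f S "Suc 0"] by simp

lemma smooth_on_frechet_derivative:
  "smooth_on S f \<Longrightarrow> smooth_on S (\<lambda>y. frechet_derivative f (at y) v)"
  unfolding smooth_on_def using Ck_on.simps(2)[of _ S f] by blast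

lemma smooth_on_if_smooth_at:
  assumes "\<And>x. x \<in> S \<Longrightarrow> smooth_at x f"
  shows "smooth_on S f"
proof -
  have "S \<subseteq> \<Union>{U. open U \<and> smooth_on U f}"
    using assms by (auto simp: smooth_at_def)
  moreover have "smooth_on (\<Union>{U. open U \<and> smooth_on U f}) f"
    unfolding smooth_on_def[of "\<Union>_"]
  proof
    show "Ck_on k (\<Union>{U. open U \<and> smooth_on U f}) f" for k
      by (rule Ck_on_Union) (auto intro: smooth_onD)
  qed
  ultimately show ?thesis
    using smooth_on_subset by blast
qed

lemma smooth_on_imp_smooth_at: "smooth_on S f \<Longrightarrow> open S \<Longrightarrow> x \<in> S \<Longrightarrow> smooth_at x f"
  by (auto simp: smooth_at_def)

lemma smooth_at_cong_ev:
  assumes "eventually (\<lambda>y. f y = g y) (nhds x)" "smooth_at x f"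
  shows "smooth_at x g"
proof -
  obtain U V where U: "open U" "x \<in> U" "smooth_on U f" and V: "open V" "x \<in> V" "\<forall>y\<in>V. f y = g y"
    using assms by (auto simp: smooth_at_def eventually_nhds)
  have "Ck_on k (U \<inter> V) g" for k
    by (rule Ck_on_cong[OF _ _ smooth_onD[OF U(3)]]) (use U V in auto)
  then have "smooth_on (U \<inter> V) g"
    by (simp add: smooth_on_def)
  then show ?thesis
    using U V unfolding smooth_at_def by (intro exI[of _ "U \<inter> V"]) auto
qed

lemma smooth_at_eventually: "smooth_at x f \<Longrightarrow> eventually (\<lambda>y. smooth_at y f) (nhds x)"
  unfolding smooth_at_def eventually_nhds by blast

lemma smooth_at_differentiable: "smooth_at x f \<Longrightarrow> f differentiable (at x)"
  unfolding smooth_at_def using smooth_on_differentiable by blast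

lemma smooth_at_has_derivative: "smooth_at x f \<Longrightarrow> (f has_derivative frechet_derivative f (at x)) (at x)"
  using smooth_at_differentiable frechet_derivative_works by blast

lemma smooth_at_isCont: "smooth_at x f \<Longrightarrow> isCont f x"
  by (simp add: differentiable_imp_continuous_within smooth_at_differentiable)

lemma smooth_at_eventually_image:
  assumes "smooth_at x f" "eventually P (nhds (f x))"
  shows "eventually (\<lambda>y. P (f y)) (nhds x)"
proof -
  have "(f \<longlongrightarrow> f x) (nhds x)"
    using smooth_at_isCont[OF assms(1)] by (simp add: isCont_def tendsto_at_iff_tendsto_nhds)
  then show ?thesis
    using assms(2) by (auto simp: filterlim_iff)
qed

lemma smooth_at_const [simp]: "smooth_at x (\<lambda>y. c)"
  unfolding smooth_at_def smooth_on_def by (auto intro!: exI[of _ UNIV] Ck_on_const)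

lemma smooth_at_bounded_linear: "bounded_linear L \<Longrightarrow> smooth_at x L"
  unfolding smooth_at_def smooth_on_def by (auto intro!: exI[of _ UNIV] Ck_on_bounded_linear)

lemma smooth_at_ident [simp]: "smooth_at x (\<lambda>y. y)"
  by (simp add: smooth_at_bounded_linear)

lemma smooth_at_binop:
  assumes "smooth_at x f" "smooth_at x g"
    and "\<And>U k. open U \<Longrightarrow> Ck_on k U f \<Longrightarrow> Ck_on k U g \<Longrightarrow> Ck_on k U h"
  shows "smooth_at x h"
proof -
  obtain U V where U: "open U" "x \<in> U" "smooth_on U f" and V: "open V" "x \<in> V" "smooth_on V g"
    using assms by (auto simp: smooth_at_def)
  have "Ck_on k (U \<inter> V) h" for k
    by (rule assms(3)[OF _ smooth_onD[OF U(3)] smooth_onD[OF V(3)]]) (use U V in auto)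
  then show ?thesis
    using U V unfolding smooth_at_def smooth_on_def by (intro exI[of _ "U \<inter> V"]) auto
qed

lemma smooth_at_add: "smooth_at x f \<Longrightarrow> smooth_at x g \<Longrightarrow> smooth_at x (\<lambda>x. f x + g x)"
  by (rule smooth_at_binop[of x f g]) (auto intro: Ck_on_add)

lemma smooth_at_scaleR: "smooth_at x f \<Longrightarrow> smooth_at x g \<Longrightarrow> smooth_at x (\<lambda>x. f x *\<^sub>R g x)"
  by (rule smooth_at_binop[of x f g]) (auto intro: Ck_on_scaleR)

lemma smooth_at_Pair: "smooth_at x f \<Longrightarrow> smooth_at x g \<Longrightarrow> smooth_at x (\<lambda>x. (f x, g x))"
  by (rule smooth_at_binop[of x f g]) (auto intro: Ck_on_Pair)

lemma smooth_at_sum: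
  "(\<And>i. i \<in> I \<Longrightarrow> smooth_at x (f i)) \<Longrightarrow> smooth_at x (\<lambda>x. \<Sum>i\<in>I. f i x)"
  by (induction I rule: infinite_finite_induct) (auto intro!: smooth_at_add)

lemma smooth_at_frechet_derivative:
  "smooth_at x f \<Longrightarrow> smooth_at x (\<lambda>y. frechet_derivative f (at y) v)"
  unfolding smooth_at_def using smooth_on_frechet_derivative by blast

lemma smooth_at_compose:
  assumes "smooth_at x f" "smooth_at (f x) g"
  shows "smooth_at x (\<lambda>y. g (f y))"
proof -
  obtain U V where U: "open U" "x \<in> U" "smooth_on U f" and V: "open V" "f x \<in> V" "smooth_on V g"
    using assms by (auto simp: smooth_at_def)
  have c: "continuous_on U f" using Ck_on_imp_continuous_on[OF smooth_onD[OF U(3) subset_refl, of 0]] .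
  let ?W = "U \<inter> f -` V"
  have o: "open ?W" using c U(1) V(1) by (rule continuous_open_preimage)
  have "Ck_on k ?W (\<lambda>y. g (f y))" for k
    by (rule Ck_on_compose[OF o V(1) _ smooth_onD[OF U(3)] smooth_onD[OF V(3)]]) auto
  then have "smooth_on ?W (\<lambda>y. g (f y))"
    by (simp add: smooth_on_def)
  moreover have "x \<in> ?W"
    using U V by simp
  ultimately show ?thesis
    unfolding smooth_at_def using o by (intro exI conjI)
qed

lemma smooth_at_linear: "bounded_linear L \<Longrightarrow> smooth_at x f \<Longrightarrow> smooth_at x (\<lambda>y. L (f y))"
  using smooth_at_compose[OF _ smooth_at_bounded_linear] .

lemmas smooth_at_inner_left = smooth_at_linear[OF bounded_linear_inner_left]

lemma smooth_at_projections [simp]: "smooth_at x fst" "smooth_at x snd"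
  by (simp_all add: smooth_at_bounded_linear bounded_linear_fst bounded_linear_snd)

lemma smooth_at_Pair_const: "smooth_at b (\<lambda>b. (a, b))"
  by (rule smooth_at_Pair[OF smooth_at_const smooth_at_ident])

lemma frechet_derivative_Pair_const: "frechet_derivative (\<lambda>b. (a, b)) (at b) q = (0, q)"
proof (rule frechet_derivative_eqI)
  show "((\<lambda>b. (a, b)) has_derivative (\<lambda>q. (0, q))) (at b)"
    by (auto intro!: derivative_eq_intros)
qed

lemma frechet_derivative_chain:
  assumes "smooth_at x f" "smooth_at (f x) g"
  shows "frechet_derivative (\<lambda>y. g (f y)) (at x) v
       = frechet_derivative g (at (f x)) (frechet_derivative f (at x) v)"
proof -
  have "((\<lambda>y. g (f y)) has_derivative (\<lambda>v. frechet_derivative g (at (f x)) (frechet_derivative f (at x) v))) (at x)"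
    using has_derivative_compose[OF assms[THEN smooth_at_has_derivative]] .
  from frechet_derivative_eqI[OF this] show ?thesis .
qed

lemma smooth_at_linear_frechet_derivative:
  "smooth_at x f \<Longrightarrow> linear (frechet_derivative f (at x))"
  by (simp add: linear_frechet_derivative smooth_at_differentiable)

lemma smooth_at_has_vector_derivative:
  assumes "smooth_at t f"
  shows "(f has_vector_derivative frechet_derivative f (at t) 1) (at t)"
proof -
  let ?D = "frechet_derivative f (at t)"
  have "?D s = s *\<^sub>R ?D 1" for s
    using linear_scale[OF smooth_at_linear_frechet_derivative[OF assms], of s 1] by simp
  then have "?D = (\<lambda>s. s *\<^sub>R ?D 1)" by (rule ext)
  with smooth_at_has_derivative[OF assms] show ?thesis
    by (simp only: has_vector_derivative_def)
qed

text \<open>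
  The derivative of \<open>f\<close> is smooth jointly in the point and the direction, being linear in the
  direction. In coordinates this is what makes tangent maps smooth.
\<close>

lemma smooth_at_directional_derivative:
  fixes f :: "'a::euclidean_space \<Rightarrow> 'b::euclidean_space" and a w :: "'c::euclidean_space \<Rightarrow> 'a"
  assumes "smooth_at (a x) f" "smooth_at x a" "smooth_at x w"
  shows "smooth_at x (\<lambda>y. frechet_derivative f (at (a y)) (w y))"
proof (rule smooth_at_cong_ev)
  show "smooth_at x (\<lambda>y. \<Sum>i\<in>Basis. (w y \<bullet> i) *\<^sub>R frechet_derivative f (at (a y)) i)"
  proof (intro smooth_at_sum smooth_at_scaleR)
    show "smooth_at x (\<lambda>y. w y \<bullet> i)" for i
      using assms(3) by (rule smooth_at_inner_left)
    show "smooth_at x (\<lambda>y. frechet_derivative f (at (a y)) i)" for i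
      using smooth_at_compose[OF assms(2) smooth_at_frechet_derivative[OF assms(1)]] .
  qed
  have "eventually (\<lambda>y. smooth_at (a y) f) (nhds x)"
    using smooth_at_eventually_image[OF assms(2) smooth_at_eventually[OF assms(1)]] .
  then show "\<forall>\<^sub>F y in nhds x. (\<Sum>i\<in>Basis. (w y \<bullet> i) *\<^sub>R frechet_derivative f (at (a y)) i)
      = frechet_derivative f (at (a y)) (w y)"
    using linear_expand_Basis[OF smooth_at_linear_frechet_derivative, symmetric]
    by (rule eventually_mono)
qed

section \<open>The inverse function theorem for smooth maps\<close>

text \<open>
  The map \<open>(x, z) \<mapsto> h'(x) z\<close> is linear in \<open>z\<close>, so its derivative in the direction of \<open>z\<close> is
  \<open>h'(x)\<close> itself. Only this part of the derivative has to be known explicitly, both for inverting it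
  and for extracting second derivatives of curves.
\<close>

lemma frechet_derivative_partial_linear:
  fixes h :: "'a::euclidean_space \<Rightarrow> 'b::euclidean_space"
  assumes "smooth_at x h"
  obtains F where "((\<lambda>u. frechet_derivative h (at (fst u)) (snd u)) has_derivative F) (at (x, z))"
    "\<And>p q. F (p, q) = F (p, 0) + frechet_derivative h (at x) q"
proof -
  let ?E = "\<lambda>u. frechet_derivative h (at (fst u)) (snd u)"
  have sm: "smooth_at (x, z) ?E"
    by (rule smooth_at_directional_derivative)
       (use assms in simp_all)
  let ?F = "frechet_derivative ?E (at (x, z))"
  have F: "(?E has_derivative ?F) (at (x, z))"
    by (rule smooth_at_has_derivative[OF sm])
  have lin: "linear (frechet_derivative h (at x))"
    by (rule smooth_at_linear_frechet_derivative[OF assms])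
  have 0: "?F (0, q) = frechet_derivative h (at x) q" for q
  proof -
    have "((\<lambda>y. (x, y)) has_derivative (\<lambda>q. (0, q))) (at z)"
      by (auto intro!: derivative_eq_intros)
    from has_derivative_compose[OF this F]
    have "((\<lambda>y. frechet_derivative h (at x) y) has_derivative (\<lambda>q. ?F (0, q))) (at z)"
      by simp
    moreover have "((\<lambda>y. frechet_derivative h (at x) y) has_derivative frechet_derivative h (at x)) (at z)"
      using lin by (simp add: linear_conv_bounded_linear bounded_linear_imp_has_derivative)
    ultimately show ?thesis
      by (rule fun_cong[OF has_derivative_unique])
  qed
  have "?F (p, q) = ?F (p, 0) + frechet_derivative h (at x) q" for p q
    using linear_add[OF smooth_at_linear_frechet_derivative[OF sm], of "(p, 0)" "(0, q)"] 0 by simp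
  with F show ?thesis
    by (rule that)
qed

text \<open>
  The map \<open>(x, z) \<mapsto> (x, h'(x) z)\<close> has the inverse \<open>(x, v) \<mapsto> (x, h'(x)\<inverse> v)\<close> and an invertible
  derivative. By invariance of domain, the inverse of a continuous injective map with invertible
  derivative at a point is differentiable at the image of that point.
\<close>

lemma inverse_derivative_differentiable:
  fixes h :: "'a::euclidean_space \<Rightarrow> 'a"
  assumes "open U" "smooth_on U h" "\<And>x. x \<in> U \<Longrightarrow> bij (frechet_derivative h (at x))" "x \<in> U"
  shows "(\<lambda>x. inv_into UNIV (frechet_derivative h (at x)) v) differentiable (at x)"
proof -
  let ?D = "\<lambda>x. frechet_derivative h (at x)"
  let ?\<Phi> = "\<lambda>u. (fst u, ?D (fst u) (snd u))"
  let ?\<Psi> = "\<lambda>u. (fst u, inv_into UNIV (?D (fst u)) (snd u))"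
  define z where "z = inv_into UNIV (?D x) v"
  have sm: "smooth_at y h" if "y \<in> U" for y
    using smooth_on_imp_smooth_at[OF assms(2,1) that] .
  have z: "?D x z = v"
    using assms(3)[OF assms(4)] by (simp add: z_def bij_is_surj surj_f_inv_f)
  obtain F where F: "((\<lambda>u. ?D (fst u) (snd u)) has_derivative F) (at (x, z))"
    and Fpq: "\<And>p q. F (p, q) = F (p, 0) + ?D x q"
    using frechet_derivative_partial_linear[OF sm[OF assms(4)]] by blast
  have "(?\<Psi> has_derivative (\<lambda>u. (fst u, inv_into UNIV (?D x) (snd u - F (fst u, 0))))) (at (?\<Phi> (x, z)))"
  proof (rule has_derivative_inverse_strong[of "U \<times> UNIV" "(x, z)" ?\<Phi>])
    show "open (U \<times> (UNIV::'a set))"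
      using assms(1) by (simp add: open_Times)
    show "continuous_on (U \<times> UNIV) ?\<Phi>"
    proof (intro continuous_at_imp_continuous_on ballI)
      fix u :: "'a \<times> 'a" assume "u \<in> U \<times> UNIV"
      then have "smooth_at (fst u) h" by (auto intro: sm)
      then have "smooth_at u (\<lambda>u. ?D (fst u) (snd u))"
        by (rule smooth_at_directional_derivative)
           simp_all
      then show "isCont ?\<Phi> u"
        by (auto dest: smooth_at_isCont intro!: continuous_intros)
    qed
    show "?\<Psi> (?\<Phi> u) = u" if "u \<in> U \<times> UNIV" for u
      using that assms(3) by (auto simp: bij_is_inj)
    show "(?\<Phi> has_derivative (\<lambda>u. (fst u, F u))) (at (x, z))"
      using F by (auto intro!: derivative_eq_intros)
    show "(\<lambda>u. (fst u, F u)) \<circ> (\<lambda>u. (fst u, inv_into UNIV (?D x) (snd u - F (fst u, 0)))) = id"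
    proof
      fix u :: "'a \<times> 'a"
      have "?D x (inv_into UNIV (?D x) w) = w" for w
        using assms(3)[OF assms(4)] by (simp add: bij_is_surj surj_f_inv_f)
      then show "((\<lambda>u. (fst u, F u)) \<circ> (\<lambda>u. (fst u, inv_into UNIV (?D x) (snd u - F (fst u, 0))))) u = id u"
        using Fpq[of "fst u" "inv_into UNIV (?D x) (snd u - F (fst u, 0))"] by (cases u) simp
    qed
  qed (use assms(4) in simp)
  then have "?\<Psi> differentiable (at (x, v))"
    unfolding differentiable_def using z by auto
  moreover have "(\<lambda>x. (x, v)) differentiable (at x)"
    unfolding differentiable_def
    by (intro exI[of _ "\<lambda>p. (p, 0)"]) (auto intro!: derivative_eq_intros)
  ultimately have "(?\<Psi> \<circ> (\<lambda>x. (x, v))) differentiable (at x)"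
    by (intro differentiable_chain_at) auto
  then obtain D where "((\<lambda>x. ?\<Psi> (x, v)) has_derivative D) (at x)"
    by (auto simp: differentiable_def o_def)
  from has_derivative_snd[OF this] show ?thesis
    unfolding differentiable_def by auto
qed

text \<open>
  Put \<open>B v x = h'(x)\<inverse> v\<close>. Differentiating \<open>h'(x) (B v x) = v\<close> expresses the derivative of
  \<open>B v\<close> through the functions \<open>B j\<close> and second derivatives of \<open>h\<close>, so if all the \<open>B v\<close> are of class
  \<open>C\<^sup>k\<close>, then they are of class \<open>C\<^sup>k\<^sup>+\<^sup>1\<close>.
\<close>

lemma smooth_on_inverse_derivative:
  fixes h :: "'a::euclidean_space \<Rightarrow> 'a"
  assumes U: "open U" and sm: "smooth_on U h" and bij: "\<And>x. x \<in> U \<Longrightarrow> bij (frechet_derivative h (at x))"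
  shows "smooth_on U (\<lambda>x. inv_into UNIV (frechet_derivative h (at x)) v)"
proof -
  let ?D = "\<lambda>x. frechet_derivative h (at x)"
  define B where "B v x = inv_into UNIV (?D x) v" for v x
  define z where "z v w x = (\<Sum>i\<in>Basis. (B v x \<bullet> i) *\<^sub>R frechet_derivative (\<lambda>y. ?D y i) (at x) w)" for v w x
  have lin: "linear (?D x)" if "x \<in> U" for x
    using smooth_at_linear_frechet_derivative[OF smooth_on_imp_smooth_at[OF sm U that]] .
  have DB: "?D x (B v x) = v" "B (?D x v) x = v" if "x \<in> U" for v x
    using bij[OF that] by (auto simp: B_def bij_is_surj bij_is_inj surj_f_inv_f)
  have linB: "linear (\<lambda>v. B v x)" if "x \<in> U" for x
  proof -
    have "?D x \<circ> inv_into UNIV (?D x) = id"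
      using bij_is_surj[OF bij[OF that]] by (simp add: surj_iff)
    then have "linear (inv_into UNIV (?D x))"
      by (rule right_inverse_linear[OF lin[OF that]])
    then show ?thesis by (simp add: B_def)
  qed
  have dB: "(B v) differentiable (at x)" if "x \<in> U" for v x
    unfolding B_def by (rule inverse_derivative_differentiable[OF U sm bij that])
  \<comment> \<open>obtained by differentiating \<open>h'(x) (B v x) = v\<close>, expanded in the standard basis, and applying \<open>h'(x)\<inverse>\<close>\<close>
  have d: "frechet_derivative (B v) (at x) w = - (\<Sum>j\<in>Basis. (z v w x \<bullet> j) *\<^sub>R B j x)" if x: "x \<in> U" for v w x
  proof -
    let ?b = "frechet_derivative (B v) (at x)"
    have b: "(B v has_derivative ?b) (at x)"
      using dB[OF x] by (simp add: frechet_derivative_works)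
    have Di: "((\<lambda>y. ?D y i) has_derivative frechet_derivative (\<lambda>y. ?D y i) (at x)) (at x)" for i
      by (rule smooth_at_has_derivative[OF smooth_at_frechet_derivative[OF smooth_on_imp_smooth_at[OF sm U x]]])
    have "((\<lambda>y. \<Sum>i\<in>Basis. (B v y \<bullet> i) *\<^sub>R ?D y i) has_derivative
       (\<lambda>w. \<Sum>i\<in>Basis. (B v x \<bullet> i) *\<^sub>R frechet_derivative (\<lambda>y. ?D y i) (at x) w + (?b w \<bullet> i) *\<^sub>R ?D x i)) (at x)"
      by (intro has_derivative_sum has_derivative_scaleR Di has_derivative_inner_left b)
    moreover have "\<forall>\<^sub>F y in nhds x. (\<Sum>i\<in>Basis. (B v y \<bullet> i) *\<^sub>R ?D y i) = v"
    proof (rule eventually_mono)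
      show "\<forall>\<^sub>F y in nhds x. y \<in> U" using U x by (simp add: eventually_nhds_in_open)
      show "(\<Sum>i\<in>Basis. (B v y \<bullet> i) *\<^sub>R ?D y i) = v" if "y \<in> U" for y
        using linear_expand_Basis[OF lin[OF that], of "B v y"] DB[OF that] by simp
    qed
    ultimately have "((\<lambda>y. v) has_derivative
       (\<lambda>w. \<Sum>i\<in>Basis. (B v x \<bullet> i) *\<^sub>R frechet_derivative (\<lambda>y. ?D y i) (at x) w + (?b w \<bullet> i) *\<^sub>R ?D x i)) (at x)"
      using has_derivative_cong_nhds by fastforce
    then have "(\<lambda>w. \<Sum>i\<in>Basis. (B v x \<bullet> i) *\<^sub>R frechet_derivative (\<lambda>y. ?D y i) (at x) w + (?b w \<bullet> i) *\<^sub>R ?D x i)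
        = (\<lambda>w. 0)"
      using has_derivative_const has_derivative_unique by blast
    from fun_cong[OF this, of w]
    have "z v w x + ?D x (?b w) = 0"
      using linear_expand_Basis[OF lin[OF x], of "?b w"] by (simp add: z_def sum.distrib)
    then have "?D x (?b w) = - z v w x"
      by (simp add: add_eq_0_iff2)
    then have "?b w = B (- z v w x) x"
      using DB(2)[OF x, of "?b w"] by simp
    also have "\<dots> = - B (z v w x) x"
      using linear_neg[OF linB[OF x]] by simp
    also have "B (z v w x) x = (\<Sum>j\<in>Basis. (z v w x \<bullet> j) *\<^sub>R B j x)"
      using linear_expand_Basis[OF linB[OF x]] .
    finally show ?thesis .
  qed
  have "Ck_on k U (B v)" for k v
  proof (induction k arbitrary: v)
    case 0
    then show ?case
      using dB by (auto intro!: continuous_at_imp_continuous_on differentiable_imp_continuous_within)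
  next
    case (Suc k)
    have 1: "Ck_on k U (\<lambda>x. B v x \<bullet> i)" for v i
      by (rule Ck_on_compose_linear[OF bounded_linear_inner_left U Suc])
    have 2: "Ck_on k U (\<lambda>x. frechet_derivative (\<lambda>y. ?D y i) (at x) w)" for i w
      by (rule smooth_onD[OF smooth_on_frechet_derivative[OF smooth_on_frechet_derivative[OF sm]] subset_refl])
    have "Ck_on k U (z v w)" for w
      unfolding z_def by (rule Ck_on_sum[OF U Ck_on_scaleR[OF U 1 2]])
    then have 3: "Ck_on k U (\<lambda>x. z v w x \<bullet> j)" for w j
      by (rule Ck_on_compose_linear[OF bounded_linear_inner_left U])
    have 4: "Ck_on k U (\<lambda>x. \<Sum>j\<in>Basis. (z v w x \<bullet> j) *\<^sub>R B j x)" for w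
      by (rule Ck_on_sum[OF U Ck_on_scaleR[OF U 3 Suc]])
    have "Ck_on k U (\<lambda>x. frechet_derivative (B v) (at x) w)" for w
      by (rule Ck_on_cong[OF U _ Ck_on_compose_linear[OF bounded_linear_minus[OF bounded_linear_ident] U 4]])
         (simp add: d)
    then show ?case using dB by simp
  qed
  then have "smooth_on U (B v)"
    by (simp add: smooth_on_def)
  then show ?thesis
    unfolding B_def .
qed

text \<open>
  The local inverse \<open>g\<close> has the derivative \<open>h'(g y)\<inverse>\<close>. If \<open>g\<close> is of class \<open>C\<^sup>k\<close>, then so is
  this composition, hence \<open>g\<close> is of class \<open>C\<^sup>k\<^sup>+\<^sup>1\<close>.
\<close>

lemma smooth_inverse_function:
  fixes h :: "'a::euclidean_space \<Rightarrow> 'a"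
  assumes "smooth_at x h" "bij (frechet_derivative h (at x))"
  obtains k where "smooth_at (h x) k" "k (h x) = x" "\<forall>\<^sub>F y in nhds (h x). h (k y) = y"
proof -
  let ?D = "\<lambda>x. frechet_derivative h (at x)"
  obtain U where U: "open U" "x \<in> U" "smooth_on U h"
    using assms(1) by (auto simp: smooth_at_def)
  have sm: "smooth_at y h" if "y \<in> U" for y
    using smooth_on_imp_smooth_at[OF U(3,1) that] .
  have bl: "bounded_linear (?D y)" if "y \<in> U" for y
    using smooth_at_linear_frechet_derivative[OF sm[OF that]] by (simp add: linear_conv_bounded_linear)
  define D where "D y = Blinfun (?D y)" for y
  have D: "blinfun_apply (D y) = ?D y" if "y \<in> U" for y
    using bl[OF that] by (simp add: D_def bounded_linear_Blinfun_apply)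
  have "?D x \<circ> inv_into UNIV (?D x) = id"
    using bij_is_surj[OF assms(2)] by (simp add: surj_iff)
  then have "bounded_linear (inv_into UNIV (?D x))"
    using bl[OF U(2)] right_inverse_linear by (simp add: linear_conv_bounded_linear[symmetric])
  then have inv: "Blinfun (inv_into UNIV (?D x)) o\<^sub>L D x = id_blinfun"
    using assms(2) D[OF U(2)]
    by (intro blinfun_eqI) (simp add: bounded_linear_Blinfun_apply bij_is_inj)
  have cont: "continuous_on U D"
  proof (rule continuous_on_blinfun_componentwise)
    fix i :: 'a
    have "continuous_on U (\<lambda>y. ?D y i)"
      by (rule Ck_on_imp_continuous_on[OF smooth_onD[OF smooth_on_frechet_derivative[OF U(3)] subset_refl, of 0]])
    then show "continuous_on U (\<lambda>y. blinfun_apply (D y) i)"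
      by (rule continuous_on_eq) (simp add: D)
  qed
  have der: "(h has_derivative blinfun_apply (D y)) (at y)" if "y \<in> U" for y
    using smooth_at_has_derivative[OF sm[OF that]] D[OF that] by simp
  obtain U' V g g' where *: "open U'" "U' \<subseteq> U" "x \<in> U'" "open V" "h x \<in> V" "homeomorphism U' V h g"
    and g': "\<And>y. y \<in> V \<Longrightarrow> (g has_derivative g' y) (at y)"
      "\<And>y. y \<in> V \<Longrightarrow> g' y = inv_into UNIV (blinfun_apply (D (g y)))"
      "\<And>y. y \<in> V \<Longrightarrow> bij (blinfun_apply (D (g y)))"
    using inverse_function_theorem[OF U(1) der cont U(2) inv] by blast
  have gV: "g y \<in> U'" "h (g y) = y" if "y \<in> V" for y
    using *(6) that by (auto simp: homeomorphism_def)
  have gh: "g (h y) = y" "h y \<in> V" if "y \<in> U'" for y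
    using *(6) that by (auto simp: homeomorphism_def)
  have bij: "bij (?D y)" if "y \<in> U'" for y
    using g'(3)[OF gh(2)[OF that]] gh(1)[OF that] D[of y] that *(2) by auto
  have smI: "smooth_on U' (\<lambda>y. inv_into UNIV (?D y) v)" for v
    by (rule smooth_on_inverse_derivative[OF *(1) smooth_on_subset[OF U(3) *(2)] bij])
  have fd: "frechet_derivative g (at y) v = inv_into UNIV (?D (g y)) v" if "y \<in> V" for y v
    using frechet_derivative_eqI[OF g'(1)[OF that], of v] g'(2)[OF that] D[of "g y"] gV[OF that] *(2) by auto
  have "Ck_on k V g" for k
  proof (induction k)
    case 0
    show ?case using *(6) by (simp add: homeomorphism_def)
  next
    case (Suc k)
    have "Ck_on k V (\<lambda>y. inv_into UNIV (?D (g y)) v)" for v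
      using Ck_on_compose[OF *(4,1) _ Suc smooth_onD[OF smI subset_refl]] gV by blast
    then have "Ck_on k V (\<lambda>y. frechet_derivative g (at y) v)" for v
      by (rule Ck_on_cong[OF *(4), rotated]) (simp add: fd)
    moreover have "g differentiable (at y)" if "y \<in> V" for y
      using g'(1)[OF that] by (auto simp: differentiable_def)
    ultimately show ?case by simp
  qed
  then have "smooth_at (h x) g"
    unfolding smooth_at_def smooth_on_def using * by blast
  moreover have "\<forall>\<^sub>F y in nhds (h x). h (g y) = y"
    using * gV by (auto simp: eventually_nhds)
  ultimately show ?thesis
    using that gh(1)[OF *(3)] by blast
qed

text \<open>
  If \<open>R\<close> is a linear right inverse of the derivative of \<open>f\<close> at \<open>x\<close>, then \<open>f\<close> restricted to the
  affine subspace \<open>x + range R\<close> has an invertible derivative, and its inverse is a section of \<open>f\<close>.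
\<close>

lemma smooth_local_right_inverse:
  fixes f :: "'a::euclidean_space \<Rightarrow> 'b::euclidean_space"
  assumes sm: "smooth_at x f" and surj: "surj (frechet_derivative f (at x))"
  obtains s where "smooth_at (f x) s" "s (f x) = x" "\<forall>\<^sub>F y in nhds (f x). f (s y) = y"
proof -
  obtain R where R: "linear R" "frechet_derivative f (at x) \<circ> R = id"
    using linear_surjective_right_inverse[OF smooth_at_linear_frechet_derivative[OF sm] surj] by blast
  have bl: "bounded_linear R" using R(1) by (simp add: linear_conv_bounded_linear)
  let ?a = "\<lambda>y. x + R (y - f x)"
  have a: "smooth_at y ?a" for y
  proof -
    have 1: "smooth_at y (\<lambda>y. y - f x)"
      using smooth_at_add[OF smooth_at_ident smooth_at_const, of y "- f x"] by simp
    show ?thesis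
      by (rule smooth_at_add[OF smooth_at_const smooth_at_linear[OF bl 1]])
  qed
  have ax: "?a (f x) = x" by (simp add: linear_0[OF R(1)])
  have "((\<lambda>y. y - f x) has_derivative (\<lambda>v. v)) (at (f x))"
    by (auto intro!: derivative_eq_intros)
  from has_derivative_add[OF has_derivative_const[of x] bounded_linear.has_derivative[OF bl this]]
  have "(?a has_derivative R) (at (f x))"
    by simp
  then have da: "frechet_derivative ?a (at (f x)) v = R v" for v
    by (rule frechet_derivative_eqI)
  let ?h = "\<lambda>y. f (?a y)"
  have h: "smooth_at (f x) ?h"
    using smooth_at_compose[OF a[of "f x"], of f] sm ax by simp
  have hx: "?h (f x) = f x" using ax by simp
  have "frechet_derivative ?h (at (f x)) v = v" for v
    using frechet_derivative_chain[OF a[of "f x"], of f v] sm ax da fun_cong[OF R(2), of v] by simp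
  then have "frechet_derivative ?h (at (f x)) = id" by auto
  then have "bij (frechet_derivative ?h (at (f x)))" by simp
  from smooth_inverse_function[OF h this]
  obtain k where k: "smooth_at (f x) k" "k (f x) = f x" "\<forall>\<^sub>F y in nhds (f x). ?h (k y) = y"
    using hx by metis
  show ?thesis
  proof (rule that)
    show "smooth_at (f x) (\<lambda>y. ?a (k y))"
      by (rule smooth_at_compose[OF k(1) a])
    show "?a (k (f x)) = x" using k(2) ax by simp
    show "\<forall>\<^sub>F y in nhds (f x). f (?a (k y)) = y" by (rule k(3))
  qed
qed

section \<open>Charts and atlases\<close>

lemma openI_eventually:
  assumes "\<And>x. x \<in> S \<Longrightarrow> eventually (\<lambda>y. y \<in> S) (nhds x)"
  shows "open S"
proof (subst open_subopen, intro ballI)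
  fix x assume "x \<in> S"
  then obtain T where "open T" "x \<in> T" "\<forall>y\<in>T. y \<in> S"
    using assms by (auto simp: eventually_nhds)
  then show "\<exists>T. open T \<and> x \<in> T \<and> T \<subseteq> S" by blast
qed

lemma topological_chartD:
  assumes "topological_chart T c"
  shows "openin T (fst c)" "open (snd c ` fst c)" "inj_on (snd c) (fst c)"
    and "\<And>V. openin T V \<Longrightarrow> open (snd c ` (fst c \<inter> V))"
    and "\<And>W. open W \<Longrightarrow> openin T {p \<in> fst c. snd c p \<in> W}"
proof -
  show o: "openin T (fst c)" "open (snd c ` fst c)"
    using assms by (auto simp: topological_chart_def)
  have h: "homeomorphic_map (subtopology T (fst c)) (top_of_set (snd c ` fst c)) (snd c)"
    using assms by (auto simp: topological_chart_def)
  have ts: "topspace (subtopology T (fst c)) = fst c"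
    using openin_subset[OF o(1)] by auto
  show "inj_on (snd c) (fst c)"
    using homeomorphic_imp_injective_map[OF h] ts by simp
  show "open (snd c ` (fst c \<inter> V))" if "openin T V" for V
  proof -
    have "openin (subtopology T (fst c)) (fst c \<inter> V)"
      using that by (auto simp: openin_subtopology)
    then have "openin (top_of_set (snd c ` fst c)) (snd c ` (fst c \<inter> V))"
      using homeomorphic_imp_open_map[OF h] by (simp add: open_map_def)
    then show ?thesis
      using o(2) by (simp add: openin_open_eq)
  qed
  show "openin T {p \<in> fst c. snd c p \<in> W}" if "open W" for W
  proof -
    have "openin (top_of_set (snd c ` fst c)) (snd c ` fst c \<inter> W)"
      using that by (simp add: openin_open_Int)
    then have "openin (subtopology T (fst c)) {p \<in> fst c. snd c p \<in> snd c ` fst c \<inter> W}"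
      using openin_continuous_map_preimage[OF homeomorphic_imp_continuous_map[OF h]] ts by metis
    moreover have "{p \<in> fst c. snd c p \<in> snd c ` fst c \<inter> W} = {p \<in> fst c. snd c p \<in> W}"
      by auto
    ultimately show ?thesis
      using openin_open_subtopology[OF o(1)] by auto
  qed
qed

lemma topological_chartI:
  assumes "openin T S" "inj_on f S"
    and "\<And>W. open W \<Longrightarrow> openin T {p \<in> S. f p \<in> W}"
    and "\<And>V. openin T V \<Longrightarrow> V \<subseteq> S \<Longrightarrow> open (f ` V)"
  shows "topological_chart T (S, f)"
proof -
  have ts: "topspace (subtopology T S) = S"
    using openin_subset[OF assms(1)] by auto
  have "homeomorphic_map (subtopology T S) (top_of_set (f ` S)) f"
  proof (rule bijective_open_imp_homeomorphic_map)
    show "continuous_map (subtopology T S) (top_of_set (f ` S)) f"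
      unfolding continuous_map_def ts
    proof (intro conjI allI impI)
      fix U assume "openin (top_of_set (f ` S)) U"
      then obtain W where "open W" "U = f ` S \<inter> W"
        by (auto simp: openin_open)
      then have "{x \<in> S. f x \<in> U} = {x \<in> S. f x \<in> W}" "openin T {x \<in> S. f x \<in> W}"
        using assms(3) by auto
      then show "openin (subtopology T S) {x \<in> S. f x \<in> U}"
        using openin_open_subtopology[OF assms(1)] by auto
    qed auto
    show "open_map (subtopology T S) (top_of_set (f ` S)) f"
      unfolding open_map_def
    proof (intro allI impI)
      fix U assume "openin (subtopology T S) U"
      then have "openin T U" "U \<subseteq> S"
        using openin_open_subtopology[OF assms(1)] by auto
      then show "openin (top_of_set (f ` S)) (f ` U)"
        using assms(4) by (auto intro!: open_subset)
    qed
  qed (use ts assms(2) in auto)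
  then show ?thesis
    using assms(1) assms(4)[OF assms(1)] by (simp add: topological_chart_def)
qed

lemma chart_inv_chart: "topological_chart T c \<Longrightarrow> p \<in> fst c \<Longrightarrow> chart_inv c (snd c p) = p"
  by (simp add: chart_inv_def topological_chartD(3))

lemma chart_inv_in: "x \<in> snd c ` fst c \<Longrightarrow> chart_inv c x \<in> fst c"
  by (simp add: chart_inv_def inv_into_into)

lemma chart_chart_inv: "x \<in> snd c ` fst c \<Longrightarrow> snd c (chart_inv c x) = x"
  by (simp add: chart_inv_def f_inv_into_f)

text \<open>
  Openness conditions on a manifold turn into \<open>eventually\<close> statements about coordinates, which
  combine without naming neighbourhoods.
\<close>

lemma chart_eventually:
  assumes "topological_chart T c" "openin T V" "p \<in> fst c" "p \<in> V"
  shows "\<forall>\<^sub>F x in nhds (snd c p). x \<in> snd c ` fst c \<and> chart_inv c x \<in> fst c \<and> chart_inv c x \<in> V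
      \<and> snd c (chart_inv c x) = x"
proof (rule eventually_mono)
  show "\<forall>\<^sub>F x in nhds (snd c p). x \<in> snd c ` (fst c \<inter> V)"
    using topological_chartD(4)[OF assms(1,2)] assms(3,4) by (intro eventually_nhds_in_open) auto
  fix x assume "x \<in> snd c ` (fst c \<inter> V)"
  then obtain q where "q \<in> fst c" "q \<in> V" "x = snd c q" by blast
  then show "x \<in> snd c ` fst c \<and> chart_inv c x \<in> fst c \<and> chart_inv c x \<in> V \<and> snd c (chart_inv c x) = x"
    using chart_inv_chart[OF assms(1)] by auto
qed

lemma topological_chart_restrict:
  assumes "topological_chart T c" "openin T V"
  shows "topological_chart T (fst c \<inter> V, snd c)"
proof (rule topological_chartI)
  show "openin T (fst c \<inter> V)"
    using topological_chartD(1)[OF assms(1)] assms(2) by auto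
  show "inj_on (snd c) (fst c \<inter> V)"
    using topological_chartD(3)[OF assms(1)] by (auto simp: inj_on_def)
  fix W :: "'b set" assume "open W"
  then have "openin T ({p \<in> fst c. snd c p \<in> W} \<inter> V)"
    using topological_chartD(5)[OF assms(1)] assms(2) by blast
  moreover have "{p \<in> fst c. snd c p \<in> W} \<inter> V = {p \<in> fst c \<inter> V. snd c p \<in> W}" by auto
  ultimately show "openin T {p \<in> fst c \<inter> V. snd c p \<in> W}" by simp
next
  fix U assume "openin T U" "U \<subseteq> fst c \<inter> V"
  then show "open (snd c ` U)"
    using topological_chartD(4)[OF assms(1), of U] by (simp add: inf.absorb2)
qed

lemma chart_inv_restrict:
  assumes "topological_chart T c" "x \<in> snd c ` (fst c \<inter> V)"
  shows "chart_inv (fst c \<inter> V, snd c) x = chart_inv c x"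
proof -
  obtain q where q: "q \<in> fst c \<inter> V" "x = snd c q" using assms(2) by blast
  have "inj_on (snd c) (fst c \<inter> V)"
    using topological_chartD(3)[OF assms(1)] by (auto simp: inj_on_def)
  then have "chart_inv (fst c \<inter> V, snd c) x = q"
    using q by (simp add: chart_inv_def)
  then show ?thesis using chart_inv_chart[OF assms(1)] q by simp
qed

lemma compatible_iff:
  assumes "topological_chart T c" "topological_chart T d"
  shows "compatible c d \<longleftrightarrow> (\<forall>p\<in>fst c \<inter> fst d. smooth_at (snd c p) (\<lambda>x. snd d (chart_inv c x)) \<and>
      smooth_at (snd d p) (\<lambda>x. snd c (chart_inv d x)))"
proof -
  have *: "smooth_on (snd c ` (fst c \<inter> fst d)) (snd d \<circ> chart_inv c) \<longleftrightarrow>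
      (\<forall>p\<in>fst c \<inter> fst d. smooth_at (snd c p) (\<lambda>x. snd d (chart_inv c x)))"
    if "topological_chart T c" "topological_chart T d" for c d :: "('a, 'b) chart"
  proof -
    have "open (snd c ` (fst c \<inter> fst d))"
      using topological_chartD(4)[OF that(1) topological_chartD(1)[OF that(2)]] .
    then show ?thesis
      using smooth_on_imp_smooth_at smooth_on_if_smooth_at[of "snd c ` (fst c \<inter> fst d)"]
      unfolding o_def by blast
  qed
  show ?thesis
    unfolding compatible_def *[OF assms] using *[OF assms(2,1)] by (auto simp: Int_commute)
qed

text \<open>
  The part of the definition of a smooth manifold that calculus uses. Tangent bundles, slit tangent
  bundles and products have it by construction.
\<close>

definition atlased :: "('a, 'e::euclidean_space) manifold \<Rightarrow> bool" where
  "atlased M \<longleftrightarrow> (\<Union>c\<in>charts M. fst c) = points M \<and>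
     (\<forall>c\<in>charts M. topological_chart (mtop M) c) \<and> (\<forall>c\<in>charts M. \<forall>d\<in>charts M. compatible c d)"

lemma atlased_topological_chart: "atlased M \<Longrightarrow> c \<in> charts M \<Longrightarrow> topological_chart (mtop M) c"
  by (simp add: atlased_def)

lemma atlased_chart_subset: "atlased M \<Longrightarrow> c \<in> charts M \<Longrightarrow> p \<in> fst c \<Longrightarrow> p \<in> points M"
  by (auto simp: atlased_def)

lemma atlased_obtain_chart:
  assumes "atlased M" "p \<in> points M"
  obtains c where "c \<in> charts M" "p \<in> fst c"
  using assms unfolding atlased_def by blast

lemma atlased_transition:
  assumes "atlased M" "c \<in> charts M" "d \<in> charts M" "p \<in> fst c" "p \<in> fst d"
  shows "smooth_at (snd c p) (\<lambda>x. snd d (chart_inv c x))"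
  using assms compatible_iff[of "mtop M" c d] by (auto simp: atlased_def)

lemmas atlased_inv = chart_inv_chart[OF atlased_topological_chart]

lemma smooth_manifold_atlased: "smooth_manifold M \<Longrightarrow> atlased M"
  unfolding smooth_manifold_def atlased_def by blast

lemma open_submanifold_points:
  fixes M :: "('a, 'e::euclidean_space) manifold"
  assumes "atlased M"
  shows "open_submanifold M (points M) = M"
proof -
  have "{c \<in> charts M. fst c \<subseteq> points M} = charts M"
    using atlased_chart_subset[OF assms] by auto
  then show ?thesis
    by (cases M) (simp add: open_submanifold_def)
qed

text \<open>
  Two charts that are compatible with the atlas are compatible with each other: near a common point
  the transition map factors through a chart of the atlas.
\<close>

lemma atlased_manifold_of_atlas:
  assumes cov: "(\<Union>c\<in>A. fst c) = topspace T"
    and top: "\<And>c. c \<in> A \<Longrightarrow> topological_chart T c"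
    and comp: "\<And>c d. c \<in> A \<Longrightarrow> d \<in> A \<Longrightarrow> compatible c d"
  shows "atlased (manifold_of_atlas T A)" "A \<subseteq> charts (manifold_of_atlas T A)"
proof -
  let ?M = "manifold_of_atlas T A"
  show A: "A \<subseteq> charts ?M"
    using top comp by (auto simp: manifold_of_atlas_def)
  have sub: "fst c \<subseteq> topspace T" if "topological_chart T c" for c :: "('a, 'b) chart"
    using topological_chartD(1)[OF that] openin_subset by blast
  have half: "smooth_at (snd c p) (\<lambda>x. snd d (chart_inv c x))"
    if c: "topological_chart T c" "\<forall>a\<in>A. compatible c a" and d: "topological_chart T d" "\<forall>a\<in>A. compatible d a"
      and p: "p \<in> fst c" "p \<in> fst d" for c d :: "('a, 'b) chart" and p
  proof -
    obtain a where a: "a \<in> A" "p \<in> fst a"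
      using cov sub[OF c(1)] p by blast
    have 1: "smooth_at (snd c p) (\<lambda>x. snd a (chart_inv c x))"
      using compatible_iff[OF c(1) top[OF a(1)]] c(2) a p by auto
    have 2: "smooth_at (snd a p) (\<lambda>x. snd d (chart_inv a x))"
      using compatible_iff[OF d(1) top[OF a(1)]] d(2) a p by auto
    have "smooth_at (snd c p) (\<lambda>x. snd d (chart_inv a (snd a (chart_inv c x))))"
      using smooth_at_compose[OF 1, of "\<lambda>x. snd d (chart_inv a x)"] 2 chart_inv_chart[OF c(1) p(1)] by simp
    moreover have "\<forall>\<^sub>F x in nhds (snd c p). snd d (chart_inv a (snd a (chart_inv c x))) = snd d (chart_inv c x)"
      using chart_eventually[OF c(1) topological_chartD(1)[OF top[OF a(1)]] p(1) a(2)]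
      by (rule eventually_mono) (simp add: chart_inv_chart[OF top[OF a(1)]])
    ultimately show ?thesis
    by (rule smooth_at_cong_ev[rotated])
  qed
  show "atlased ?M"
    unfolding atlased_def
  proof (intro conjI ballI)
    have "points ?M = topspace T" by (simp add: manifold_of_atlas_def)
    moreover have "(\<Union>c\<in>charts ?M. fst c) \<subseteq> topspace T"
      by (rule UN_least) (simp add: manifold_of_atlas_def sub)
    moreover have "(\<Union>c\<in>A. fst c) \<subseteq> (\<Union>c\<in>charts ?M. fst c)"
      by (rule UN_mono[OF A]) simp
    ultimately show "(\<Union>c\<in>charts ?M. fst c) = points ?M"
      using cov by simp
    show "topological_chart (mtop ?M) c" if "c \<in> charts ?M" for c
      using that by (simp add: manifold_of_atlas_def)
    show "compatible c d" if "c \<in> charts ?M" "d \<in> charts ?M" for c d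
    proof -
      have c: "topological_chart T c" "\<forall>a\<in>A. compatible c a"
        and d: "topological_chart T d" "\<forall>a\<in>A. compatible d a"
        using that by (simp_all add: manifold_of_atlas_def)
      show ?thesis
        unfolding compatible_iff[OF c(1) d(1)] using half[OF c d] half[OF d c] by blast
    qed
  qed
qed

text \<open>
  Needed for the slit tangent bundle, whose charts have to avoid the zero section.
\<close>

lemma manifold_of_atlas_restrict:
  assumes cov: "(\<Union>c\<in>A. fst c) = topspace T"
    and top: "\<And>c. c \<in> A \<Longrightarrow> topological_chart T c"
    and comp: "\<And>c d. c \<in> A \<Longrightarrow> d \<in> A \<Longrightarrow> compatible c d"
    and c: "c \<in> A" and V: "openin T V"
  shows "(fst c \<inter> V, snd c) \<in> charts (manifold_of_atlas T A)"
proof -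
  let ?c = "(fst c \<inter> V, snd c)"
  have tc: "topological_chart T ?c"
    by (rule topological_chart_restrict[OF top[OF c] V])
  have "compatible ?c d" if d: "d \<in> A" for d
    unfolding compatible_iff[OF tc top[OF d]]
  proof (intro ballI conjI)
    fix p assume p: "p \<in> fst ?c \<inter> fst d"
    have *: "smooth_at (snd c p) (\<lambda>x. snd d (chart_inv c x))" "smooth_at (snd d p) (\<lambda>x. snd c (chart_inv d x))"
      using compatible_iff[OF top[OF c] top[OF d]] comp[OF c d] p by auto
    show "smooth_at (snd d p) (\<lambda>x. snd ?c (chart_inv d x))"
      using *(2) by simp
    have "\<forall>\<^sub>F x in nhds (snd c p). x \<in> snd c ` (fst c \<inter> V)"
      using topological_chartD(4)[OF top[OF c] V] p by (intro eventually_nhds_in_open) auto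
    then have "\<forall>\<^sub>F x in nhds (snd c p). snd d (chart_inv c x) = snd d (chart_inv ?c x)"
      by (rule eventually_mono) (simp add: chart_inv_restrict[OF top[OF c]])
    then show "smooth_at (snd ?c p) (\<lambda>x. snd d (chart_inv ?c x))"
      using smooth_at_cong_ev *(1) by fastforce
  qed
  then show ?thesis
    using tc by (simp add: manifold_of_atlas_def)
qed

section \<open>Smooth maps from Euclidean space into a manifold\<close>

definition smooth_into_at ::
    "('a, 'e::euclidean_space) manifold \<Rightarrow> ('x::euclidean_space \<Rightarrow> 'a) \<Rightarrow> 'x \<Rightarrow> bool" where
  "smooth_into_at N \<phi> x \<longleftrightarrow> \<phi> x \<in> points N \<and> (\<forall>d\<in>charts N. \<phi> x \<in> fst d \<longrightarrow>
     (\<forall>\<^sub>F y in nhds x. \<phi> y \<in> fst d) \<and> smooth_at x (\<lambda>y. snd d (\<phi> y)))"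

text \<open>
  The derivative of \<open>\<phi>\<close> at \<open>x\<close> as a linear map into the tangent space of \<open>N\<close> at \<open>\<phi> x\<close>.
\<close>

definition pushforward ::
    "('a, 'e::euclidean_space) manifold \<Rightarrow> ('x::euclidean_space \<Rightarrow> 'a) \<Rightarrow> 'x \<Rightarrow> 'x \<Rightarrow> ('a, 'e) tangent_vector" where
  "pushforward N \<phi> x v = (\<lambda>d. if d \<in> charts N \<and> \<phi> x \<in> fst d
     then frechet_derivative (\<lambda>y. snd d (\<phi> y)) (at x) v else 0)"

text \<open>
  One chart suffices: the representatives in the other charts differ by a smooth transition map.
\<close>

lemma smooth_into_atI:
  assumes N: "atlased N" and c: "c \<in> charts N" "\<phi> x \<in> fst c"
    and ev: "\<forall>\<^sub>F y in nhds x. \<phi> y \<in> fst c" and sm: "smooth_at x (\<lambda>y. snd c (\<phi> y))"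
  shows "smooth_into_at N \<phi> x"
  unfolding smooth_into_at_def
proof (intro conjI ballI impI)
  show "\<phi> x \<in> points N" using atlased_chart_subset[OF N c] .
  fix d assume d: "d \<in> charts N" "\<phi> x \<in> fst d"
  note tc = atlased_topological_chart[OF N c(1)] and td = atlased_topological_chart[OF N d(1)]
  have "\<forall>\<^sub>F y in nhds x. chart_inv c (snd c (\<phi> y)) \<in> fst d"
    using smooth_at_eventually_image[OF sm chart_eventually[OF tc topological_chartD(1)[OF td] c(2) d(2)]]
    by (rule eventually_mono) simp
  with ev show "\<forall>\<^sub>F y in nhds x. \<phi> y \<in> fst d"
    by eventually_elim (simp add: chart_inv_chart[OF tc])
  have "smooth_at x (\<lambda>y. snd d (chart_inv c (snd c (\<phi> y))))"
    by (rule smooth_at_compose[OF sm atlased_transition[OF N c(1) d(1) c(2) d(2)]])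
  moreover have "\<forall>\<^sub>F y in nhds x. snd d (chart_inv c (snd c (\<phi> y))) = snd d (\<phi> y)"
    using ev by (rule eventually_mono) (simp add: chart_inv_chart[OF tc])
  ultimately show "smooth_at x (\<lambda>y. snd d (\<phi> y))"
    by (rule smooth_at_cong_ev[rotated])
qed

lemma smooth_into_at_points: "smooth_into_at N \<phi> x \<Longrightarrow> \<phi> x \<in> points N"
  by (simp add: smooth_into_at_def)

lemma smooth_into_at_chart: "smooth_into_at N \<phi> x \<Longrightarrow> d \<in> charts N \<Longrightarrow> \<phi> x \<in> fst d \<Longrightarrow> smooth_at x (\<lambda>y. snd d (\<phi> y))"
  by (simp add: smooth_into_at_def)

lemma smooth_into_at_eventually_chart:
  "smooth_into_at N \<phi> x \<Longrightarrow> d \<in> charts N \<Longrightarrow> \<phi> x \<in> fst d \<Longrightarrow> \<forall>\<^sub>F y in nhds x. \<phi> y \<in> fst d"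
  by (simp add: smooth_into_at_def)

lemma smooth_into_at_eventually_open:
  assumes N: "atlased N" and \<phi>: "smooth_into_at N \<phi> x" and V: "openin (mtop N) V" "\<phi> x \<in> V"
  shows "\<forall>\<^sub>F y in nhds x. \<phi> y \<in> V"
proof -
  obtain d where d: "d \<in> charts N" "\<phi> x \<in> fst d"
    using atlased_obtain_chart[OF N smooth_into_at_points[OF \<phi>]] .
  note td = atlased_topological_chart[OF N d(1)]
  have "\<forall>\<^sub>F y in nhds x. chart_inv d (snd d (\<phi> y)) \<in> V"
    using smooth_at_eventually_image[OF smooth_into_at_chart[OF \<phi> d] chart_eventually[OF td V(1) d(2) V(2)]]
    by (rule eventually_mono) simp
  with smooth_into_at_eventually_chart[OF \<phi> d] show ?thesis
    by eventually_elim (simp add: chart_inv_chart[OF td])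
qed

lemma smooth_into_at_eventually:
  assumes N: "atlased N" and \<phi>: "smooth_into_at N \<phi> x"
  shows "\<forall>\<^sub>F y in nhds x. smooth_into_at N \<phi> y"
proof -
  obtain d where d: "d \<in> charts N" "\<phi> x \<in> fst d"
    using atlased_obtain_chart[OF N smooth_into_at_points[OF \<phi>]] .
  have "\<forall>\<^sub>F y in nhds x. \<forall>\<^sub>F z in nhds y. \<phi> z \<in> fst d"
    using smooth_into_at_eventually_chart[OF \<phi> d] by (simp add: eventually_eventually)
  with smooth_into_at_eventually_chart[OF \<phi> d] smooth_at_eventually[OF smooth_into_at_chart[OF \<phi> d]]
  show ?thesis
    by eventually_elim (rule smooth_into_atI[OF N d(1)])
qed

lemma smooth_into_at_cong_ev:
  assumes "\<forall>\<^sub>F y in nhds x. \<phi> y = \<psi> y" "smooth_into_at N \<phi> x"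
  shows "smooth_into_at N \<psi> x"
  unfolding smooth_into_at_def
proof (intro conjI ballI impI)
  have eq: "\<phi> x = \<psi> x" using eventually_nhds_x_imp_x[OF assms(1)] .
  show "\<psi> x \<in> points N" using smooth_into_at_points[OF assms(2)] eq by simp
  fix d assume "d \<in> charts N" "\<psi> x \<in> fst d"
  then have d: "d \<in> charts N" "\<phi> x \<in> fst d" using eq by auto
  show "\<forall>\<^sub>F y in nhds x. \<psi> y \<in> fst d"
    using assms(1) smooth_into_at_eventually_chart[OF assms(2) d] by eventually_elim simp
  have "\<forall>\<^sub>F y in nhds x. snd d (\<phi> y) = snd d (\<psi> y)"
    using assms(1) by (rule eventually_mono) simp
  then show "smooth_at x (\<lambda>y. snd d (\<psi> y))"
    using smooth_into_at_chart[OF assms(2) d] by (rule smooth_at_cong_ev)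
qed

lemma pushforward_cong_ev:
  fixes N :: "('a, 'e::euclidean_space) manifold"
  assumes "\<forall>\<^sub>F y in nhds x. \<phi> y = \<psi> y"
  shows "pushforward N \<phi> x v = pushforward N \<psi> x v"
proof -
  have "frechet_derivative (\<lambda>y. snd d (\<phi> y)) (at x) = frechet_derivative (\<lambda>y. snd d (\<psi> y)) (at x)" for d :: "('a, 'e) chart"
    by (rule frechet_derivative_cong_ev, rule eventually_mono[OF assms]) simp
  then show ?thesis
    using eventually_nhds_x_imp_x[OF assms] unfolding pushforward_def by metis
qed

lemma smooth_into_at_precompose:
  assumes "smooth_at x \<tau>" "smooth_into_at N \<phi> (\<tau> x)"
  shows "smooth_into_at N (\<lambda>y. \<phi> (\<tau> y)) x"
  unfolding smooth_into_at_def
proof (intro conjI ballI impI)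
  show "\<phi> (\<tau> x) \<in> points N" using smooth_into_at_points[OF assms(2)] .
  fix d assume d: "d \<in> charts N" "\<phi> (\<tau> x) \<in> fst d"
  show "\<forall>\<^sub>F y in nhds x. \<phi> (\<tau> y) \<in> fst d"
    by (rule smooth_at_eventually_image[OF assms(1) smooth_into_at_eventually_chart[OF assms(2) d]])
  show "smooth_at x (\<lambda>y. snd d (\<phi> (\<tau> y)))"
    by (rule smooth_at_compose[OF assms(1) smooth_into_at_chart[OF assms(2) d]])
qed

lemma pushforward_precompose:
  assumes "smooth_at x \<tau>" "smooth_into_at N \<phi> (\<tau> x)"
  shows "pushforward N (\<lambda>y. \<phi> (\<tau> y)) x v = pushforward N \<phi> (\<tau> x) (frechet_derivative \<tau> (at x) v)"
proof
  fix d
  show "pushforward N (\<lambda>y. \<phi> (\<tau> y)) x v d = pushforward N \<phi> (\<tau> x) (frechet_derivative \<tau> (at x) v) d"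
    using frechet_derivative_chain[OF assms(1) smooth_into_at_chart[OF assms(2), of d]]
    by (simp add: pushforward_def)
qed

lemma smooth_into_at_chart_inv:
  assumes "atlased M" "c \<in> charts M" "p \<in> fst c"
  shows "smooth_into_at M (chart_inv c) (snd c p)"
proof (rule smooth_into_atI[OF assms(1,2)])
  note tc = atlased_topological_chart[OF assms(1,2)]
  note ev = chart_eventually[OF tc topological_chartD(1)[OF tc] assms(3,3)]
  show "chart_inv c (snd c p) \<in> fst c" using chart_inv_chart[OF tc] assms by simp
  show "\<forall>\<^sub>F y in nhds (snd c p). chart_inv c y \<in> fst c"
    using ev by (rule eventually_mono) simp
  have "\<forall>\<^sub>F y in nhds (snd c p). y = snd c (chart_inv c y)"
    using ev by (rule eventually_mono) simp
  then show "smooth_at (snd c p) (\<lambda>y. snd c (chart_inv c y))"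
    by (rule smooth_at_cong_ev) simp
qed

lemma tangent_space_transition:
  "v \<in> tangent_space M p \<Longrightarrow> c \<in> charts M \<Longrightarrow> p \<in> fst c \<Longrightarrow> d \<in> charts M \<Longrightarrow> p \<in> fst d \<Longrightarrow>
    v d = frechet_derivative (\<lambda>x. snd d (chart_inv c x)) (at (snd c p)) (v c)"
  unfolding tangent_space_def mem_Collect_eq o_def by blast

lemma tangent_space_outside_chart:
  "v \<in> tangent_space M p \<Longrightarrow> \<not> (d \<in> charts M \<and> p \<in> fst d) \<Longrightarrow> v d = 0"
  unfolding tangent_space_def mem_Collect_eq by blast

lemma tangent_spaceI:
  assumes "\<And>d. \<not> (d \<in> charts M \<and> p \<in> fst d) \<Longrightarrow> v d = 0"
    and "\<And>c d. c \<in> charts M \<Longrightarrow> p \<in> fst c \<Longrightarrow> d \<in> charts M \<Longrightarrow> p \<in> fst d \<Longrightarrow>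
      v d = frechet_derivative (\<lambda>x. snd d (chart_inv c x)) (at (snd c p)) (v c)"
  shows "v \<in> tangent_space M p"
  unfolding tangent_space_def mem_Collect_eq o_def using assms by blast

lemma pushforward_tangent:
  assumes N: "atlased N" and \<phi>: "smooth_into_at N \<phi> x"
  shows "pushforward N \<phi> x v \<in> tangent_space N (\<phi> x)"
proof (rule tangent_spaceI)
  show "pushforward N \<phi> x v c = 0" if "\<not> (c \<in> charts N \<and> \<phi> x \<in> fst c)" for c
    using that unfolding pushforward_def by (rule if_not_P)
  fix c d assume c: "c \<in> charts N" "\<phi> x \<in> fst c" and d: "d \<in> charts N" "\<phi> x \<in> fst d"
  have "\<forall>\<^sub>F y in nhds x. snd d (chart_inv c (snd c (\<phi> y))) = snd d (\<phi> y)"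
    using smooth_into_at_eventually_chart[OF \<phi> c]
    by (rule eventually_mono) (simp add: atlased_inv[OF N c(1)])
  from frechet_derivative_cong_ev[OF this]
  have "frechet_derivative (\<lambda>y. snd d (\<phi> y)) (at x) v
      = frechet_derivative (\<lambda>x. snd d (chart_inv c x)) (at (snd c (\<phi> x)))
          (frechet_derivative (\<lambda>y. snd c (\<phi> y)) (at x) v)"
    using frechet_derivative_chain[OF smooth_into_at_chart[OF \<phi> c] atlased_transition[OF N c(1) d(1) c(2) d(2)]]
    by simp
  then show "pushforward N \<phi> x v d = frechet_derivative (\<lambda>x. snd d (chart_inv c x)) (at (snd c (\<phi> x))) (pushforward N \<phi> x v c)"
    using c d by (simp add: pushforward_def)
qed

text \<open>
  The representations in the other charts are obtained from the one in \<open>c\<close> by the transition maps.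
\<close>

lemma tangent_space_eqI:
  assumes "v \<in> tangent_space M p" "w \<in> tangent_space M p" "c \<in> charts M" "p \<in> fst c" "v c = w c"
  shows "v = w"
proof
  fix d
  show "v d = w d"
  proof (cases "d \<in> charts M \<and> p \<in> fst d")
    case True
    then show ?thesis
      using tangent_space_transition[OF assms(1,3,4)] tangent_space_transition[OF assms(2,3,4)] assms(5) by simp
  next
    case False
    then show ?thesis
      using tangent_space_outside_chart[OF assms(1)] tangent_space_outside_chart[OF assms(2)] by simp
  qed
qed

lemma pushforward_chart_inv_chart:
  assumes "atlased M" "c \<in> charts M" "p \<in> fst c"
  shows "pushforward M (chart_inv c) (snd c p) y c = y"
proof -
  note tc = atlased_topological_chart[OF assms(1,2)]
  have "\<forall>\<^sub>F y in nhds (snd c p). snd c (chart_inv c y) = y"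
    using chart_eventually[OF tc topological_chartD(1)[OF tc] assms(3,3)] by (rule eventually_mono) simp
  then have "frechet_derivative (\<lambda>y. snd c (chart_inv c y)) (at (snd c p)) = frechet_derivative (\<lambda>y. y) (at (snd c p))"
    by (rule frechet_derivative_cong_ev)
  also have "\<dots> = (\<lambda>v. v)"
    using frechet_derivative_at[OF has_derivative_ident] by metis
  finally show ?thesis
    using assms chart_inv_chart[OF tc] by (simp add: pushforward_def)
qed

lemma pushforward_chart_inv:
  assumes "atlased M" "c \<in> charts M" "p \<in> fst c" "v \<in> tangent_space M p"
  shows "pushforward M (chart_inv c) (snd c p) (v c) = v"
  using tangent_space_eqI[OF _ assms(4,2,3)] pushforward_tangent[OF assms(1) smooth_into_at_chart_inv[OF assms(1-3)]]
    pushforward_chart_inv_chart[OF assms(1-3)] atlased_inv[OF assms(1-3)] by metis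

lemma pushforward_linear:
  assumes "atlased N" "smooth_into_at N \<phi> x"
  shows "linear (\<lambda>v. pushforward N \<phi> x v d)"
proof (cases "d \<in> charts N \<and> \<phi> x \<in> fst d")
  case True
  then have "linear (frechet_derivative (\<lambda>y. snd d (\<phi> y)) (at x))"
    using smooth_at_linear_frechet_derivative[OF smooth_into_at_chart[OF assms(2)]] by blast
  then show ?thesis using True by (simp add: pushforward_def)
next
  case False
  then have "(\<lambda>v. pushforward N \<phi> x v d) = (\<lambda>v. 0)" by (auto simp: pushforward_def)
  then show ?thesis by (simp add: linear_zero)
qed

section \<open>Smooth maps between manifolds and their differentials\<close>

definition smooth_map_at :: "('a, 'e::euclidean_space) manifold \<Rightarrow> ('b, 'f::euclidean_space) manifold \<Rightarrow>
     ('a \<Rightarrow> 'b) \<Rightarrow> 'a \<Rightarrow> bool" where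
  "smooth_map_at M N f p \<longleftrightarrow> p \<in> points M \<and>
     (\<forall>c\<in>charts M. p \<in> fst c \<longrightarrow> smooth_into_at N (\<lambda>x. f (chart_inv c x)) (snd c p))"

lemma smooth_map_atI:
  assumes M: "atlased M" and c: "c \<in> charts M" "p \<in> fst c"
    and f: "smooth_into_at N (\<lambda>x. f (chart_inv c x)) (snd c p)"
  shows "smooth_map_at M N f p"
  unfolding smooth_map_at_def
proof (intro conjI ballI impI)
  show "p \<in> points M" using atlased_chart_subset[OF M c] .
  fix d assume d: "d \<in> charts M" "p \<in> fst d"
  note tc = atlased_topological_chart[OF M c(1)] and td = atlased_topological_chart[OF M d(1)]
  have "smooth_into_at N (\<lambda>x. f (chart_inv c (snd c (chart_inv d x)))) (snd d p)"
    using smooth_into_at_precompose[OF atlased_transition[OF M d(1) c(1) d(2) c(2)], of N "\<lambda>x. f (chart_inv c x)"]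
      f atlased_inv[OF M d] by simp
  moreover have "\<forall>\<^sub>F x in nhds (snd d p). f (chart_inv c (snd c (chart_inv d x))) = f (chart_inv d x)"
    using chart_eventually[OF td topological_chartD(1)[OF tc] d(2) c(2)]
    by (rule eventually_mono) (simp add: chart_inv_chart[OF tc])
  ultimately show "smooth_into_at N (\<lambda>x. f (chart_inv d x)) (snd d p)"
    by (rule smooth_into_at_cong_ev[rotated])
qed

lemma smooth_map_atD:
  "smooth_map_at M N f p \<Longrightarrow> c \<in> charts M \<Longrightarrow> p \<in> fst c \<Longrightarrow> smooth_into_at N (\<lambda>x. f (chart_inv c x)) (snd c p)"
  by (simp add: smooth_map_at_def)

lemma smooth_map_at_points: "smooth_map_at M N f p \<Longrightarrow> p \<in> points M"
  by (simp add: smooth_map_at_def)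

lemma smooth_map_at_image:
  assumes "atlased M" "smooth_map_at M N f p"
  shows "f p \<in> points N"
proof -
  obtain c where c: "c \<in> charts M" "p \<in> fst c"
    using atlased_obtain_chart[OF assms(1) smooth_map_at_points[OF assms(2)]] .
  then show ?thesis
    using smooth_into_at_points[OF smooth_map_atD[OF assms(2) c]] atlased_inv[OF assms(1) c] by simp
qed

lemma smooth_into_at_postcompose:
  assumes M: "atlased M" and \<phi>: "smooth_into_at M \<phi> x" and f: "smooth_map_at M N f (\<phi> x)"
  shows "smooth_into_at N (\<lambda>y. f (\<phi> y)) x"
proof -
  obtain c where c: "c \<in> charts M" "\<phi> x \<in> fst c"
    using atlased_obtain_chart[OF M smooth_into_at_points[OF \<phi>]] .
  have "smooth_into_at N (\<lambda>y. f (chart_inv c (snd c (\<phi> y)))) x"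
    by (rule smooth_into_at_precompose[OF smooth_into_at_chart[OF \<phi> c] smooth_map_atD[OF f c]])
  moreover have "\<forall>\<^sub>F y in nhds x. f (chart_inv c (snd c (\<phi> y))) = f (\<phi> y)"
    using smooth_into_at_eventually_chart[OF \<phi> c] by (rule eventually_mono) (simp add: atlased_inv[OF M c(1)])
  ultimately show ?thesis
    by (rule smooth_into_at_cong_ev[rotated])
qed

text \<open>
  Frees the differential from the chart that its definition chooses.
\<close>

lemma differential_chart:
  assumes M: "atlased M" and f: "smooth_map_at M N f p" and c: "c \<in> charts M" "p \<in> fst c"
    and v: "v \<in> tangent_space M p"
  shows "differential M N f p v = pushforward N (\<lambda>x. f (chart_inv c x)) (snd c p) (v c)"
proof -
  define b where "b = (SOME c. c \<in> charts M \<and> p \<in> fst c)"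
  have b: "b \<in> charts M" "p \<in> fst b"
    using someI[of "\<lambda>c. c \<in> charts M \<and> p \<in> fst c" c] c by (auto simp: b_def)
  note tb = atlased_topological_chart[OF M b(1)] and tc = atlased_topological_chart[OF M c(1)]
  have "differential M N f p v = pushforward N (\<lambda>x. f (chart_inv b x)) (snd b p) (v b)"
    unfolding differential_def pushforward_def b_def[symmetric] Let_def o_def atlased_inv[OF M b] ..
  also have "\<dots> = pushforward N (\<lambda>x. f (chart_inv c (snd c (chart_inv b x)))) (snd b p) (v b)"
    by (rule pushforward_cong_ev, rule eventually_mono[OF chart_eventually[OF tb topological_chartD(1)[OF tc] b(2) c(2)]])
       (simp add: chart_inv_chart[OF tc])
  also have "\<dots> = pushforward N (\<lambda>x. f (chart_inv c x)) (snd c p)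
      (frechet_derivative (\<lambda>x. snd c (chart_inv b x)) (at (snd b p)) (v b))"
    using pushforward_precompose[OF atlased_transition[OF M b(1) c(1) b(2) c(2)], of N "\<lambda>x. f (chart_inv c x)"]
      smooth_map_atD[OF f c] atlased_inv[OF M b] by simp
  also have "frechet_derivative (\<lambda>x. snd c (chart_inv b x)) (at (snd b p)) (v b) = v c"
    by (rule tangent_space_transition[OF v b c, symmetric])
  finally show ?thesis .
qed

text \<open>
  The chain rule on manifolds. For \<open>\<phi>\<close> the inverse of a chart it gives the chain rule for
  differentials, and for \<open>\<phi>\<close> a curve the one for velocities.
\<close>

lemma differential_pushforward:
  assumes M: "atlased M" and \<phi>: "smooth_into_at M \<phi> x" and f: "smooth_map_at M N f (\<phi> x)"
  shows "differential M N f (\<phi> x) (pushforward M \<phi> x v) = pushforward N (\<lambda>y. f (\<phi> y)) x v"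
proof -
  obtain c where c: "c \<in> charts M" "\<phi> x \<in> fst c"
    using atlased_obtain_chart[OF M smooth_into_at_points[OF \<phi>]] .
  have "differential M N f (\<phi> x) (pushforward M \<phi> x v)
      = pushforward N (\<lambda>x. f (chart_inv c x)) (snd c (\<phi> x)) (pushforward M \<phi> x v c)"
    by (rule differential_chart[OF M f c pushforward_tangent[OF M \<phi>]])
  also have "pushforward M \<phi> x v c = frechet_derivative (\<lambda>y. snd c (\<phi> y)) (at x) v"
    using c by (simp add: pushforward_def)
  also have "pushforward N (\<lambda>x. f (chart_inv c x)) (snd c (\<phi> x)) \<dots> = pushforward N (\<lambda>y. f (chart_inv c (snd c (\<phi> y)))) x v"
    by (rule pushforward_precompose[OF smooth_into_at_chart[OF \<phi> c] smooth_map_atD[OF f c], symmetric])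
  also have "\<dots> = pushforward N (\<lambda>y. f (\<phi> y)) x v"
    by (rule pushforward_cong_ev, rule eventually_mono[OF smooth_into_at_eventually_chart[OF \<phi> c]])
       (simp add: atlased_inv[OF M c(1)])
  finally show ?thesis .
qed

lemma differential_tangent:
  assumes "atlased M" "atlased N" "smooth_map_at M N f p" "v \<in> tangent_space M p"
  shows "differential M N f p v \<in> tangent_space N (f p)"
proof -
  obtain c where c: "c \<in> charts M" "p \<in> fst c"
    using atlased_obtain_chart[OF assms(1) smooth_map_at_points[OF assms(3)]] .
  show ?thesis
    using pushforward_tangent[OF assms(2) smooth_map_atD[OF assms(3) c]] differential_chart[OF assms(1,3) c assms(4)]
      atlased_inv[OF assms(1) c] by simp
qed

lemma smooth_map_at_compose:
  assumes M: "atlased M" and N: "atlased N" and f: "smooth_map_at M N f p" and g: "smooth_map_at N P g (f p)"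
  shows "smooth_map_at M P (\<lambda>q. g (f q)) p"
proof -
  obtain c where c: "c \<in> charts M" "p \<in> fst c"
    using atlased_obtain_chart[OF M smooth_map_at_points[OF f]] .
  have "smooth_into_at P (\<lambda>x. g (f (chart_inv c x))) (snd c p)"
    using smooth_into_at_postcompose[OF N smooth_map_atD[OF f c]] g atlased_inv[OF M c] by simp
  then show ?thesis
    by (rule smooth_map_atI[OF M c])
qed

lemma differential_compose:
  assumes M: "atlased M" and N: "atlased N" and f: "smooth_map_at M N f p" and g: "smooth_map_at N P g (f p)"
    and v: "v \<in> tangent_space M p"
  shows "differential N P g (f p) (differential M N f p v) = differential M P (\<lambda>q. g (f q)) p v"
proof -
  obtain c where c: "c \<in> charts M" "p \<in> fst c"
    using atlased_obtain_chart[OF M smooth_map_at_points[OF f]] .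
  show ?thesis
    unfolding differential_chart[OF M f c v] differential_chart[OF M smooth_map_at_compose[OF M N f g] c v]
    using differential_pushforward[OF N smooth_map_atD[OF f c]] g atlased_inv[OF M c] by simp
qed

lemma eventually_chart_points:
  assumes M: "atlased M" and c: "c \<in> charts M" "p \<in> fst c"
  shows "\<forall>\<^sub>F x in nhds (snd c p). chart_inv c x \<in> points M"
  using chart_eventually[OF atlased_topological_chart[OF M c(1)] openin_topspace c(2) atlased_chart_subset[OF M c]]
  by (rule eventually_mono) simp

lemma smooth_map_at_cong:
  assumes M: "atlased M" and eq: "\<And>q. q \<in> points M \<Longrightarrow> f q = g q" and f: "smooth_map_at M N f p"
  shows "smooth_map_at M N g p"
proof -
  obtain c where c: "c \<in> charts M" "p \<in> fst c"
    using atlased_obtain_chart[OF M smooth_map_at_points[OF f]] .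
  show ?thesis
    by (rule smooth_map_atI[OF M c], rule smooth_into_at_cong_ev[OF _ smooth_map_atD[OF f c]],
        rule eventually_mono[OF eventually_chart_points[OF M c]]) (rule eq)
qed

lemma differential_cong:
  assumes M: "atlased M" and eq: "\<And>q. q \<in> points M \<Longrightarrow> f q = g q" and f: "smooth_map_at M N f p"
    and v: "v \<in> tangent_space M p"
  shows "differential M N f p v = differential M N g p v"
proof -
  obtain c where c: "c \<in> charts M" "p \<in> fst c"
    using atlased_obtain_chart[OF M smooth_map_at_points[OF f]] .
  have g: "smooth_map_at M N g p"
    by (rule smooth_map_at_cong[OF M eq f])
  show ?thesis
    unfolding differential_chart[OF M f c v] differential_chart[OF M g c v]
    by (rule pushforward_cong_ev, rule eventually_mono[OF eventually_chart_points[OF M c]]) (rule eq)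
qed

lemma smooth_map_at_ident:
  assumes M: "atlased M" and p: "p \<in> points M"
  shows "smooth_map_at M M (\<lambda>q. q) p"
proof -
  obtain c where c: "c \<in> charts M" "p \<in> fst c"
    using atlased_obtain_chart[OF M p] .
  show ?thesis
    by (rule smooth_map_atI[OF M c smooth_into_at_chart_inv[OF M c]])
qed

lemma differential_ident:
  assumes M: "atlased M" and p: "p \<in> points M" and v: "v \<in> tangent_space M p"
  shows "differential M M (\<lambda>q. q) p v = v"
proof -
  obtain c where c: "c \<in> charts M" "p \<in> fst c"
    using atlased_obtain_chart[OF M p] .
  show ?thesis
    unfolding differential_chart[OF M smooth_map_at_ident[OF M p] c v] by (rule pushforward_chart_inv[OF M c v])
qed

lemma differential_add:
  assumes M: "atlased M" and N: "atlased N" and f: "smooth_map_at M N f p"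
    and v: "v \<in> tangent_space M p" "w \<in> tangent_space M p" "(\<lambda>c. v c + w c) \<in> tangent_space M p"
  shows "differential M N f p (\<lambda>c. v c + w c) = (\<lambda>c. differential M N f p v c + differential M N f p w c)"
proof -
  obtain c where c: "c \<in> charts M" "p \<in> fst c"
    using atlased_obtain_chart[OF M smooth_map_at_points[OF f]] .
  show ?thesis
    unfolding differential_chart[OF M f c v(1)] differential_chart[OF M f c v(2)] differential_chart[OF M f c v(3)]
    by (intro ext linear_add pushforward_linear[OF N smooth_map_atD[OF f c]])
qed

lemma differential_scale:
  assumes M: "atlased M" and N: "atlased N" and f: "smooth_map_at M N f p"
    and v: "v \<in> tangent_space M p" "(\<lambda>c. r *\<^sub>R v c) \<in> tangent_space M p"
  shows "differential M N f p (\<lambda>c. r *\<^sub>R v c) = (\<lambda>c. r *\<^sub>R differential M N f p v c)"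
proof -
  obtain c where c: "c \<in> charts M" "p \<in> fst c"
    using atlased_obtain_chart[OF M smooth_map_at_points[OF f]] .
  show ?thesis
    unfolding differential_chart[OF M f c v(1)] differential_chart[OF M f c v(2)]
    by (intro ext linear_scale pushforward_linear[OF N smooth_map_atD[OF f c]])
qed

lemma linear_subspaceD:
  assumes "linear_subspace W"
  shows "zero_vec \<in> W" "v \<in> W \<Longrightarrow> w \<in> W \<Longrightarrow> (\<lambda>c. v c + w c) \<in> W" "v \<in> W \<Longrightarrow> (\<lambda>c. r *\<^sub>R v c) \<in> W"
  using assms by (simp_all add: linear_subspace_def)

lemma linear_subspace_tangent_space:
  assumes M: "atlased M"
  shows "linear_subspace (tangent_space M p)"
proof -
  have lin: "linear (frechet_derivative (\<lambda>x. snd d (chart_inv c x)) (at (snd c p)))"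
    if "c \<in> charts M" "p \<in> fst c" "d \<in> charts M" "p \<in> fst d" for c d
    by (rule smooth_at_linear_frechet_derivative[OF atlased_transition[OF M that(1,3,2,4)]])
  have "zero_vec \<in> tangent_space M p"
    by (rule tangent_spaceI) (simp_all add: linear_0[OF lin])
  moreover have "(\<lambda>c. v c + w c) \<in> tangent_space M p"
    if vw: "v \<in> tangent_space M p" "w \<in> tangent_space M p" for v w
  proof (rule tangent_spaceI)
    fix c d assume cd: "c \<in> charts M" "p \<in> fst c" "d \<in> charts M" "p \<in> fst d"
    show "v d + w d = frechet_derivative (\<lambda>x. snd d (chart_inv c x)) (at (snd c p)) (v c + w c)"
      using tangent_space_transition[OF vw(1) cd] tangent_space_transition[OF vw(2) cd] linear_add[OF lin[OF cd]]
      by simp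
  qed (use vw in \<open>simp add: tangent_space_outside_chart\<close>)
  moreover have "(\<lambda>c. r *\<^sub>R v c) \<in> tangent_space M p" if v: "v \<in> tangent_space M p" for r v
  proof (rule tangent_spaceI)
    fix c d assume cd: "c \<in> charts M" "p \<in> fst c" "d \<in> charts M" "p \<in> fst d"
    show "r *\<^sub>R v d = frechet_derivative (\<lambda>x. snd d (chart_inv c x)) (at (snd c p)) (r *\<^sub>R v c)"
      using tangent_space_transition[OF v cd] linear_scale[OF lin[OF cd]] by simp
  qed (use v in \<open>simp add: tangent_space_outside_chart\<close>)
  ultimately show ?thesis
    by (simp add: linear_subspace_def)
qed

lemma differential_zero:
  assumes M: "atlased M" and N: "atlased N" and f: "smooth_map_at M N f p"
  shows "differential M N f p zero_vec = zero_vec"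
  using differential_scale[OF M N f, of zero_vec 0] linear_subspace_tangent_space[OF M, of p]
  by (simp add: linear_subspace_def)

lemma differential_sum:
  assumes M: "atlased M" and N: "atlased N" and f: "smooth_map_at M N f p"
    and v: "\<And>i. i < (k::nat) \<Longrightarrow> v i \<in> tangent_space M p"
    and s: "(\<lambda>c. \<Sum>i<k. a i *\<^sub>R v i c) \<in> tangent_space M p"
  shows "differential M N f p (\<lambda>c. \<Sum>i<k. a i *\<^sub>R v i c) = (\<lambda>c. \<Sum>i<k. a i *\<^sub>R differential M N f p (v i) c)"
proof
  obtain c where c: "c \<in> charts M" "p \<in> fst c"
    using atlased_obtain_chart[OF M smooth_map_at_points[OF f]] .
  fix d
  note lin = pushforward_linear[OF N smooth_map_atD[OF f c], of d]
  have "differential M N f p (\<lambda>c. \<Sum>i<k. a i *\<^sub>R v i c) d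
      = pushforward N (\<lambda>x. f (chart_inv c x)) (snd c p) (\<Sum>i<k. a i *\<^sub>R v i c) d"
    unfolding differential_chart[OF M f c s] ..
  also have "\<dots> = (\<Sum>i<k. a i *\<^sub>R pushforward N (\<lambda>x. f (chart_inv c x)) (snd c p) (v i c) d)"
    using linear_sum[OF lin, of "\<lambda>i. a i *\<^sub>R v i c" "{..<k}"] linear_scale[OF lin] by simp
  also have "\<dots> = (\<Sum>i<k. a i *\<^sub>R differential M N f p (v i) d)"
    by (rule sum.cong) (simp_all add: differential_chart[OF M f c v])
  finally show "differential M N f p (\<lambda>c. \<Sum>i<k. a i *\<^sub>R v i c) d = (\<Sum>i<k. a i *\<^sub>R differential M N f p (v i) d)" .
qed

text \<open>
  A chart identifies the tangent space linearly with a Euclidean space, and a basis of the image of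
  \<open>W\<close> is pulled back.
\<close>

lemma linear_subspace_basis:
  assumes M: "atlased M" and p: "p \<in> points M" and W: "linear_subspace W" "W \<subseteq> tangent_space M p"
  obtains k and \<beta> :: "nat \<Rightarrow> ('a, 'e::euclidean_space) tangent_vector" where
    "\<And>i. i < k \<Longrightarrow> \<beta> i \<in> W"
    "W = {(\<lambda>c. \<Sum>i<k. a i *\<^sub>R \<beta> i c) |a :: nat \<Rightarrow> real. True}"
    "\<And>a :: nat \<Rightarrow> real. (\<lambda>c. \<Sum>i<k. a i *\<^sub>R \<beta> i c) = zero_vec \<Longrightarrow> \<forall>i<k. a i = 0"
proof -
  obtain c where c: "c \<in> charts M" "p \<in> fst c"
    using atlased_obtain_chart[OF M p] .
  let ?S = "(\<lambda>v. v c) ` W"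
  have S: "subspace ?S"
    unfolding subspace_def
  proof (intro conjI ballI allI)
    show "0 \<in> ?S" using W(1) by (auto simp: linear_subspace_def intro!: image_eqI[of _ _ zero_vec])
    fix x assume "x \<in> ?S"
    then obtain v where v: "v \<in> W" "x = v c" by blast
    show "r *\<^sub>R x \<in> ?S" for r
      using W(1) v unfolding linear_subspace_def by (intro image_eqI[of _ _ "\<lambda>c. r *\<^sub>R v c"]) auto
    fix y assume "y \<in> ?S"
    then obtain w where w: "w \<in> W" "y = w c" by blast
    show "x + y \<in> ?S"
      using W(1) v w unfolding linear_subspace_def by (intro image_eqI[of _ _ "\<lambda>c. v c + w c"]) auto
  qed
  obtain B where B: "B \<subseteq> ?S" "independent B" "?S \<subseteq> span B" "card B = dim ?S"
    using basis_exists by blast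
  have fin: "finite B" using B(2) by (rule independent_imp_finite)
  have span: "span B = ?S" using B(1,3) S span_minimal by blast
  obtain b where b: "bij_betw b {..<card B} B"
    using ex_bij_betw_nat_finite[OF fin] by (auto simp: atLeast0LessThan)
  let ?k = "card B"
  have "\<exists>v. v \<in> W \<and> v c = b i" if "i < ?k" for i
  proof -
    have "b i \<in> B" using b that by (auto simp: bij_betw_def)
    with B(1) have "b i \<in> ?S" by (rule subsetD)
    then obtain v where "b i = v c" "v \<in> W" by (rule imageE)
    then show ?thesis by metis
  qed
  then have "\<forall>i. \<exists>v. i < ?k \<longrightarrow> v \<in> W \<and> v c = b i" by blast
  from choice[OF this] obtain \<beta> where "\<forall>i. i < ?k \<longrightarrow> \<beta> i \<in> W \<and> \<beta> i c = b i" ..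
  then have \<beta>: "\<And>i. i < ?k \<Longrightarrow> \<beta> i \<in> W" "\<And>i. i < ?k \<Longrightarrow> \<beta> i c = b i" by blast+
  have closed: "(\<lambda>c. \<Sum>i\<in>I. a i *\<^sub>R \<beta> i c) \<in> W" if "I \<subseteq> {..<?k}" for a :: "nat \<Rightarrow> real" and I
  proof -
    have "finite I" using that finite_subset by blast
    then show ?thesis using that
    proof (induction I)
      case empty
      then show ?case using W(1) by (simp add: linear_subspace_def)
    next
      case (insert i I)
      then have "(\<lambda>c. a i *\<^sub>R \<beta> i c) \<in> W" "(\<lambda>c. \<Sum>i\<in>I. a i *\<^sub>R \<beta> i c) \<in> W"
        using W(1) \<beta>(1)[of i] by (auto simp: linear_subspace_def)
      then have "(\<lambda>c. a i *\<^sub>R \<beta> i c + (\<Sum>i\<in>I. a i *\<^sub>R \<beta> i c)) \<in> W"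
        using W(1) unfolding linear_subspace_def by fastforce
      then show ?case using insert by simp
    qed
  qed
  have sumB: "(\<Sum>i<?k. a i *\<^sub>R \<beta> i c) = (\<Sum>v\<in>B. a (the_inv_into {..<?k} b v) *\<^sub>R v)" for a :: "nat \<Rightarrow> real"
  proof -
    have "(\<Sum>v\<in>B. a (the_inv_into {..<?k} b v) *\<^sub>R v) = (\<Sum>i<?k. a (the_inv_into {..<?k} b (b i)) *\<^sub>R b i)"
      by (rule sum.reindex_bij_betw[OF b, symmetric])
    also have "\<dots> = (\<Sum>i<?k. a i *\<^sub>R \<beta> i c)"
      using b \<beta>(2) by (intro sum.cong) (auto simp: bij_betw_def the_inv_into_f_f)
    finally show ?thesis ..
  qed
  show ?thesis
  proof (rule that[of ?k \<beta>])
    show "\<beta> i \<in> W" if "i < ?k" for i by (rule \<beta>(1)[OF that])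
    show "W = {(\<lambda>c. \<Sum>i<?k. a i *\<^sub>R \<beta> i c) |a :: nat \<Rightarrow> real. True}"
    proof (intro equalityI subsetI)
      fix v assume v: "v \<in> W"
      then have "v c \<in> span B" using span by blast
      then obtain u where u: "v c = (\<Sum>w\<in>B. u w *\<^sub>R w)"
        using span_finite[OF fin] by auto
      let ?a = "\<lambda>i. u (b i)"
      have "(\<Sum>w\<in>B. u w *\<^sub>R w) = (\<Sum>i<?k. u (b i) *\<^sub>R b i)"
        by (rule sum.reindex_bij_betw[OF b, symmetric])
      then have "v c = (\<Sum>i<?k. ?a i *\<^sub>R \<beta> i c)"
        using u \<beta>(2) by simp
      then have "v = (\<lambda>c. \<Sum>i<?k. ?a i *\<^sub>R \<beta> i c)"
        using tangent_space_eqI[OF _ _ c, of v "\<lambda>c. \<Sum>i<?k. ?a i *\<^sub>R \<beta> i c"] v W(2) closed[of "{..<?k}" ?a] by blast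
      then show "v \<in> {(\<lambda>c. \<Sum>i<?k. a i *\<^sub>R \<beta> i c) |a :: nat \<Rightarrow> real. True}"
        unfolding mem_Collect_eq by (intro exI[of _ ?a] conjI TrueI)
    next
      fix v assume "v \<in> {(\<lambda>c. \<Sum>i<?k. a i *\<^sub>R \<beta> i c) |a :: nat \<Rightarrow> real. True}"
      then obtain a :: "nat \<Rightarrow> real" where "v = (\<lambda>c. \<Sum>i<?k. a i *\<^sub>R \<beta> i c)" by (elim CollectE exE conjE)
      then show "v \<in> W" using closed[OF subset_refl, of a] by simp
    qed
    fix a :: "nat \<Rightarrow> real" assume "(\<lambda>c. \<Sum>i<?k. a i *\<^sub>R \<beta> i c) = zero_vec"
    from fun_cong[OF this, of c]
    have 0: "(\<Sum>v\<in>B. a (the_inv_into {..<?k} b v) *\<^sub>R v) = 0"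
      using sumB[of a] by simp
    have "\<forall>v\<in>B. a (the_inv_into {..<?k} b v) = 0"
      using independentD[OF B(2) fin subset_refl 0] by blast
    then show "\<forall>i<?k. a i = 0"
      using b by (metis bij_betw_def imageI lessThan_iff the_inv_into_f_f)
  qed
qed

section \<open>The tangent bundle\<close>

lemma tangent_chart_sel [simp]:
  "fst (tangent_chart M c) = {u. fst u \<in> fst c \<and> snd u \<in> tangent_space M (fst u)}"
  "snd (tangent_chart M c) = (\<lambda>u. (snd c (fst u), snd u c))"
  by (simp_all add: tangent_chart_def)

lemma topspace_tangent_topology:
  assumes "atlased M"
  shows "topspace (tangent_topology M) = {u. fst u \<in> points M \<and> snd u \<in> tangent_space M (fst u)}"
proof -
  let ?gen = "\<lambda>c W. {u \<in> fst (tangent_chart M c). snd (tangent_chart M c) u \<in> W}"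
  have ts: "topspace (tangent_topology M) = \<Union>{?gen c W |c W. c \<in> charts M \<and> open W}"
    unfolding tangent_topology_def topology_generated_by_topspace ..
  show ?thesis
  proof (intro equalityI subsetI)
    fix u assume "u \<in> topspace (tangent_topology M)"
    then obtain c W where "c \<in> charts M" "u \<in> ?gen c W"
      unfolding ts by blast
    then show "u \<in> {u. fst u \<in> points M \<and> snd u \<in> tangent_space M (fst u)}"
      using atlased_chart_subset[OF assms] by simp
  next
    fix u assume u: "u \<in> {u. fst u \<in> points M \<and> snd u \<in> tangent_space M (fst u)}"
    then have "fst u \<in> points M" by simp
    then obtain c where c: "c \<in> charts M" "fst u \<in> fst c"
      by (rule atlased_obtain_chart[OF assms])
    have "u \<in> ?gen c UNIV" using u c by simp
    then show "u \<in> topspace (tangent_topology M)"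
      unfolding ts using c(1) open_UNIV by blast
  qed
qed

lemma tangent_chart_inj:
  assumes "atlased M" "c \<in> charts M"
  shows "inj_on (snd (tangent_chart M c)) (fst (tangent_chart M c))"
proof (rule inj_onI)
  fix u w assume uw: "u \<in> fst (tangent_chart M c)" "w \<in> fst (tangent_chart M c)"
    "snd (tangent_chart M c) u = snd (tangent_chart M c) w"
  then have "fst u = fst w"
    using topological_chartD(3)[OF atlased_topological_chart[OF assms]] by (auto simp: inj_on_def)
  moreover from this have "snd u = snd w"
    using uw assms by (auto intro: tangent_space_eqI)
  ultimately show "u = w" by (simp add: prod_eq_iff)
qed

lemma chart_inv_tangent_chart:
  assumes "atlased M" "c \<in> charts M" "x \<in> snd c ` fst c"
  shows "chart_inv (tangent_chart M c) (x, y) = (chart_inv c x, pushforward M (chart_inv c) x y)"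
proof -
  obtain p where p: "p \<in> fst c" "x = snd c p" using assms(3) by blast
  let ?v = "pushforward M (chart_inv c) (snd c p) y"
  have "?v \<in> tangent_space M p" "?v c = y"
    using pushforward_tangent[OF assms(1) smooth_into_at_chart_inv[OF assms(1,2) p(1)]] atlased_inv[OF assms(1,2) p(1)]
      pushforward_chart_inv_chart[OF assms(1,2) p(1)] by auto
  then have "(p, ?v) \<in> fst (tangent_chart M c)" "snd (tangent_chart M c) (p, ?v) = (x, y)"
    using p by auto
  then have "chart_inv (tangent_chart M c) (x, y) = (p, ?v)"
    unfolding chart_inv_def using tangent_chart_inj[OF assms(1,2)] by (metis inv_into_f_f)
  then show ?thesis
    using p atlased_inv[OF assms(1,2) p(1)] by simp
qed

text \<open>
  The coordinate form of the lift \<open>y \<mapsto> (\<phi> (a y), d\<phi> (w y))\<close> to the tangent bundle. Transition maps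
  of tangent charts, tangent lifts of curves, tangent maps and left invariant vector fields are
  instances of it.
\<close>

lemma smooth_at_chart_lift:
  assumes "smooth_into_at N \<phi> (a x)" "smooth_at x a" "smooth_at x w" "d \<in> charts N" "\<phi> (a x) \<in> fst d"
  shows "smooth_at x (\<lambda>y. (snd d (\<phi> (a y)), pushforward N \<phi> (a y) (w y) d))"
proof (rule smooth_at_Pair)
  note sm = smooth_into_at_chart[OF assms(1,4,5)]
  show "smooth_at x (\<lambda>y. snd d (\<phi> (a y)))"
    by (rule smooth_at_compose[OF assms(2) sm])
  have "\<forall>\<^sub>F y in nhds x. frechet_derivative (\<lambda>y. snd d (\<phi> y)) (at (a y)) (w y) = pushforward N \<phi> (a y) (w y) d"
    using smooth_at_eventually_image[OF assms(2) smooth_into_at_eventually_chart[OF assms(1,4,5)]]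
    by (rule eventually_mono) (simp add: pushforward_def assms(4))
  then show "smooth_at x (\<lambda>y. pushforward N \<phi> (a y) (w y) d)"
    by (rule smooth_at_cong_ev) (rule smooth_at_directional_derivative[OF sm assms(2,3)])
qed

text \<open>
  The chart is continuous by definition of the topology. It is open because its inverse is
  continuous, and for this it suffices to look at the generating open sets, which come from the
  transition maps to the other tangent charts.
\<close>

lemma topological_chart_tangent_chart:
  assumes M: "atlased M" and c: "c \<in> charts M"
  shows "topological_chart (tangent_topology M) (tangent_chart M c)"
proof -
  let ?T = "tangent_topology M" and ?tc = "tangent_chart M c"
  let ?S = "(snd c ` fst c) \<times> (UNIV :: 'b set)"
  let ?j = "\<lambda>z. (chart_inv c (fst z), pushforward M (chart_inv c) (fst z) (snd z))"
  have gen: "openin ?T {u \<in> fst (tangent_chart M d). snd (tangent_chart M d) u \<in> W}"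
    if "d \<in> charts M" "open W" for d W
    unfolding tangent_topology_def by (rule topology_generated_by_Basis) (use that in blast)
  have oS: "open ?S"
    using topological_chartD(2)[OF atlased_topological_chart[OF M c]] by (intro open_Times) auto
  have j: "?j z \<in> fst ?tc" "snd ?tc (?j z) = z" if "z \<in> ?S" for z
  proof -
    obtain p where p: "p \<in> fst c" "fst z = snd c p" using \<open>z \<in> ?S\<close> by auto
    show "?j z \<in> fst ?tc"
      using p pushforward_tangent[OF M smooth_into_at_chart_inv[OF M c p(1)], of "snd z"] atlased_inv[OF M c p(1)] by simp
    show "snd ?tc (?j z) = z"
      using p atlased_inv[OF M c p(1)] pushforward_chart_inv_chart[OF M c p(1)] by (simp add: prod_eq_iff)
  qed
  have cont: "continuous_map (top_of_set ?S) ?T ?j"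
    unfolding tangent_topology_def
  proof (rule continuous_on_generated_topo)
    fix U assume "U \<in> {{u \<in> fst (tangent_chart M c). snd (tangent_chart M c) u \<in> W} |c W. c \<in> charts M \<and> open W}"
    then obtain d W where d: "d \<in> charts M" "open W" "U = {u \<in> fst (tangent_chart M d). snd (tangent_chart M d) u \<in> W}"
      by blast
    have "open (?j -` U \<inter> ?S)"
    proof (rule openI_eventually)
      fix z assume z: "z \<in> ?j -` U \<inter> ?S"
      then obtain p where p: "p \<in> fst c" "fst z = snd c p" by auto
      have pd: "p \<in> fst d"
        using z d(3) p atlased_inv[OF M c p(1)] by auto
      let ?l = "\<lambda>y. (snd d (chart_inv c (fst y)), pushforward M (chart_inv c) (fst y) (snd y) d)"
      have "smooth_at z ?l"
      proof (rule smooth_at_chart_lift)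
        show "smooth_into_at M (chart_inv c) (fst z)" using smooth_into_at_chart_inv[OF M c p(1)] p by simp
        show "chart_inv c (fst z) \<in> fst d" using p pd atlased_inv[OF M c p(1)] by simp
      qed (simp_all add: d)
      moreover have "?l z \<in> W" using z d(3) by auto
      ultimately have "\<forall>\<^sub>F y in nhds z. ?l y \<in> W"
        using d(2) eventually_nhds_in_open smooth_at_eventually_image[of z ?l "\<lambda>y. y \<in> W"] by blast
      moreover have "\<forall>\<^sub>F y in nhds z. y \<in> ?S"
        using oS z by (intro eventually_nhds_in_open) auto
      moreover have "\<forall>\<^sub>F y in nhds z. chart_inv c (fst y) \<in> fst d"
      proof (rule smooth_at_eventually_image[of z fst])
        show "smooth_at z fst" by simp
        show "\<forall>\<^sub>F y in nhds (fst z). chart_inv c y \<in> fst d"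
          using chart_eventually[OF atlased_topological_chart[OF M c]
              topological_chartD(1)[OF atlased_topological_chart[OF M d(1)]] p(1) pd] p(2)
          by (auto elim: eventually_mono)
      qed
      ultimately show "\<forall>\<^sub>F y in nhds z. y \<in> ?j -` U \<inter> ?S"
      proof eventually_elim
        case (elim y)
        then show ?case using j(1)[of y] d(3) by auto
      qed
    qed
    then show "openin (top_of_set ?S) (?j -` U \<inter> topspace (top_of_set ?S))"
      by (simp add: open_subset)
  next
    show "?j ` topspace (top_of_set ?S) \<subseteq> \<Union>{{u \<in> fst (tangent_chart M c). snd (tangent_chart M c) u \<in> W} |c W. c \<in> charts M \<and> open W}"
    proof
      fix u assume "u \<in> ?j ` topspace (top_of_set ?S)"
      then obtain z where "z \<in> ?S" "u = ?j z" by auto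
      then have "u \<in> {u \<in> fst ?tc. snd ?tc u \<in> UNIV}" using j(1)[of z] by auto
      then show "u \<in> \<Union>{{u \<in> fst (tangent_chart M c). snd (tangent_chart M c) u \<in> W} |c W. c \<in> charts M \<and> open W}"
        using c open_UNIV by blast
    qed
  qed
  have "topological_chart ?T (fst ?tc, snd ?tc)"
  proof (rule topological_chartI)
    show "openin ?T (fst ?tc)" using gen[OF c open_UNIV] by simp
    show "inj_on (snd ?tc) (fst ?tc)" by (rule tangent_chart_inj[OF M c])
    show "openin ?T {p \<in> fst ?tc. snd ?tc p \<in> W}" if "open W" for W by (rule gen[OF c that])
    fix V assume V: "openin ?T V" "V \<subseteq> fst ?tc"
    have "openin (top_of_set ?S) {z \<in> ?S. ?j z \<in> V}"
      using openin_continuous_map_preimage[OF cont V(1)] by simp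
    then have "open {z \<in> ?S. ?j z \<in> V}"
      using oS openin_open_eq by blast
    moreover have "snd ?tc ` V = {z \<in> ?S. ?j z \<in> V}"
    proof
      show "snd ?tc ` V \<subseteq> {z \<in> ?S. ?j z \<in> V}"
      proof
        fix z assume "z \<in> snd ?tc ` V"
        then obtain u where u: "u \<in> V" "z = snd ?tc u" by blast
        then have ut: "u \<in> fst ?tc" using V by auto
        then have zS: "z \<in> ?S" using u by auto
        have "?j z = u"
          by (rule inj_onD[OF tangent_chart_inj[OF M c] _ j(1)[OF zS] ut]) (use j(2)[OF zS] u in simp)
        then show "z \<in> {z \<in> ?S. ?j z \<in> V}" using zS u by simp
      qed
      show "{z \<in> ?S. ?j z \<in> V} \<subseteq> snd ?tc ` V"
      proof
        fix z assume "z \<in> {z \<in> ?S. ?j z \<in> V}"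
        then have "?j z \<in> V" "snd ?tc (?j z) = z" using j(2)[of z] by blast+
        then show "z \<in> snd ?tc ` V" by (metis imageI)
      qed
    qed
    ultimately show "open (snd ?tc ` V)" by simp
  qed
  then show ?thesis by (simp only: prod.collapse)
qed

lemma compatible_tangent_chart:
  assumes M: "atlased M" and c: "c \<in> charts M" and d: "d \<in> charts M"
  shows "compatible (tangent_chart M c) (tangent_chart M d)"
proof -
  have half: "smooth_at (snd (tangent_chart M c) u) (\<lambda>z. snd (tangent_chart M d) (chart_inv (tangent_chart M c) z))"
    if c: "c \<in> charts M" and d: "d \<in> charts M"
      and u: "u \<in> fst (tangent_chart M c) \<inter> fst (tangent_chart M d)" for c d u
  proof (rule smooth_at_cong_ev)
    have p: "fst u \<in> fst c" "fst u \<in> fst d" using u by auto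
    show "smooth_at (snd (tangent_chart M c) u)
        (\<lambda>y. (snd d (chart_inv c (fst y)), pushforward M (chart_inv c) (fst y) (snd y) d))"
    proof (rule smooth_at_chart_lift)
      show "smooth_into_at M (chart_inv c) (fst (snd (tangent_chart M c) u))"
        using smooth_into_at_chart_inv[OF M c p(1)] by simp
      show "chart_inv c (fst (snd (tangent_chart M c) u)) \<in> fst d"
        using p atlased_inv[OF M c p(1)] by simp
    qed (simp_all add: d)
    have "open ((snd c ` fst c) \<times> (UNIV :: 'b set))"
      using topological_chartD(2)[OF atlased_topological_chart[OF M c]] by (intro open_Times) auto
    then have "\<forall>\<^sub>F y in nhds (snd (tangent_chart M c) u). y \<in> (snd c ` fst c) \<times> UNIV"
      using p by (intro eventually_nhds_in_open) auto
    then show "\<forall>\<^sub>F y in nhds (snd (tangent_chart M c) u).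
        (snd d (chart_inv c (fst y)), pushforward M (chart_inv c) (fst y) (snd y) d)
        = snd (tangent_chart M d) (chart_inv (tangent_chart M c) y)"
      by (rule eventually_mono) (auto simp: chart_inv_tangent_chart[OF M c])
  qed
  show ?thesis
    unfolding compatible_iff[OF topological_chart_tangent_chart[OF M c] topological_chart_tangent_chart[OF M d]]
    using half[OF c d] half[OF d c] by blast
qed

lemma tangent_atlas_cover:
  assumes M: "atlased M"
  shows "(\<Union>c\<in>tangent_chart M ` charts M. fst c) = topspace (tangent_topology M)"
proof (intro equalityI subsetI)
  fix u assume "u \<in> (\<Union>c\<in>tangent_chart M ` charts M. fst c)"
  then obtain c where "c \<in> charts M" "u \<in> fst (tangent_chart M c)" by blast
  then show "u \<in> topspace (tangent_topology M)"
    using atlased_chart_subset[OF M] by (simp add: topspace_tangent_topology[OF M])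
next
  fix u assume u: "u \<in> topspace (tangent_topology M)"
  then have "fst u \<in> points M" by (simp add: topspace_tangent_topology[OF M])
  then obtain c where c: "c \<in> charts M" "fst u \<in> fst c"
    by (rule atlased_obtain_chart[OF M])
  have "u \<in> fst (tangent_chart M c)"
    using u c by (simp add: topspace_tangent_topology[OF M])
  then show "u \<in> (\<Union>c\<in>tangent_chart M ` charts M. fst c)"
    using c(1) by blast
qed

lemma atlased_tangent_bundle:
  assumes M: "atlased M"
  shows "atlased (tangent_bundle M)" "c \<in> charts M \<Longrightarrow> tangent_chart M c \<in> charts (tangent_bundle M)"
proof -
  show "atlased (tangent_bundle M)"
    unfolding tangent_bundle_def
    by (rule atlased_manifold_of_atlas(1)[OF tangent_atlas_cover[OF M]])
       (auto intro: topological_chart_tangent_chart[OF M] compatible_tangent_chart[OF M])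
  have "tangent_chart M ` charts M \<subseteq> charts (tangent_bundle M)"
    unfolding tangent_bundle_def
    by (rule atlased_manifold_of_atlas(2)[OF tangent_atlas_cover[OF M]])
       (auto intro: topological_chart_tangent_chart[OF M] compatible_tangent_chart[OF M])
  then show "c \<in> charts M \<Longrightarrow> tangent_chart M c \<in> charts (tangent_bundle M)"
    by blast
qed

lemma points_tangent_bundle:
  "atlased M \<Longrightarrow> points (tangent_bundle M) = {u. fst u \<in> points M \<and> snd u \<in> tangent_space M (fst u)}"
  by (simp add: tangent_bundle_def manifold_of_atlas_def topspace_tangent_topology)

lemma points_slit_bundle:
  "atlased M \<Longrightarrow> points (slit_bundle M) =
     {u. fst u \<in> points M \<and> snd u \<in> tangent_space M (fst u) \<and> snd u \<noteq> zero_vec}"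
  by (auto simp: slit_bundle_def open_submanifold_def slit_def tangent_bundle_def manifold_of_atlas_def
      topspace_tangent_topology)

lemma slit_chart_in:
  assumes M: "atlased M" and c: "c \<in> charts M"
  shows "slit_chart M c \<in> charts (slit_bundle M)"
proof -
  let ?tc = "tangent_chart M c" and ?T = "tangent_topology M"
  let ?V = "{u \<in> fst ?tc. snd ?tc u \<in> UNIV \<times> (- {0})}"
  have V: "openin ?T ?V"
    by (rule topological_chartD(5)[OF topological_chart_tangent_chart[OF M c]]) (auto intro: open_Times)
  have zero: "v = zero_vec \<longleftrightarrow> v c = 0" if "v \<in> tangent_space M p" "p \<in> fst c" for v p
    using tangent_space_eqI[OF that(1) _ c that(2), of zero_vec] linear_subspace_tangent_space[OF M, of p]
    by (auto simp: linear_subspace_def)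
  \<comment> \<open>a tangent vector vanishes iff its representation in \<open>c\<close> does, so the slit is open in the chart\<close>
  have VV: "fst ?tc \<inter> ?V = fst ?tc \<inter> slit"
    by (auto simp: slit_def zero)
  have "(fst ?tc \<inter> ?V, snd ?tc) \<in> charts (tangent_bundle M)"
    unfolding tangent_bundle_def
    by (rule manifold_of_atlas_restrict[OF tangent_atlas_cover[OF M] _ _ _ V])
       (use c in \<open>auto intro: topological_chart_tangent_chart[OF M] compatible_tangent_chart[OF M]\<close>)
  then show ?thesis
    unfolding slit_bundle_def open_submanifold_def slit_chart_def VV by simp
qed

lemma atlased_slit_bundle:
  assumes M: "atlased M"
  shows "atlased (slit_bundle M)"
proof -
  let ?TM = "tangent_bundle M"
  note TM = atlased_tangent_bundle(1)[OF M]
  have ch: "charts (slit_bundle M) = {c \<in> charts ?TM. fst c \<subseteq> slit}"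
    and top: "mtop (slit_bundle M) = subtopology (mtop ?TM) slit"
    by (simp_all add: slit_bundle_def open_submanifold_def)
  show ?thesis
    unfolding atlased_def
  proof (intro conjI ballI)
    show "(\<Union>c\<in>charts (slit_bundle M). fst c) = points (slit_bundle M)"
    proof
      show "(\<Union>c\<in>charts (slit_bundle M). fst c) \<subseteq> points (slit_bundle M)"
        using atlased_chart_subset[OF TM] unfolding ch top by auto
      show "points (slit_bundle M) \<subseteq> (\<Union>c\<in>charts (slit_bundle M). fst c)"
      proof
        fix u assume u: "u \<in> points (slit_bundle M)"
        then obtain c where c: "c \<in> charts M" "fst u \<in> fst c"
          using atlased_obtain_chart[OF M, of "fst u"] by (auto simp: points_slit_bundle[OF M])
        then have "u \<in> fst (slit_chart M c)"
          using u by (simp add: slit_chart_def slit_def points_slit_bundle[OF M])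
        then show "u \<in> (\<Union>c\<in>charts (slit_bundle M). fst c)"
          using slit_chart_in[OF M c(1)] by blast
      qed
    qed
    show "topological_chart (mtop (slit_bundle M)) c" if "c \<in> charts (slit_bundle M)" for c
    proof -
      have c: "topological_chart (mtop ?TM) c" "fst c \<subseteq> slit"
        using that atlased_topological_chart[OF TM] unfolding ch by auto
      then have "openin (subtopology (mtop ?TM) slit) (fst c)"
        using topological_chartD(1)[OF c(1)] by (auto simp: openin_subtopology)
      then show ?thesis
        using c unfolding topological_chart_def top by (simp add: subtopology_subtopology inf.absorb2)
    qed
    show "compatible c d" if "c \<in> charts (slit_bundle M)" "d \<in> charts (slit_bundle M)" for c d
      using that TM unfolding ch atlased_def by blast
  qed
qed

lemma smooth_into_at_slit:
  assumes "smooth_into_at (tangent_bundle M) \<phi> x" "snd (\<phi> x) \<noteq> zero_vec"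
  shows "smooth_into_at (slit_bundle M) \<phi> x"
  using assms by (auto simp: smooth_into_at_def slit_bundle_def open_submanifold_def slit_def)

text \<open>
  The parameters \<open>a\<close> and \<open>w\<close> allow the base point and the direction to vary independently.
\<close>

lemma smooth_into_at_lift:
  assumes N: "atlased N" and \<phi>: "smooth_into_at N \<phi> (a x)" and a: "smooth_at x a" and w: "smooth_at x w"
  shows "smooth_into_at (tangent_bundle N) (\<lambda>y. (\<phi> (a y), pushforward N \<phi> (a y) (w y))) x"
proof -
  obtain d where d: "d \<in> charts N" "\<phi> (a x) \<in> fst d"
    using atlased_obtain_chart[OF N smooth_into_at_points[OF \<phi>]] .
  have ev: "\<forall>\<^sub>F y in nhds x. (\<phi> (a y), pushforward N \<phi> (a y) (w y)) \<in> fst (tangent_chart N d)"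
    using smooth_at_eventually_image[OF a smooth_into_at_eventually_chart[OF \<phi> d]]
      smooth_at_eventually_image[OF a smooth_into_at_eventually[OF N \<phi>]]
    by eventually_elim (simp add: pushforward_tangent[OF N])
  show ?thesis
  proof (rule smooth_into_atI[OF atlased_tangent_bundle(1)[OF N] atlased_tangent_bundle(2)[OF N d(1)] _ ev])
    show "(\<phi> (a x), pushforward N \<phi> (a x) (w x)) \<in> fst (tangent_chart N d)"
      using eventually_nhds_x_imp_x[OF ev] .
    show "smooth_at x (\<lambda>y. snd (tangent_chart N d) (\<phi> (a y), pushforward N \<phi> (a y) (w y)))"
      using smooth_at_chart_lift[OF \<phi> a w d] by simp
  qed
qed

text \<open>
  In slit charts the tangent map sends \<open>(x, y)\<close> to the point \<open>f x\<close> together with the derivative of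
  \<open>f\<close> applied to \<open>y\<close>. A nonzero image of \<open>u\<close> keeps the map in the slit bundle near \<open>u\<close>.
\<close>

lemma smooth_map_at_tangent_map:
  assumes M: "atlased M" and N: "atlased N" and u: "u \<in> points (slit_bundle M)"
    and f: "\<And>q. q \<in> points M \<Longrightarrow> smooth_map_at M N f q"
    and nz: "differential M N f (fst u) (snd u) \<noteq> zero_vec"
  shows "smooth_map_at (slit_bundle M) (slit_bundle N) (tangent_map M N f) u"
proof -
  have up: "fst u \<in> points M" "snd u \<in> tangent_space M (fst u)" "snd u \<noteq> zero_vec"
    using u by (auto simp: points_slit_bundle[OF M])
  obtain c where c: "c \<in> charts M" "fst u \<in> fst c"
    using atlased_obtain_chart[OF M up(1)] .
  let ?sc = "slit_chart M c" and ?tc = "tangent_chart M c"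
  have usc: "u \<in> fst ?sc" using up c by (simp add: slit_chart_def slit_def)
  have sc: "?sc \<in> charts (slit_bundle M)" by (rule slit_chart_in[OF M c(1)])
  have su: "snd ?sc u = (snd c (fst u), snd u c)" by (simp add: slit_chart_def)
  let ?\<phi> = "\<lambda>x. f (chart_inv c x)"
  let ?l = "\<lambda>y. (?\<phi> (fst y), pushforward N ?\<phi> (fst y) (snd y))"
  have fu: "smooth_map_at M N f (fst u)" by (rule f[OF up(1)])
  have l: "smooth_into_at (tangent_bundle N) ?l (snd ?sc u)"
  proof (rule smooth_into_at_lift[OF N])
    show "smooth_into_at N ?\<phi> (fst (snd ?sc u))" using smooth_map_atD[OF fu c] by (simp add: su)
  qed simp_all
  have "snd (?l (snd ?sc u)) = differential M N f (fst u) (snd u)"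
    using differential_chart[OF M fu c up(2)] by (simp add: su)
  then have l': "smooth_into_at (slit_bundle N) ?l (snd ?sc u)"
    using smooth_into_at_slit[OF l] nz by simp
  have tinv: "chart_inv ?sc z = chart_inv ?tc z" if "z \<in> snd ?sc ` fst ?sc" for z
  proof -
    have "chart_inv (fst ?tc \<inter> slit, snd ?tc) z = chart_inv ?tc z"
      by (rule chart_inv_restrict[OF topological_chart_tangent_chart[OF M c(1)]])
         (use that in \<open>simp add: slit_chart_def\<close>)
    then show ?thesis by (simp add: slit_chart_def)
  qed
  have "\<forall>\<^sub>F z in nhds (snd ?sc u). z \<in> snd ?sc ` fst ?sc"
    using topological_chartD(2)[OF atlased_topological_chart[OF atlased_slit_bundle[OF M] sc]] usc
    by (intro eventually_nhds_in_open) auto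
  then have "\<forall>\<^sub>F z in nhds (snd ?sc u). ?l z = tangent_map M N f (chart_inv ?sc z)"
  proof (rule eventually_mono)
    fix z assume z: "z \<in> snd ?sc ` fst ?sc"
    then have "fst z \<in> snd c ` fst c" by (auto simp: slit_chart_def)
    then obtain p where p: "p \<in> fst c" "fst z = snd c p" by blast
    have inv: "chart_inv ?sc z = (p, pushforward M (chart_inv c) (snd c p) (snd z))"
      using tinv[OF z] chart_inv_tangent_chart[OF M c(1), of "fst z" "snd z"] p atlased_inv[OF M c(1) p(1)]
      by (cases z) auto
    have "differential M N f (chart_inv c (snd c p)) (pushforward M (chart_inv c) (snd c p) (snd z))
        = pushforward N ?\<phi> (snd c p) (snd z)"
      by (rule differential_pushforward[OF M smooth_into_at_chart_inv[OF M c(1) p(1)]])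
         (use f[OF atlased_chart_subset[OF M c(1) p(1)]] atlased_inv[OF M c(1) p(1)] in simp)
    then show "?l z = tangent_map M N f (chart_inv ?sc z)"
      using inv p atlased_inv[OF M c(1) p(1)] by (simp add: tangent_map_def)
  qed
  from smooth_into_at_cong_ev[OF this l'] show ?thesis
    by (rule smooth_map_atI[OF atlased_slit_bundle[OF M] sc usc])
qed

section \<open>Global smooth maps and smooth curves\<close>

lemma smooth_map_imp_smooth_map_at:
  assumes M: "atlased M" and N: "atlased N" and f: "smooth_map M N f" and p: "p \<in> points M"
  shows "smooth_map_at M N f p"
proof -
  have cont: "continuous_map (mtop M) (mtop N) f"
    and sm: "\<And>c d. c \<in> charts M \<Longrightarrow> d \<in> charts N \<Longrightarrow> smooth_on (snd c ` (fst c \<inter> f -` fst d)) (snd d \<circ> f \<circ> chart_inv c)"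
    using f by (auto simp: smooth_map_def)
  obtain c where c: "c \<in> charts M" "p \<in> fst c"
    using atlased_obtain_chart[OF M p] .
  have "f p \<in> points N" using cont p by (auto simp: continuous_map_def)
  then obtain d where d: "d \<in> charts N" "f p \<in> fst d"
    using atlased_obtain_chart[OF N] by blast
  note tc = atlased_topological_chart[OF M c(1)] and td = atlased_topological_chart[OF N d(1)]
  let ?V = "{q \<in> points M. f q \<in> fst d}"
  have V: "openin (mtop M) ?V"
    by (rule openin_continuous_map_preimage[OF cont topological_chartD(1)[OF td]])
  have eq: "fst c \<inter> ?V = fst c \<inter> f -` fst d"
    using atlased_chart_subset[OF M c(1)] by auto
  show ?thesis
  proof (rule smooth_map_atI[OF M c], rule smooth_into_atI[OF N d(1)])
    show "f (chart_inv c (snd c p)) \<in> fst d" using d atlased_inv[OF M c] by simp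
    show "\<forall>\<^sub>F y in nhds (snd c p). f (chart_inv c y) \<in> fst d"
      using chart_eventually[OF tc V c(2)] p d(2) by (auto elim: eventually_mono)
    have "open (snd c ` (fst c \<inter> f -` fst d))"
      using topological_chartD(4)[OF tc V] unfolding eq .
    from smooth_on_imp_smooth_at[OF sm[OF c(1) d(1)] this, of "snd c p"]
    show "smooth_at (snd c p) (\<lambda>y. snd d (f (chart_inv c y)))"
      using c d by (simp add: o_def)
  qed
qed

lemma smooth_mapI:
  assumes M: "atlased M" and N: "atlased N" and f: "\<And>p. p \<in> points M \<Longrightarrow> smooth_map_at M N f p"
  shows "smooth_map M N f"
  unfolding smooth_map_def continuous_map_def
proof (intro conjI allI impI ballI)
  show "f \<in> points M \<rightarrow> points N"
    using smooth_map_at_image[OF M f] by auto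
  fix V assume V: "openin (mtop N) V"
  show "openin (mtop M) {p \<in> points M. f p \<in> V}"
  proof (subst openin_subopen, intro ballI)
    fix p assume p: "p \<in> {p \<in> points M. f p \<in> V}"
    then obtain c where c: "c \<in> charts M" "p \<in> fst c"
      using atlased_obtain_chart[OF M] by blast
    have "\<forall>\<^sub>F x in nhds (snd c p). f (chart_inv c x) \<in> V"
      using smooth_into_at_eventually_open[OF N smooth_map_atD[OF f c] V] p atlased_inv[OF M c] by simp
    then obtain W where W: "open W" "snd c p \<in> W" "\<forall>x\<in>W. f (chart_inv c x) \<in> V"
      by (auto simp: eventually_nhds)
    have "openin (mtop M) {q \<in> fst c. snd c q \<in> W}"
      by (rule topological_chartD(5)[OF atlased_topological_chart[OF M c(1)] W(1)])
    moreover have "{q \<in> fst c. snd c q \<in> W} \<subseteq> {p \<in> points M. f p \<in> V}"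
      using atlased_chart_subset[OF M c(1)] W(3) atlased_inv[OF M c(1)] by fastforce
    ultimately show "\<exists>T. openin (mtop M) T \<and> p \<in> T \<and> T \<subseteq> {p \<in> points M. f p \<in> V}"
      using c(2) W(2) by blast
  qed
next
  fix c d assume c: "c \<in> charts M" and d: "d \<in> charts N"
  show "smooth_on (snd c ` (fst c \<inter> f -` fst d)) (snd d \<circ> f \<circ> chart_inv c)"
  proof (rule smooth_on_if_smooth_at)
    fix x assume "x \<in> snd c ` (fst c \<inter> f -` fst d)"
    then obtain p where p: "p \<in> fst c" "f p \<in> fst d" "x = snd c p" by auto
    show "smooth_at x (snd d \<circ> f \<circ> chart_inv c)"
      using smooth_into_at_chart[OF smooth_map_atD[OF f[OF atlased_chart_subset[OF M c p(1)]] c p(1)] d] p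
        atlased_inv[OF M c p(1)] by (simp add: o_def)
  qed
qed

lemma smooth_curve_iff:
  assumes M: "atlased M"
  shows "smooth_curve M I \<gamma> \<longleftrightarrow> open I \<and> is_interval I \<and> (\<forall>t\<in>I. smooth_into_at M \<gamma> t)"
proof (intro iffI conjI ballI)
  assume s: "smooth_curve M I \<gamma>"
  then show I: "open I" and "is_interval I" by (auto simp: smooth_curve_def)
  have cont: "continuous_map (top_of_set I) (mtop M) \<gamma>" using s by (simp add: smooth_curve_def)
  fix t assume t: "t \<in> I"
  have "\<gamma> t \<in> points M" using cont t by (auto simp: continuous_map_def)
  then obtain d where d: "d \<in> charts M" "\<gamma> t \<in> fst d"
    using atlased_obtain_chart[OF M] by blast
  have "openin (top_of_set I) {t \<in> I. \<gamma> t \<in> fst d}"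
    using openin_continuous_map_preimage[OF cont topological_chartD(1)[OF atlased_topological_chart[OF M d(1)]]]
    by simp
  then have o: "open (I \<inter> \<gamma> -` fst d)"
    using I by (simp add: openin_open_eq Int_def)
  show "smooth_into_at M \<gamma> t"
  proof (rule smooth_into_atI[OF M d(1)])
    show "\<gamma> t \<in> fst d" by (rule d(2))
    have "\<forall>\<^sub>F s in nhds t. s \<in> I \<inter> \<gamma> -` fst d"
      using o t d by (intro eventually_nhds_in_open) auto
    then show "\<forall>\<^sub>F s in nhds t. \<gamma> s \<in> fst d" by (rule eventually_mono) simp
    show "smooth_at t (\<lambda>s. snd d (\<gamma> s))"
      using smooth_on_imp_smooth_at[of "I \<inter> \<gamma> -` fst d" "snd d \<circ> \<gamma>" t] s o t d
      by (simp add: smooth_curve_def o_def)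
  qed
next
  assume s: "open I \<and> is_interval I \<and> (\<forall>t\<in>I. smooth_into_at M \<gamma> t)"
  show "smooth_curve M I \<gamma>"
    unfolding smooth_curve_def continuous_map_def
  proof (intro conjI allI impI ballI)
    show "\<gamma> \<in> topspace (top_of_set I) \<rightarrow> points M"
      using s smooth_into_at_points by fastforce
    fix V assume V: "openin (mtop M) V"
    have "open {t \<in> I. \<gamma> t \<in> V}"
    proof (rule openI_eventually)
      fix t assume t: "t \<in> {t \<in> I. \<gamma> t \<in> V}"
      then have "\<forall>\<^sub>F s in nhds t. \<gamma> s \<in> V"
        using smooth_into_at_eventually_open[OF M _ V] s by blast
      moreover have "\<forall>\<^sub>F s in nhds t. s \<in> I" using s t by (intro eventually_nhds_in_open) auto
      ultimately show "\<forall>\<^sub>F s in nhds t. s \<in> {t \<in> I. \<gamma> t \<in> V}" by eventually_elim simp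
    qed
    then show "openin (top_of_set I) {t \<in> topspace (top_of_set I). \<gamma> t \<in> V}"
      by (auto intro!: open_subset)
  next
    fix d assume "d \<in> charts M"
    then show "smooth_on (I \<inter> \<gamma> -` fst d) (snd d \<circ> \<gamma>)"
      using s smooth_into_at_chart unfolding o_def by (intro smooth_on_if_smooth_at) blast
  qed (use s in auto)
qed

lemma velocity_pushforward:
  assumes "smooth_into_at M \<gamma> t"
  shows "velocity M \<gamma> t = pushforward M \<gamma> t 1"
proof
  fix d
  have "vector_derivative (snd d \<circ> \<gamma>) (at t) = frechet_derivative (\<lambda>y. snd d (\<gamma> y)) (at t) 1"
    if "d \<in> charts M" "\<gamma> t \<in> fst d"
    using vector_derivative_at[OF smooth_at_has_vector_derivative[OF smooth_into_at_chart[OF assms that]]]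
    by (simp add: o_def)
  then show "velocity M \<gamma> t d = pushforward M \<gamma> t 1 d"
    by (simp add: velocity_def pushforward_def)
qed

lemma velocity_cong_ev:
  assumes "\<forall>\<^sub>F s in nhds t. \<gamma> s = \<delta> s" "smooth_into_at M \<gamma> t"
  shows "velocity M \<gamma> t = velocity M \<delta> t"
  using velocity_pushforward[OF assms(2)] velocity_pushforward[OF smooth_into_at_cong_ev[OF assms]] pushforward_cong_ev[OF assms(1)]
  by metis

lemma velocity_tangent:
  assumes "atlased M" "smooth_into_at M \<gamma> t"
  shows "velocity M \<gamma> t \<in> tangent_space M (\<gamma> t)"
  using velocity_pushforward[OF assms(2)] pushforward_tangent[OF assms] by simp

lemma velocity_compose:
  assumes "atlased M" "smooth_into_at M \<gamma> t" "smooth_map_at M N f (\<gamma> t)"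
  shows "velocity N (\<lambda>s. f (\<gamma> s)) t = differential M N f (\<gamma> t) (velocity M \<gamma> t)"
  using velocity_pushforward[OF assms(2)] velocity_pushforward[OF smooth_into_at_postcompose[OF assms]]
    differential_pushforward[OF assms] by simp

lemma smooth_into_at_tangent_lift:
  assumes M: "atlased M" and \<gamma>: "smooth_into_at M \<gamma> t" and nz: "velocity M \<gamma> t \<noteq> zero_vec"
  shows "smooth_into_at (slit_bundle M) (tangent_lift M \<gamma>) t"
proof (rule smooth_into_at_cong_ev)
  show "\<forall>\<^sub>F s in nhds t. (\<gamma> s, pushforward M \<gamma> s 1) = tangent_lift M \<gamma> s"
    using smooth_into_at_eventually[OF M \<gamma>] by (rule eventually_mono) (simp add: tangent_lift_def velocity_pushforward)
  show "smooth_into_at (slit_bundle M) (\<lambda>s. (\<gamma> s, pushforward M \<gamma> s 1)) t"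
    by (rule smooth_into_at_slit[OF smooth_into_at_lift[OF M, of \<gamma> "\<lambda>s. s"]])
       (use \<gamma> nz in \<open>simp_all add: velocity_pushforward\<close>)
qed

lemma velocity_tangent_lift_cong:
  assumes M: "atlased M" and ev: "\<forall>\<^sub>F s in nhds t. \<gamma> s = \<delta> s"
    and \<gamma>: "smooth_into_at M \<gamma> t" and nz: "velocity M \<gamma> t \<noteq> zero_vec"
  shows "velocity (slit_bundle M) (tangent_lift M \<gamma>) t = velocity (slit_bundle M) (tangent_lift M \<delta>) t"
proof (rule velocity_cong_ev[OF _ smooth_into_at_tangent_lift[OF M \<gamma> nz]])
  have "\<forall>\<^sub>F s in nhds t. \<forall>\<^sub>F r in nhds s. \<gamma> r = \<delta> r"
    using ev by (simp add: eventually_eventually)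
  with ev smooth_into_at_eventually[OF M \<gamma>]
  show "\<forall>\<^sub>F s in nhds t. tangent_lift M \<gamma> s = tangent_lift M \<delta> s"
    by eventually_elim (simp add: tangent_lift_def velocity_cong_ev)
qed

lemma tangent_lift_compose:
  assumes "atlased M" "smooth_into_at M \<gamma> t" "smooth_map_at M N f (\<gamma> t)"
  shows "tangent_lift N (\<lambda>s. f (\<gamma> s)) t = tangent_map M N f (tangent_lift M \<gamma> t)"
  by (simp add: tangent_lift_def tangent_map_def velocity_compose[OF assms])

text \<open>
  The second order chain rule: it transports the geodesic equation along \<open>f\<close>.
\<close>

lemma velocity_tangent_lift_compose:
  assumes M: "atlased M" and N: "atlased N" and \<gamma>: "smooth_into_at M \<gamma> t"
    and f: "\<And>q. q \<in> points M \<Longrightarrow> smooth_map_at M N f q"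
    and nz: "velocity N (\<lambda>s. f (\<gamma> s)) t \<noteq> zero_vec" "velocity M \<gamma> t \<noteq> zero_vec"
  shows "velocity (slit_bundle N) (tangent_lift N (\<lambda>s. f (\<gamma> s))) t
    = differential (slit_bundle M) (slit_bundle N) (tangent_map M N f) (tangent_lift M \<gamma> t)
        (velocity (slit_bundle M) (tangent_lift M \<gamma>) t)"
proof -
  note f\<gamma> = f[OF smooth_into_at_points[OF \<gamma>]]
  have l: "smooth_into_at (slit_bundle M) (tangent_lift M \<gamma>) t"
    by (rule smooth_into_at_tangent_lift[OF M \<gamma> nz(2)])
  have Tf: "smooth_map_at (slit_bundle M) (slit_bundle N) (tangent_map M N f) (tangent_lift M \<gamma> t)"
    by (rule smooth_map_at_tangent_map[OF M N smooth_into_at_points[OF l] f])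
       (use nz velocity_compose[OF M \<gamma> f\<gamma>] in \<open>simp_all add: tangent_lift_def\<close>)
  have "\<forall>\<^sub>F s in nhds t. tangent_map M N f (tangent_lift M \<gamma> s) = tangent_lift N (\<lambda>s. f (\<gamma> s)) s"
    using smooth_into_at_eventually[OF M \<gamma>]
    by (rule eventually_mono) (use f smooth_into_at_points in \<open>metis tangent_lift_compose[OF M]\<close>)
  from velocity_cong_ev[OF this smooth_into_at_postcompose[OF atlased_slit_bundle[OF M] l Tf]]
    velocity_compose[OF atlased_slit_bundle[OF M] l Tf]
  show ?thesis by simp
qed

section \<open>Products of manifolds\<close>

lemma topological_chart_prod:
  assumes c: "topological_chart T c" and d: "topological_chart T' d"
  shows "topological_chart (prod_topology T T') (fst c \<times> fst d, map_prod (snd c) (snd d))"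
proof (rule topological_chartI)
  show "openin (prod_topology T T') (fst c \<times> fst d)"
    using topological_chartD(1)[OF c] topological_chartD(1)[OF d] by (simp add: openin_prod_Times_iff)
  show "inj_on (map_prod (snd c) (snd d)) (fst c \<times> fst d)"
    by (rule map_prod_inj_on[OF topological_chartD(3)[OF c] topological_chartD(3)[OF d]])
  show "openin (prod_topology T T') {p \<in> fst c \<times> fst d. map_prod (snd c) (snd d) p \<in> W}" if W: "open W" for W
  proof (subst openin_subopen, intro ballI)
    fix p assume p: "p \<in> {p \<in> fst c \<times> fst d. map_prod (snd c) (snd d) p \<in> W}"
    then have "(snd c (fst p), snd d (snd p)) \<in> W"
      by (auto simp: map_prod_def split_beta)
    then obtain A B where AB: "open A" "open B" "(snd c (fst p), snd d (snd p)) \<in> A \<times> B" "A \<times> B \<subseteq> W"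
      by (rule open_prod_elim[OF W])
    have "openin (prod_topology T T') ({q \<in> fst c. snd c q \<in> A} \<times> {q \<in> fst d. snd d q \<in> B})"
      using topological_chartD(5)[OF c AB(1)] topological_chartD(5)[OF d AB(2)] by (simp add: openin_prod_Times_iff)
    then show "\<exists>U. openin (prod_topology T T') U \<and> p \<in> U \<and>
        U \<subseteq> {p \<in> fst c \<times> fst d. map_prod (snd c) (snd d) p \<in> W}"
      using p AB by (intro exI conjI) auto
  qed
  show "open (map_prod (snd c) (snd d) ` V)" if V: "openin (prod_topology T T') V" "V \<subseteq> fst c \<times> fst d" for V
  proof (subst open_subopen, intro ballI)
    fix z assume "z \<in> map_prod (snd c) (snd d) ` V"
    then obtain p q where pq: "(p, q) \<in> V" "z = (snd c p, snd d q)" by auto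
    then obtain A B where AB: "openin T A" "openin T' B" "p \<in> A" "q \<in> B" "A \<times> B \<subseteq> V"
      using V(1)[unfolded openin_prod_topology_alt, rule_format, OF pq(1)] by blast
    have "open (snd c ` (fst c \<inter> A) \<times> snd d ` (fst d \<inter> B))"
      using topological_chartD(4)[OF c AB(1)] topological_chartD(4)[OF d AB(2)] by (rule open_Times)
    moreover have "z \<in> snd c ` (fst c \<inter> A) \<times> snd d ` (fst d \<inter> B)"
      using pq V(2) AB by auto
    moreover have "snd c ` (fst c \<inter> A) \<times> snd d ` (fst d \<inter> B) \<subseteq> map_prod (snd c) (snd d) ` V"
    proof
      fix w assume "w \<in> snd c ` (fst c \<inter> A) \<times> snd d ` (fst d \<inter> B)"
      then obtain p' q' where "p' \<in> A" "q' \<in> B" "w = map_prod (snd c) (snd d) (p', q')" by auto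
      then show "w \<in> map_prod (snd c) (snd d) ` V" using AB(5) by blast
    qed
    ultimately show "\<exists>U. open U \<and> z \<in> U \<and> U \<subseteq> map_prod (snd c) (snd d) ` V" by blast
  qed
qed

lemma chart_inv_prod:
  assumes c: "topological_chart T c" and d: "topological_chart T' d" and "x \<in> snd c ` fst c" "y \<in> snd d ` fst d"
  shows "chart_inv (fst c \<times> fst d, map_prod (snd c) (snd d)) (x, y) = (chart_inv c x, chart_inv d y)"
proof -
  let ?p = "(fst c \<times> fst d, map_prod (snd c) (snd d))"
  have "chart_inv ?p (snd ?p (chart_inv c x, chart_inv d y)) = (chart_inv c x, chart_inv d y)"
    by (rule chart_inv_chart[OF topological_chart_prod[OF c d]]) (simp add: chart_inv_in assms)
  then show ?thesis by (simp add: chart_chart_inv assms)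
qed

lemma compatible_prod:
  assumes M: "atlased M" and N: "atlased N" and c: "c \<in> charts M" "c' \<in> charts M" and d: "d \<in> charts N" "d' \<in> charts N"
  shows "compatible (fst c \<times> fst d, map_prod (snd c) (snd d)) (fst c' \<times> fst d', map_prod (snd c') (snd d'))"
proof -
  let ?p = "\<lambda>c d. (fst c \<times> fst d, map_prod (snd c) (snd d))"
  note tM = atlased_topological_chart[OF M] and tN = atlased_topological_chart[OF N]
  have half: "smooth_at (snd (?p c d) u) (\<lambda>x. snd (?p c' d') (chart_inv (?p c d) x))"
    if c: "c \<in> charts M" "c' \<in> charts M" and d: "d \<in> charts N" "d' \<in> charts N"
      and u: "u \<in> fst (?p c d) \<inter> fst (?p c' d')" for c d c' d' u
  proof (rule smooth_at_cong_ev)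
    have u': "fst u \<in> fst c" "fst u \<in> fst c'" "snd u \<in> fst d" "snd u \<in> fst d'"
      using u by auto
    have uu: "snd (?p c d) u = (snd c (fst u), snd d (snd u))" by (simp add: map_prod_def split_beta)
    show "smooth_at (snd (?p c d) u) (\<lambda>z. (snd c' (chart_inv c (fst z)), snd d' (chart_inv d (snd z))))"
      unfolding uu
    proof (rule smooth_at_Pair)
      show "smooth_at (snd c (fst u), snd d (snd u)) (\<lambda>z. snd c' (chart_inv c (fst z)))"
        by (rule smooth_at_compose[of _ fst "\<lambda>x. snd c' (chart_inv c x)"])
           (use atlased_transition[OF M c u'(1,2)] in simp_all)
      show "smooth_at (snd c (fst u), snd d (snd u)) (\<lambda>z. snd d' (chart_inv d (snd z)))"
        by (rule smooth_at_compose[of _ snd "\<lambda>x. snd d' (chart_inv d x)"])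
           (use atlased_transition[OF N d u'(3,4)] in simp_all)
    qed
    have "open (snd c ` fst c \<times> snd d ` fst d)"
      using topological_chartD(2)[OF tM[OF c(1)]] topological_chartD(2)[OF tN[OF d(1)]] by (rule open_Times)
    then have "\<forall>\<^sub>F z in nhds (snd (?p c d) u). z \<in> snd c ` fst c \<times> snd d ` fst d"
      unfolding uu by (rule eventually_nhds_in_open) (use u' in simp)
    then show "\<forall>\<^sub>F z in nhds (snd (?p c d) u). (snd c' (chart_inv c (fst z)), snd d' (chart_inv d (snd z)))
        = snd (?p c' d') (chart_inv (?p c d) z)"
    proof (rule eventually_mono)
      fix z assume "z \<in> snd c ` fst c \<times> snd d ` fst d"
      then have "chart_inv (?p c d) (fst z, snd z) = (chart_inv c (fst z), chart_inv d (snd z))"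
        by (intro chart_inv_prod[OF tM[OF c(1)] tN[OF d(1)]]) auto
      then show "(snd c' (chart_inv c (fst z)), snd d' (chart_inv d (snd z))) = snd (?p c' d') (chart_inv (?p c d) z)"
        by simp
    qed
  qed
  show ?thesis
    unfolding compatible_iff[OF topological_chart_prod[OF tM[OF c(1)] tN[OF d(1)]] topological_chart_prod[OF tM[OF c(2)] tN[OF d(2)]]]
    using half[OF c d] half[OF c(2,1) d(2,1)] by blast
qed

lemma atlased_prod_manifold:
  assumes M: "atlased M" and N: "atlased N"
  shows "atlased (prod_manifold M N)"
    "\<And>c d. c \<in> charts M \<Longrightarrow> d \<in> charts N \<Longrightarrow>
       (fst c \<times> fst d, map_prod (snd c) (snd d)) \<in> charts (prod_manifold M N)"
proof -
  let ?A = "{(fst c \<times> fst d, map_prod (snd c) (snd d)) |c d. c \<in> charts M \<and> d \<in> charts N}"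
  have cov: "(\<Union>c\<in>?A. fst c) = topspace (prod_topology (mtop M) (mtop N))"
  proof (intro equalityI subsetI)
    fix u assume "u \<in> (\<Union>c\<in>?A. fst c)"
    then obtain c d where "c \<in> charts M" "d \<in> charts N" "u \<in> fst c \<times> fst d" by auto
    then show "u \<in> topspace (prod_topology (mtop M) (mtop N))"
      using atlased_chart_subset[OF M] atlased_chart_subset[OF N] by (simp add: mem_Times_iff)
  next
    fix u assume u: "u \<in> topspace (prod_topology (mtop M) (mtop N))"
    then have "fst u \<in> points M" "snd u \<in> points N" by auto
    then obtain c d where "c \<in> charts M" "fst u \<in> fst c" "d \<in> charts N" "snd u \<in> fst d"
      using atlased_obtain_chart[OF M] atlased_obtain_chart[OF N] by metis
    moreover from this have "u \<in> fst (fst c \<times> fst d, map_prod (snd c) (snd d))"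
      by (simp add: mem_Times_iff)
    ultimately show "u \<in> (\<Union>c\<in>?A. fst c)" by blast
  qed
  have top: "topological_chart (prod_topology (mtop M) (mtop N)) c" if "c \<in> ?A" for c
    using that topological_chart_prod[OF atlased_topological_chart[OF M] atlased_topological_chart[OF N]] by blast
  have comp: "compatible c d" if "c \<in> ?A" "d \<in> ?A" for c d
    using that compatible_prod[OF M N] by blast
  show "atlased (prod_manifold M N)"
    unfolding prod_manifold_def by (rule atlased_manifold_of_atlas(1)[OF cov top comp])
  have "?A \<subseteq> charts (prod_manifold M N)"
    unfolding prod_manifold_def by (rule atlased_manifold_of_atlas(2)[OF cov top comp])
  then show "(fst c \<times> fst d, map_prod (snd c) (snd d)) \<in> charts (prod_manifold M N)"
    if "c \<in> charts M" "d \<in> charts N" for c d using that by blast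
qed

lemma smooth_into_at_Pair:
  assumes M: "atlased M" and N: "atlased N" and \<alpha>: "smooth_into_at M \<alpha> x" and \<beta>: "smooth_into_at N \<beta> x"
  shows "smooth_into_at (prod_manifold M N) (\<lambda>y. (\<alpha> y, \<beta> y)) x"
proof -
  obtain c where c: "c \<in> charts M" "\<alpha> x \<in> fst c"
    using atlased_obtain_chart[OF M smooth_into_at_points[OF \<alpha>]] .
  obtain d where d: "d \<in> charts N" "\<beta> x \<in> fst d"
    using atlased_obtain_chart[OF N smooth_into_at_points[OF \<beta>]] .
  show ?thesis
  proof (rule smooth_into_atI[OF atlased_prod_manifold(1)[OF M N] atlased_prod_manifold(2)[OF M N c(1) d(1)]])
    show "\<forall>\<^sub>F y in nhds x. (\<alpha> y, \<beta> y) \<in> fst (fst c \<times> fst d, map_prod (snd c) (snd d))"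
      using smooth_into_at_eventually_chart[OF \<alpha> c] smooth_into_at_eventually_chart[OF \<beta> d] by eventually_elim simp
    show "smooth_at x (\<lambda>y. snd (fst c \<times> fst d, map_prod (snd c) (snd d)) (\<alpha> y, \<beta> y))"
      using smooth_at_Pair[OF smooth_into_at_chart[OF \<alpha> c] smooth_into_at_chart[OF \<beta> d]] by simp
  qed (use c d in simp)
qed

section \<open>Lie groups\<close>

locale lie_group_mfd = group G for G :: "('g, 'z) monoid_scheme" (structure) +
  fixes N :: "('g, 'e::euclidean_space) manifold"
  assumes lie: "lie_group G N"
begin

lemma atlased_N: "atlased N"
  using lie smooth_manifold_atlased by (auto simp: lie_group_def)

lemma points_N: "points N = carrier G"
  using lie by (simp add: lie_group_def)

lemma smooth_into_at_mult:
  assumes "smooth_into_at N \<alpha> x" "smooth_into_at N \<beta> x"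
  shows "smooth_into_at N (\<lambda>y. \<alpha> y \<otimes> \<beta> y) x"
proof -
  note p = smooth_into_at_Pair[OF atlased_N atlased_N assms]
  have "smooth_map (prod_manifold N N) N (\<lambda>(x, y). x \<otimes> y)"
    using lie by (simp add: lie_group_def)
  from smooth_map_imp_smooth_map_at[OF atlased_prod_manifold(1)[OF atlased_N atlased_N] atlased_N this smooth_into_at_points[OF p]]
  have "smooth_into_at N (\<lambda>y. (\<lambda>(x, y). x \<otimes> y) (\<alpha> y, \<beta> y)) x"
    by (rule smooth_into_at_postcompose[OF atlased_prod_manifold(1)[OF atlased_N atlased_N] p])
  then show ?thesis by simp
qed

lemma smooth_into_at_inverse:
  assumes "smooth_into_at N \<alpha> x"
  shows "smooth_into_at N (\<lambda>y. inv (\<alpha> y)) x"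
proof -
  have "smooth_map N N (\<lambda>x. inv x)"
    using lie by (simp add: lie_group_def)
  from smooth_map_imp_smooth_map_at[OF atlased_N atlased_N this smooth_into_at_points[OF assms]]
  show ?thesis by (rule smooth_into_at_postcompose[OF atlased_N assms])
qed

lemma smooth_into_at_const: "g \<in> carrier G \<Longrightarrow> smooth_into_at N (\<lambda>y. g) x"
  by (auto simp: smooth_into_at_def points_N)

lemma smooth_map_at_left:
  assumes "g \<in> carrier G" "p \<in> carrier G"
  shows "smooth_map_at N N (\<lambda>x. g \<otimes> x) p"
proof -
  obtain c where c: "c \<in> charts N" "p \<in> fst c"
    using atlased_obtain_chart[OF atlased_N] assms points_N by metis
  show ?thesis
    by (rule smooth_map_atI[OF atlased_N c smooth_into_at_mult[OF smooth_into_at_const[OF assms(1)] smooth_into_at_chart_inv[OF atlased_N c]]])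
qed

abbreviation "dL g \<equiv> differential N N (\<lambda>x. g \<otimes> x)"

lemma dL_tangent:
  "g \<in> carrier G \<Longrightarrow> p \<in> carrier G \<Longrightarrow> v \<in> tangent_space N p \<Longrightarrow> dL g p v \<in> tangent_space N (g \<otimes> p)"
  by (rule differential_tangent[OF atlased_N atlased_N smooth_map_at_left])

text \<open>
  Together with \<open>dL_one\<close> this says that left translations act on the tangent bundle of \<open>G\<close>; in
  particular each \<open>dL g p\<close> is invertible.
\<close>

lemma dL_mult:
  assumes "g \<in> carrier G" "h \<in> carrier G" "p \<in> carrier G" "v \<in> tangent_space N p"
  shows "dL g (h \<otimes> p) (dL h p v) = dL (g \<otimes> h) p v"
proof -
  have "dL g (h \<otimes> p) (dL h p v) = differential N N (\<lambda>q. g \<otimes> (h \<otimes> q)) p v"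
    by (rule differential_compose[OF atlased_N atlased_N smooth_map_at_left smooth_map_at_left]) (use assms in auto)
  also have "\<dots> = dL (g \<otimes> h) p v"
    by (rule differential_cong[OF atlased_N _ smooth_map_at_compose[OF atlased_N atlased_N smooth_map_at_left smooth_map_at_left]])
       (use assms in \<open>auto simp: points_N m_assoc\<close>)
  finally show ?thesis .
qed

lemma dL_one:
  assumes "p \<in> carrier G" "v \<in> tangent_space N p"
  shows "dL \<one> p v = v"
proof -
  have "dL \<one> p v = differential N N (\<lambda>q. q) p v"
    by (rule differential_cong[OF atlased_N _ smooth_map_at_left]) (use assms in \<open>auto simp: points_N\<close>)
  also have "\<dots> = v"
    by (rule differential_ident[OF atlased_N]) (use assms in \<open>auto simp: points_N\<close>)
  finally show ?thesis .
qed

lemma dL_inverse: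
  assumes "g \<in> carrier G" "p \<in> carrier G" "v \<in> tangent_space N p"
  shows "dL (inv g) (g \<otimes> p) (dL g p v) = v"
  using dL_mult[of "inv g" g p v] dL_one[of p v] assms by simp

lemma dL_nonzero:
  assumes "g \<in> carrier G" "p \<in> carrier G" "v \<in> tangent_space N p" "v \<noteq> zero_vec"
  shows "dL g p v \<noteq> zero_vec"
proof
  assume "dL g p v = zero_vec"
  then have "v = dL (inv g) (g \<otimes> p) zero_vec"
    using dL_inverse[OF assms(1-3)] by simp
  also have "\<dots> = zero_vec"
    by (rule differential_zero[OF atlased_N atlased_N smooth_map_at_left]) (use assms in auto)
  finally show False using assms(4) by simp
qed

lemma left_velocity_tangent:
  assumes "smooth_into_at N C t"
  shows "left_velocity G N C t \<in> tangent_space N \<one>"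
proof -
  have "C t \<in> carrier G" using smooth_into_at_points[OF assms] by (simp add: points_N)
  then show ?thesis
    using dL_tangent[of "inv (C t)" "C t", OF _ _ velocity_tangent[OF atlased_N assms]]
    by (simp add: left_velocity_def)
qed

lemma velocity_left_velocity:
  assumes "smooth_into_at N C t"
  shows "velocity N C t = dL (C t) \<one> (left_velocity G N C t)"
proof -
  have c: "C t \<in> carrier G" using smooth_into_at_points[OF assms] by (simp add: points_N)
  show ?thesis
    using dL_inverse[of "inv (C t)" "C t" "velocity N C t"] c velocity_tangent[OF atlased_N assms]
    by (simp add: left_velocity_def)
qed

lemma left_velocity_at_one:
  assumes "smooth_into_at N C t" "C t = \<one>"
  shows "left_velocity G N C t = velocity N C t"
  using dL_one[of \<one> "velocity N C t"] velocity_tangent[OF atlased_N assms(1)] assms(2)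
  by (simp add: left_velocity_def)

lemma velocity_left:
  assumes "g \<in> carrier G" "smooth_into_at N C t"
  shows "velocity N (\<lambda>s. g \<otimes> C s) t = dL g (C t) (velocity N C t)"
  by (rule velocity_compose[OF atlased_N assms(2) smooth_map_at_left])
     (use assms smooth_into_at_points[OF assms(2)] in \<open>simp_all add: points_N\<close>)

text \<open>
  In a chart \<open>c\<close> around the identity let \<open>m (a, b)\<close> represent \<open>a\<inverse> b\<close>, and let \<open>x\<close> represent a
  curve through the identity. Its left velocity is \<open>t \<mapsto> D\<^sub>2 m (x t, x t) (x' t)\<close>. Since
  \<open>m (x 0, b) = b\<close>, the derivative of this expression at \<open>0\<close> is \<open>x''(0)\<close> plus a term that depends
  only on \<open>x 0\<close> and \<open>x'(0)\<close>. So \<open>x''(0)\<close> can be read off from the derivative of the left velocity.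
\<close>

lemma second_order_jet:
  assumes C: "smooth_into_at N C 0" "C 0 = \<one>" and D: "smooth_into_at N D 0" "D 0 = \<one>"
    and v: "velocity N C 0 = velocity N D 0"
    and wC: "\<And>d. ((\<lambda>t. left_velocity G N C t d) has_vector_derivative w d) (at 0)"
    and wD: "\<And>d. ((\<lambda>t. left_velocity G N D t d) has_vector_derivative w d) (at 0)"
    and nz: "velocity N C 0 \<noteq> zero_vec"
  shows "velocity (slit_bundle N) (tangent_lift N C) 0 = velocity (slit_bundle N) (tangent_lift N D) 0"
proof -
  obtain c where c: "c \<in> charts N" "\<one> \<in> fst c"
    using atlased_obtain_chart[OF atlased_N] points_N one_closed by metis
  note inv1 = atlased_inv[OF atlased_N c]
  define x0 where "x0 = snd c \<one>"
  define y where "y = velocity N C 0 c"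
  define \<Phi> where "\<Phi> z = inv (chart_inv c (fst z)) \<otimes> chart_inv c (snd z)" for z
  define m where "m z = snd c (\<Phi> z)" for z
  have ci: "smooth_into_at N (chart_inv c) x0"
    unfolding x0_def by (rule smooth_into_at_chart_inv[OF atlased_N c])
  have \<Phi>: "smooth_into_at N \<Phi> (x0, x0)"
    unfolding \<Phi>_def
    by (intro smooth_into_at_mult smooth_into_at_inverse smooth_into_at_precompose[of _ fst] smooth_into_at_precompose[of _ snd])
       (use ci in simp_all)
  have \<Phi>0: "\<Phi> (x0, x0) = \<one>" by (simp add: \<Phi>_def x0_def inv1)
  have m: "smooth_at (x0, x0) m"
    unfolding m_def using smooth_into_at_chart[OF \<Phi> c(1)] \<Phi>0 c(2) by simp
  obtain F where F: "((\<lambda>u. frechet_derivative m (at (fst u)) (snd u)) has_derivative F) (at ((x0, x0), (0, y)))"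
    and Fpq: "\<And>p q. F (p, q) = F (p, 0) + frechet_derivative m (at (x0, x0)) q"
    using frechet_derivative_partial_linear[OF m] by blast
  \<comment> \<open>since \<open>m (x0, b) = b\<close> for \<open>b\<close> near \<open>x0\<close>\<close>
  have m2: "frechet_derivative m (at (x0, x0)) (0, q) = q" for q
  proof -
    have "\<forall>\<^sub>F b in nhds x0. chart_inv c b \<in> points N \<and> snd c (chart_inv c b) = b"
      using chart_eventually[OF atlased_topological_chart[OF atlased_N c(1)] openin_topspace c(2)] points_N
      unfolding x0_def by (auto elim: eventually_mono)
    then have "\<forall>\<^sub>F b in nhds x0. m (x0, b) = b"
      by (rule eventually_mono) (simp add: m_def \<Phi>_def points_N, simp add: x0_def inv1)
    from frechet_derivative_cong_ev[OF this]
    have "frechet_derivative (\<lambda>b. m (x0, b)) (at x0) q = q"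
      using frechet_derivative_eqI[OF has_derivative_ident] by metis
    then show ?thesis
      using frechet_derivative_chain[OF smooth_at_Pair_const, of x0 x0 m q] m by (simp add: frechet_derivative_Pair_const)
  qed
  \<comment> \<open>The formula for the second derivative is proved for any curve \<open>E\<close> with the given first order data and applied to \<open>C\<close> and \<open>D\<close>; the correction term \<open>F ((y, y), 0)\<close> is the same for both.\<close>
  have key: "frechet_derivative (\<lambda>t. frechet_derivative (\<lambda>s. snd c (E s)) (at t) 1) (at 0) 1 = w c - F ((y, y), 0)"
      (is "?x'' = _")
    and tl: "velocity (slit_bundle N) (tangent_lift N E) 0 (slit_chart N c)
      = (y, frechet_derivative (\<lambda>t. frechet_derivative (\<lambda>s. snd c (E s)) (at t) 1) (at 0) 1)"
    if E: "smooth_into_at N E 0" "E 0 = \<one>" and vE: "velocity N E 0 = velocity N C 0"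
      and wE: "((\<lambda>t. left_velocity G N E t c) has_vector_derivative w c) (at 0)" for E
  proof -
    define x where "x = (\<lambda>t. snd c (E t))"
    define x' where "x' = (\<lambda>t. frechet_derivative x (at t) 1)"
    have x0: "x 0 = x0" by (simp add: x_def E x0_def)
    have x: "smooth_at 0 x"
      unfolding x_def using smooth_into_at_chart[OF E(1) c(1)] E(2) c(2) by simp
    have x': "smooth_at 0 x'"
      unfolding x'_def by (rule smooth_at_frechet_derivative[OF x])
    have evE: "\<forall>\<^sub>F t in nhds 0. smooth_into_at N E t"
      by (rule smooth_into_at_eventually[OF atlased_N E(1)])
    have evc: "\<forall>\<^sub>F t in nhds 0. E t \<in> fst c"
      using smooth_into_at_eventually_chart[OF E(1) c(1)] E(2) c(2) by simp
    have velc: "velocity N E t c = x' t" if "smooth_into_at N E t" "E t \<in> fst c" for t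
      using that c(1) by (simp add: velocity_pushforward pushforward_def x'_def x_def)
    have y: "x' 0 = y"
      using velc[OF E(1)] E(2) c(2) vE by (simp add: y_def)
    have xx: "smooth_at 0 (\<lambda>t. (x t, x t))"
      by (rule smooth_at_Pair[OF x x])
    have ev\<Phi>: "\<forall>\<^sub>F t in nhds 0. smooth_into_at N \<Phi> (x t, x t)"
      using smooth_at_eventually_image[OF xx, of "smooth_into_at N \<Phi>"] smooth_into_at_eventually[OF atlased_N \<Phi>] x0 by simp
    have ev: "\<forall>\<^sub>F t in nhds 0. left_velocity G N E t c = frechet_derivative m (at (x t, x t)) (0, x' t)"
      using evE evc ev\<Phi>
    proof eventually_elim
      case (elim t)
      have Et: "E t \<in> carrier G" using smooth_into_at_points[OF elim(1)] by (simp add: points_N)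
      have Et': "chart_inv c (x t) = E t"
        unfolding x_def by (rule atlased_inv[OF atlased_N c(1) elim(2)])
      have \<Phi>t: "\<Phi> (x t, x t) = \<one>" using Et by (simp add: \<Phi>_def Et')
      have mt: "smooth_at (x t, x t) m"
        unfolding m_def using smooth_into_at_chart[OF elim(3) c(1)] \<Phi>t c(2) by simp
      have "left_velocity G N E t c = pushforward N (\<lambda>b. inv (E t) \<otimes> chart_inv c b) (x t) (velocity N E t c) c"
        unfolding left_velocity_def x_def
        by (subst differential_chart[OF atlased_N smooth_map_at_left c(1) elim(2) velocity_tangent[OF atlased_N elim(1)]])
           (use Et in auto)
      also have "\<dots> = frechet_derivative (\<lambda>b. m (x t, b)) (at (x t)) (x' t)"
        using c Et by (simp add: pushforward_def Et' velc[OF elim(1,2)] m_def \<Phi>_def)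
      also have "\<dots> = frechet_derivative m (at (x t, x t)) (0, x' t)"
        using frechet_derivative_chain[OF smooth_at_Pair_const mt, of "x' t"] by (simp add: frechet_derivative_Pair_const)
      finally show ?case .
    qed
    let ?Dx' = "frechet_derivative x' (at 0)"
    have dx: "(x has_vector_derivative y) (at 0)" and dx': "(x' has_vector_derivative ?Dx' 1) (at 0)"
      using smooth_at_has_vector_derivative[OF x] smooth_at_has_vector_derivative[OF x'] y by (simp_all add: x'_def)
    have "((\<lambda>t. ((x t, x t), (0::'e, x' t))) has_vector_derivative ((y, y), (0, ?Dx' 1))) (at 0)"
      by (intro has_vector_derivative_Pair dx dx' has_vector_derivative_const)
    then have "((\<lambda>t. ((x t, x t), (0::'e, x' t))) has_derivative (\<lambda>s. s *\<^sub>R ((y, y), (0, ?Dx' 1)))) (at 0)"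
      by (simp only: has_vector_derivative_def)
    from has_derivative_compose[OF this, of "\<lambda>u. frechet_derivative m (at (fst u)) (snd u)" F] F
    have "((\<lambda>t. frechet_derivative m (at (x t, x t)) (0, x' t)) has_derivative
        (\<lambda>s. F (s *\<^sub>R ((y, y), (0, ?Dx' 1))))) (at 0)"
      by (simp add: x0 y)
    then have "((\<lambda>t. left_velocity G N E t c) has_derivative (\<lambda>s. F (s *\<^sub>R ((y, y), (0, ?Dx' 1))))) (at 0)"
      using has_derivative_cong_nhds[OF ev] by blast
    moreover have "((\<lambda>t. left_velocity G N E t c) has_derivative (\<lambda>s. s *\<^sub>R w c)) (at 0)"
      using wE by (simp only: has_vector_derivative_def)
    ultimately have "(\<lambda>s. F (s *\<^sub>R ((y, y), (0, ?Dx' 1)))) = (\<lambda>s. s *\<^sub>R w c)"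
      by (rule has_derivative_unique)
    from fun_cong[OF this, of 1] have "F ((y, y), (0, ?Dx' 1)) = w c" by simp
    then have "F ((y, y), 0) + ?Dx' 1 = w c"
      using Fpq[of "(y, y)" "(0, ?Dx' 1)"] m2 by simp
    then have "?Dx' 1 = w c - F ((y, y), 0)" by (metis add_diff_cancel_left')
    then show "frechet_derivative (\<lambda>t. frechet_derivative (\<lambda>s. snd c (E s)) (at t) 1) (at 0) 1 = w c - F ((y, y), 0)"
      by (simp add: x'_def x_def)
    have nzE: "velocity N E 0 \<noteq> zero_vec" using nz vE by simp
    note l = smooth_into_at_tangent_lift[OF atlased_N E(1) nzE]
    have "tangent_lift N E 0 \<in> fst (slit_chart N c)"
      using nzE E c velocity_tangent[OF atlased_N E(1)] by (simp add: slit_chart_def slit_def tangent_lift_def)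
    then have "velocity (slit_bundle N) (tangent_lift N E) 0 (slit_chart N c)
        = vector_derivative (\<lambda>t. (snd c (E t), velocity N E t c)) (at 0)"
      using slit_chart_in[OF atlased_N c(1)]
      by (simp add: velocity_def) (simp add: slit_chart_def o_def tangent_lift_def velocity_def)
    also have "\<dots> = (y, ?Dx' 1)"
    proof (rule vector_derivative_at)
      have ev2: "\<forall>\<^sub>F t in nhds 0. (snd c (E t), velocity N E t c) = (x t, x' t)"
        using evE evc by eventually_elim (simp add: velc x_def)
      have "((\<lambda>t. (x t, x' t)) has_derivative (\<lambda>s. s *\<^sub>R (y, ?Dx' 1))) (at 0)"
        using has_vector_derivative_Pair[OF dx dx'] by (simp only: has_vector_derivative_def)
      then show "((\<lambda>t. (snd c (E t), velocity N E t c)) has_vector_derivative (y, ?Dx' 1)) (at 0)"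
        by (simp only: has_vector_derivative_def has_derivative_cong_nhds[OF ev2])
    qed
    finally show "velocity (slit_bundle N) (tangent_lift N E) 0 (slit_chart N c)
      = (y, frechet_derivative (\<lambda>t. frechet_derivative (\<lambda>s. snd c (E s)) (at t) 1) (at 0) 1)"
      by (simp add: x'_def x_def)
  qed
  have nzD: "velocity N D 0 \<noteq> zero_vec" using nz v by simp
  have lC: "tangent_lift N C 0 = tangent_lift N D 0"
    using C D v by (simp add: tangent_lift_def)
  show ?thesis
  proof (rule tangent_space_eqI)
    show "velocity (slit_bundle N) (tangent_lift N C) 0 \<in> tangent_space (slit_bundle N) (tangent_lift N C 0)"
      by (rule velocity_tangent[OF atlased_slit_bundle[OF atlased_N] smooth_into_at_tangent_lift[OF atlased_N C(1) nz]])
    show "velocity (slit_bundle N) (tangent_lift N D) 0 \<in> tangent_space (slit_bundle N) (tangent_lift N C 0)"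
      unfolding lC
      by (rule velocity_tangent[OF atlased_slit_bundle[OF atlased_N] smooth_into_at_tangent_lift[OF atlased_N D(1) nzD]])
    show "slit_chart N c \<in> charts (slit_bundle N)" by (rule slit_chart_in[OF atlased_N c(1)])
    show "tangent_lift N C 0 \<in> fst (slit_chart N c)"
      using nz C c velocity_tangent[OF atlased_N C(1)] by (simp add: slit_chart_def slit_def tangent_lift_def)
    show "velocity (slit_bundle N) (tangent_lift N C) 0 (slit_chart N c)
        = velocity (slit_bundle N) (tangent_lift N D) 0 (slit_chart N c)"
      using tl[OF C refl wC] tl[OF D v[symmetric] wD] key[OF C refl wC] key[OF D v[symmetric] wD] by simp
  qed
qed

text \<open>
  The left invariant vector field of \<open>v\<close> is the derivative of the multiplication in its second
  argument at the identity, with the first argument as a parameter.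
\<close>

lemma left_field_smooth:
  assumes "g \<in> carrier G" "v \<in> tangent_space N \<one>"
  shows "smooth_map_at N (tangent_bundle N) (\<lambda>q. (q, dL q \<one> v)) g"
proof -
  obtain c1 where c1: "c1 \<in> charts N" "\<one> \<in> fst c1"
    using atlased_obtain_chart[OF atlased_N] points_N one_closed by metis
  obtain c where c: "c \<in> charts N" "g \<in> fst c"
    using atlased_obtain_chart[OF atlased_N] points_N assms(1) by metis
  let ?\<phi> = "\<lambda>z. chart_inv c (fst z) \<otimes> chart_inv c1 (snd z)"
  let ?x1 = "snd c1 \<one>"
  have \<phi>: "smooth_into_at N ?\<phi> (snd c g, ?x1)"
    by (intro smooth_into_at_mult smooth_into_at_precompose[of _ fst] smooth_into_at_precompose[of _ snd])
       (use smooth_into_at_chart_inv[OF atlased_N c] smooth_into_at_chart_inv[OF atlased_N c1] in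
         simp_all)
  have sa: "smooth_at (snd c g) (\<lambda>x. (x, ?x1))"
    by (intro smooth_at_Pair) auto
  have l: "smooth_into_at (tangent_bundle N) (\<lambda>x. (?\<phi> (x, ?x1), pushforward N ?\<phi> (x, ?x1) (0, v c1))) (snd c g)"
    using smooth_into_at_lift[OF atlased_N, of ?\<phi> "\<lambda>x. (x, ?x1)" "snd c g" "\<lambda>x. (0, v c1)"] \<phi> sa by simp
  have ev\<phi>: "\<forall>\<^sub>F x in nhds (snd c g). smooth_into_at N ?\<phi> (x, ?x1)"
    by (rule smooth_at_eventually_image[OF sa]) (rule smooth_into_at_eventually[OF atlased_N \<phi>])
  have "\<forall>\<^sub>F x in nhds (snd c g). (?\<phi> (x, ?x1), pushforward N ?\<phi> (x, ?x1) (0, v c1))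
      = (chart_inv c x, dL (chart_inv c x) \<one> v)"
    using eventually_chart_points[OF atlased_N c] ev\<phi>
  proof eventually_elim
    case (elim x)
    then have q: "chart_inv c x \<in> carrier G" by (simp add: points_N)
    have "dL (chart_inv c x) \<one> v = pushforward N (\<lambda>b. ?\<phi> (x, b)) ?x1 (v c1)"
      using differential_chart[OF atlased_N smooth_map_at_left[OF q one_closed] c1 assms(2)] by simp
    also have "\<dots> = pushforward N ?\<phi> (x, ?x1) (frechet_derivative (\<lambda>b. (x, b)) (at ?x1) (v c1))"
      by (rule pushforward_precompose[OF smooth_at_Pair_const, of N ?\<phi>]) (rule elim(2))
    also have "frechet_derivative (\<lambda>b. (x, b)) (at ?x1) (v c1) = (0, v c1)"
      by (rule frechet_derivative_Pair_const)
    finally show ?case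
      using q by (simp add: atlased_inv[OF atlased_N c1])
  qed
  from smooth_into_at_cong_ev[OF this l] show ?thesis
    by (rule smooth_map_atI[OF atlased_N c])
qed

lemma fiber_left_distribution:
  assumes "V \<subseteq> tangent_space N \<one>" "g \<in> carrier G"
  shows "fiber (left_distribution G N V) g = dL g \<one> ` V"
proof (intro equalityI subsetI)
  fix w assume "w \<in> fiber (left_distribution G N V) g"
  then obtain h v where "h \<in> carrier G" "v \<in> V" "(g, w) = tangent_map N N (\<lambda>x. h \<otimes> x) (\<one>, v)"
    by (auto simp: fiber_def left_distribution_def)
  then show "w \<in> dL g \<one> ` V" by (auto simp: tangent_map_def)
next
  fix w assume "w \<in> dL g \<one> ` V"
  then obtain v where v: "v \<in> V" "w = dL g \<one> v" by blast
  then have "(g, w) = tangent_map N N (\<lambda>x. g \<otimes> x) (\<one>, v)"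
    using assms(2) by (simp add: tangent_map_def)
  then show "w \<in> fiber (left_distribution G N V) g"
    using v assms(2) unfolding fiber_def left_distribution_def by blast
qed

lemma left_distribution_cases:
  assumes "u \<in> left_distribution G N V"
  obtains g v where "g \<in> carrier G" "v \<in> V" "u = (g, dL g \<one> v)"
  using assms by (auto simp: left_distribution_def tangent_map_def)

lemma left_distribution_mem: "g \<in> carrier G \<Longrightarrow> v \<in> V \<Longrightarrow> (g, dL g \<one> v) \<in> left_distribution G N V"
  unfolding left_distribution_def tangent_map_def by force

text \<open>
  A basis of \<open>V\<close> spreads to a global left invariant frame.
\<close>

lemma distribution_left_distribution:
  assumes V: "linear_subspace V" "V \<subseteq> tangent_space N \<one>"
  shows "distribution N (left_distribution G N V)"
proof -
  have one: "\<one> \<in> points N" by (simp add: points_N)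
  obtain k and \<beta> :: "nat \<Rightarrow> ('g, 'e) tangent_vector" where
    \<beta>: "\<And>i. i < k \<Longrightarrow> \<beta> i \<in> V" "V = {(\<lambda>c. \<Sum>i<k. a i *\<^sub>R \<beta> i c) |a :: nat \<Rightarrow> real. True}"
      "\<And>a :: nat \<Rightarrow> real. (\<lambda>c. \<Sum>i<k. a i *\<^sub>R \<beta> i c) = zero_vec \<Longrightarrow> \<forall>i<k. a i = 0"
    using linear_subspace_basis[OF atlased_N one V] by blast
  have inV: "(\<lambda>c. \<Sum>i<k. a i *\<^sub>R \<beta> i c) \<in> V" for a :: "nat \<Rightarrow> real"
    by (subst \<beta>(2)) blast
  have \<beta>t: "\<beta> i \<in> tangent_space N \<one>" if "i < k" for i using \<beta>(1)[OF that] V(2) by blast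
  define E where "E i q = dL q \<one> (\<beta> i)" for i q
  have dsum: "dL q \<one> (\<lambda>c. \<Sum>i<k. a i *\<^sub>R \<beta> i c) = (\<lambda>c. \<Sum>i<k. a i *\<^sub>R E i q c)"
    if "q \<in> carrier G" for q and a :: "nat \<Rightarrow> real"
    unfolding E_def
    by (rule differential_sum[OF atlased_N atlased_N smooth_map_at_left[OF that one_closed] \<beta>t subsetD[OF V(2) inV]])
  show ?thesis
    unfolding distribution_def
  proof (intro conjI exI[of _ k] ballI exI[of _ "points N"] exI[of _ E] allI impI)
    show "left_distribution G N V \<subseteq> points (tangent_bundle N)"
    proof
      fix u assume "u \<in> left_distribution G N V"
      then obtain g v where gv: "g \<in> carrier G" "v \<in> V" "u = (g, dL g \<one> v)"
        by (rule left_distribution_cases)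
      then show "u \<in> points (tangent_bundle N)"
        using dL_tangent[OF gv(1) one_closed] V(2) by (auto simp: points_tangent_bundle[OF atlased_N] points_N)
    qed
    show "openin (mtop N) (points N)" by simp
    show "p \<in> points N" if "p \<in> points N" for p by (rule that)
    show "smooth_map (open_submanifold N (points N)) (tangent_bundle N) (\<lambda>q. (q, E i q))" if "i < k" for i
      unfolding open_submanifold_points[OF atlased_N] E_def
      by (rule smooth_mapI[OF atlased_N atlased_tangent_bundle(1)[OF atlased_N] left_field_smooth])
         (use \<beta>t[OF that] in \<open>simp_all add: points_N\<close>)
    show "fiber (left_distribution G N V) q = {(\<lambda>c. \<Sum>i<k. a i *\<^sub>R E i q c) |a :: nat \<Rightarrow> real. True}"
      if "q \<in> points N" for q
    proof -
      have q: "q \<in> carrier G" using that by (simp add: points_N)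
      have "fiber (left_distribution G N V) q = dL q \<one> ` {(\<lambda>c. \<Sum>i<k. a i *\<^sub>R \<beta> i c) |a :: nat \<Rightarrow> real. True}"
        using fiber_left_distribution[OF V(2) q] \<beta>(2) by simp
      also have "\<dots> = {dL q \<one> (\<lambda>c. \<Sum>i<k. a i *\<^sub>R \<beta> i c) |a :: nat \<Rightarrow> real. True}" by blast
      finally show ?thesis by (simp only: dsum[OF q])
    qed
    show "a i = 0" if "q \<in> points N" "(\<lambda>c. \<Sum>i<k. a i *\<^sub>R E i q c) = zero_vec" "i < k"
      for q i and a :: "nat \<Rightarrow> real"
    proof -
      have q: "q \<in> carrier G" using that by (simp add: points_N)
      have "(\<lambda>c. \<Sum>i<k. a i *\<^sub>R \<beta> i c) = zero_vec"
        using dL_nonzero[OF q one_closed subsetD[OF V(2) inV]] that(2) dsum[OF q] by metis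
      then show ?thesis using \<beta>(3) that(3) by blast
    qed
  qed
qed

end

section \<open>Coset manifolds\<close>

lemma geodesicD:
  assumes "geodesic M X I c"
  shows "smooth_curve M I c" "t \<in> I \<Longrightarrow> velocity M c t \<noteq> zero_vec"
    "t \<in> I \<Longrightarrow> velocity (slit_bundle M) (tangent_lift M c) t = X (tangent_lift M c t)"
  using assms by (simp_all add: geodesic_def)

locale lie_group_quotient = lie_group_mfd G N for G :: "('g, 'z) monoid_scheme" (structure) and N :: "('g, 'e::euclidean_space) manifold" +
  fixes H :: "'g set" and M :: "('g set, 'f::euclidean_space) manifold"
  assumes H: "subgroup H G" and M: "coset_manifold G N H M"
begin

abbreviation "\<pi> \<equiv> (\<lambda>g. g <# H)"
abbreviation "d\<pi> \<equiv> differential N M \<pi>"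
abbreviation "dA g \<equiv> differential M M (\<lambda>A. g <# A)"

lemma smooth_manifold_M: "smooth_manifold M"
  using M by (simp add: coset_manifold_def)

lemma atlased_M: "atlased M"
  by (rule smooth_manifold_atlased[OF smooth_manifold_M])

lemma points_M: "points M = lcosets H"
  using M by (simp add: coset_manifold_def)

lemma submersion: "smooth_submersion N M \<pi>"
  using M by (simp add: coset_manifold_def)

lemma H_sub: "H \<subseteq> carrier G"
  using H by (rule subgroup.subset)

lemma \<pi>_points: "g \<in> carrier G \<Longrightarrow> \<pi> g \<in> points M"
  by (auto simp: points_M LCOSETS_def)

lemma points_M_cases:
  assumes "p \<in> points M"
  obtains g where "g \<in> carrier G" "p = \<pi> g"
  using assms by (auto simp: points_M LCOSETS_def)

lemma action_\<pi>: "g \<in> carrier G \<Longrightarrow> h \<in> carrier G \<Longrightarrow> g <# \<pi> h = \<pi> (g \<otimes> h)"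
  by (rule lcos_m_assoc[OF H_sub])

lemma \<pi>_H: "h \<in> H \<Longrightarrow> \<pi> h = H"
  using l_repr_independence[of h \<one> H] H lcos_mult_one[OF H_sub] by simp

lemma smooth_map_at_\<pi>: "g \<in> carrier G \<Longrightarrow> smooth_map_at N M \<pi> g"
  using submersion smooth_map_imp_smooth_map_at[OF atlased_N atlased_M] by (simp add: smooth_submersion_def points_N)

text \<open>
  If \<open>s\<close> is a smooth local section of \<open>\<pi>\<close>, then near \<open>p\<close> the action of \<open>g\<close> is
  \<open>q \<mapsto> \<pi> (g \<otimes> s q)\<close>.
\<close>

lemma smooth_map_at_action:
  assumes g: "g \<in> carrier G" and p: "p \<in> points M"
  shows "smooth_map_at M M (\<lambda>A. g <# A) p"
proof -
  obtain h where h: "h \<in> carrier G" "p = \<pi> h"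
    using p by (rule points_M_cases)
  obtain c where c: "c \<in> charts N" "h \<in> fst c"
    using atlased_obtain_chart[OF atlased_N] points_N h(1) by metis
  obtain d where d: "d \<in> charts M" "p \<in> fst d"
    using atlased_obtain_chart[OF atlased_M p] .
  note ch = atlased_inv[OF atlased_N c]
  let ?f = "\<lambda>x. snd d (\<pi> (chart_inv c x))"
  have \<pi>c: "smooth_into_at M (\<lambda>x. \<pi> (chart_inv c x)) (snd c h)"
    by (rule smooth_map_atD[OF smooth_map_at_\<pi>[OF h(1)] c])
  have f: "smooth_at (snd c h) ?f"
    by (rule smooth_into_at_chart[OF \<pi>c d(1)]) (use ch h d in simp)
  have fx: "?f (snd c h) = snd d p" by (simp add: ch h)
  have "\<exists>x. frechet_derivative ?f (at (snd c h)) x = y" for y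
  proof -
    let ?w = "pushforward M (chart_inv d) (snd d p) y"
    have "?w \<in> tangent_space M p"
      using pushforward_tangent[OF atlased_M smooth_into_at_chart_inv[OF atlased_M d], of y] atlased_inv[OF atlased_M d] by simp
    then have "?w \<in> d\<pi> h ` tangent_space N h"
      using submersion h by (simp add: smooth_submersion_def points_N)
    then obtain v where v: "v \<in> tangent_space N h" "?w = d\<pi> h v" by (rule imageE) simp
    have "y = ?w d"
      using pushforward_chart_inv_chart[OF atlased_M d] by simp
    also have "\<dots> = pushforward M (\<lambda>x. \<pi> (chart_inv c x)) (snd c h) (v c) d"
      using v(2) differential_chart[OF atlased_N smooth_map_at_\<pi>[OF h(1)] c v(1)] by simp
    also have "\<dots> = frechet_derivative ?f (at (snd c h)) (v c)"
      using d ch h by (simp add: pushforward_def)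
    finally show ?thesis by metis
  qed
  then have "surj (frechet_derivative ?f (at (snd c h)))"
    by (metis surjI)
  from smooth_local_right_inverse[OF f this, unfolded fx]
  obtain s where s: "smooth_at (snd d p) s" "s (snd d p) = snd c h" "\<forall>\<^sub>F z in nhds (snd d p). ?f (s z) = z"
    by blast
  have cs: "smooth_into_at N (\<lambda>z. chart_inv c (s z)) (snd d p)"
    by (rule smooth_into_at_precompose[OF s(1)]) (simp add: s(2) smooth_into_at_chart_inv[OF atlased_N c])
  have gs: "smooth_into_at N (\<lambda>z. g \<otimes> chart_inv c (s z)) (snd d p)"
    by (rule smooth_into_at_mult[OF smooth_into_at_const[OF g] cs])
  have \<pi>s: "smooth_into_at M (\<lambda>z. \<pi> (chart_inv c (s z))) (snd d p)"
    by (rule smooth_into_at_precompose[OF s(1)]) (simp add: s(2) \<pi>c)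
  have "smooth_into_at M (\<lambda>z. \<pi> (g \<otimes> chart_inv c (s z))) (snd d p)"
    by (rule smooth_into_at_postcompose[OF atlased_N gs]) (rule smooth_map_at_\<pi>, use ch s(2) g h in simp)
  moreover have "\<forall>\<^sub>F z in nhds (snd d p). \<pi> (chart_inv c (s z)) \<in> fst d"
    by (rule smooth_into_at_eventually_chart[OF \<pi>s d(1)]) (use ch s(2) h d in simp)
  with s(3) smooth_into_at_eventually[OF atlased_N cs]
  have "\<forall>\<^sub>F z in nhds (snd d p). \<pi> (g \<otimes> chart_inv c (s z)) = g <# chart_inv d z"
  proof eventually_elim
    case (elim z)
    have "chart_inv d (snd d (\<pi> (chart_inv c (s z)))) = \<pi> (chart_inv c (s z))"
      by (rule atlased_inv[OF atlased_M d(1) elim(3)])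
    moreover have "chart_inv c (s z) \<in> carrier G"
      using smooth_into_at_points[OF elim(2)] by (simp add: points_N)
    ultimately show ?case
      using elim(1) action_\<pi>[OF g] by simp
  qed
  ultimately have "smooth_into_at M (\<lambda>z. g <# chart_inv d z) (snd d p)"
    by (rule smooth_into_at_cong_ev[rotated])
  then show ?thesis
    by (rule smooth_map_atI[OF atlased_M d])
qed

lemma d\<pi>_tangent: "g \<in> carrier G \<Longrightarrow> v \<in> tangent_space N g \<Longrightarrow> d\<pi> g v \<in> tangent_space M (\<pi> g)"
  by (rule differential_tangent[OF atlased_N atlased_M smooth_map_at_\<pi>])

lemma d\<pi>_dL:
  assumes "g \<in> carrier G" "p \<in> carrier G" "v \<in> tangent_space N p"
  shows "d\<pi> (g \<otimes> p) (dL g p v) = dA g (\<pi> p) (d\<pi> p v)"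
proof -
  have "d\<pi> (g \<otimes> p) (dL g p v) = differential N M (\<lambda>q. \<pi> (g \<otimes> q)) p v"
    by (rule differential_compose[OF atlased_N atlased_N smooth_map_at_left smooth_map_at_\<pi>]) (use assms in auto)
  also have "\<dots> = differential N M (\<lambda>q. g <# \<pi> q) p v"
    by (rule differential_cong[OF atlased_N _ smooth_map_at_compose[OF atlased_N atlased_N smooth_map_at_left smooth_map_at_\<pi>]])
       (use assms in \<open>auto simp: points_N action_\<pi>\<close>)
  also have "\<dots> = dA g (\<pi> p) (d\<pi> p v)"
    by (rule differential_compose[OF atlased_N atlased_M smooth_map_at_\<pi> smooth_map_at_action, symmetric])
       (use assms \<pi>_points in auto)
  finally show ?thesis .
qed

lemma dA_nonzero:
  assumes g: "g \<in> carrier G" and p: "p \<in> carrier G" and w: "w \<in> tangent_space M (\<pi> p)" "w \<noteq> zero_vec"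
  shows "dA g (\<pi> p) w \<noteq> zero_vec"
proof
  assume 0: "dA g (\<pi> p) w = zero_vec"
  have ig: "inv g \<in> carrier G" using g by simp
  have gp: "g <# \<pi> p \<in> points M" using action_\<pi>[OF g p] \<pi>_points g p by simp
  note a = smooth_map_at_action[OF g \<pi>_points[OF p]] and b = smooth_map_at_action[OF ig gp]
  have eq: "inv g <# (g <# A) = A" if "A \<in> points M" for A
    using that
  proof (rule points_M_cases)
    fix h assume h: "h \<in> carrier G" "A = \<pi> h"
    have "inv g \<otimes> (g \<otimes> h) = h" using g h by (simp add: m_assoc[symmetric])
    then show ?thesis using g h by (simp add: action_\<pi>)
  qed
  have "w = differential M M (\<lambda>A. A) (\<pi> p) w"
    by (rule differential_ident[OF atlased_M \<pi>_points[OF p] w(1), symmetric])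
  also have "\<dots> = differential M M (\<lambda>A. inv g <# (g <# A)) (\<pi> p) w"
    by (rule differential_cong[OF atlased_M _ smooth_map_at_ident[OF atlased_M \<pi>_points[OF p]] w(1)]) (simp add: eq)
  also have "\<dots> = dA (inv g) (g <# \<pi> p) (dA g (\<pi> p) w)"
    by (rule differential_compose[OF atlased_M atlased_M a b w(1), symmetric])
  also have "\<dots> = zero_vec"
    unfolding 0 by (rule differential_zero[OF atlased_M atlased_M b])
  finally show False using w(2) by simp
qed

text \<open>
  An element of the Lie algebra of \<open>H\<close> is the velocity of a curve in \<open>H\<close>, and \<open>\<pi>\<close> is constant
  on \<open>H\<close>.
\<close>

lemma d\<pi>_lie_subalgebra:
  assumes "a \<in> lie_subalgebra G N H"
  shows "a \<in> tangent_space N \<one>" "d\<pi> \<one> a = zero_vec"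
proof -
  obtain c \<epsilon> where c: "a = velocity N c 0" "\<epsilon> > 0" "smooth_curve N {-\<epsilon><..<\<epsilon>} c" "c 0 = \<one>"
      "\<forall>t\<in>{-\<epsilon><..<\<epsilon>}. c t \<in> H"
    using assms by (auto simp: lie_subalgebra_def tangent_space_of_subset_def)
  have e: "smooth_into_at N c 0"
    using c(2,3) by (simp add: smooth_curve_iff[OF atlased_N])
  show "a \<in> tangent_space N \<one>"
    using velocity_tangent[OF atlased_N e] c by simp
  have m: "smooth_map_at N M \<pi> (c 0)" using smooth_map_at_\<pi> c(4) by simp
  have "\<forall>\<^sub>F t in nhds 0. t \<in> {-\<epsilon><..<\<epsilon>}"
    using c(2) by (intro eventually_nhds_in_open) auto
  then have "\<forall>\<^sub>F t in nhds 0. \<pi> (c t) = H"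
    by (rule eventually_mono) (use c(5) \<pi>_H in blast)
  from velocity_cong_ev[OF this smooth_into_at_postcompose[OF atlased_N e m]]
  have "velocity M (\<lambda>t. \<pi> (c t)) 0 = velocity M (\<lambda>t. H) 0" .
  also have "\<dots> = zero_vec" by (simp add: velocity_def o_def fun_eq_iff)
  finally show "d\<pi> \<one> a = zero_vec"
    using velocity_compose[OF atlased_N e m] c by simp
qed

end

section \<open>Sprays with matching spray vector fields\<close>

locale matching_sprays = lie_group_quotient G N H M for G :: "('g, 'z) monoid_scheme" (structure)
    and N :: "('g, 'e::euclidean_space) manifold" and H and M :: "('g set, 'f::euclidean_space) manifold" +
  fixes X :: "('g set, 'f) spray" and Y :: "('g, 'e) spray" and \<mm> :: "('g, 'e) tangent_vector set"
    and \<eta> \<eta>' :: "('g, 'e) tangent_vector \<Rightarrow> ('g, 'e) tangent_vector"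
  assumes X: "homogeneous_spray G M X"
    and \<mm>: "direct_sum (lie_algebra G N) (lie_subalgebra G N H) \<mm>"
    and \<eta>: "spray_vector_field G N H M X \<mm> \<eta>"
    and Y: "left_invariant_spray G N Y"
    and \<eta>': "group_spray_vector_field G N Y \<eta>'"
    and eq: "\<forall>y\<in>\<mm> - {zero_vec}. \<eta> y = \<eta>' y"
begin

lemma \<mm>_subspace: "linear_subspace \<mm>"
  using \<mm> by (simp add: direct_sum_def)

lemma \<mm>_tangent: "\<mm> \<subseteq> tangent_space N \<one>"
proof
  fix v assume v: "v \<in> \<mm>"
  have "zero_vec \<in> lie_subalgebra G N H" using \<mm> by (simp add: direct_sum_def linear_subspace_def)
  moreover have "lie_algebra G N = {(\<lambda>c. a c + b c) |a b. a \<in> lie_subalgebra G N H \<and> b \<in> \<mm>}"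
    using \<mm> by (simp add: direct_sum_def)
  ultimately have "(\<lambda>c. zero_vec c + v c) \<in> lie_algebra G N"
    using v by (simp only: mem_Collect_eq) (intro exI[of _ zero_vec] exI[of _ v], simp)
  then show "v \<in> tangent_space N \<one>" by (simp add: lie_algebra_def)
qed

text \<open>
  The vector \<open>d\<pi> \<one> y\<close> is the initial velocity of a geodesic, and these velocities do not vanish.
\<close>

lemma d\<pi>_\<mm>_nonzero:
  assumes "y \<in> \<mm>" "y \<noteq> zero_vec"
  shows "d\<pi> \<one> y \<noteq> zero_vec"
proof -
  have "y \<in> \<mm> - {zero_vec}" using assms by simp
  from bspec[OF \<eta>[unfolded spray_vector_field_def] this]
  obtain \<epsilon> c where c: "\<epsilon> > 0" "geodesic M X {-\<epsilon><..<\<epsilon>} c" "velocity M c 0 = d\<pi> \<one> y"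
    by (elim exE conjE)
  then show ?thesis
    using geodesicD(2)[OF c(2), of 0] by simp
qed

lemma d\<pi>_\<mm>_inj:
  assumes "v \<in> \<mm>" "w \<in> \<mm>" "d\<pi> \<one> v = d\<pi> \<one> w"
  shows "v = w"
proof -
  let ?w = "\<lambda>c. (-1) *\<^sub>R w c" and ?d = "\<lambda>c. v c + (-1) *\<^sub>R w c"
  have w: "?w \<in> \<mm>"
    by (rule linear_subspaceD(3)[OF \<mm>_subspace assms(2)])
  have d: "?d \<in> \<mm>"
    by (rule linear_subspaceD(2)[OF \<mm>_subspace assms(1) w])
  note t = subsetD[OF \<mm>_tangent]
  have "d\<pi> \<one> ?d = (\<lambda>c. d\<pi> \<one> v c + d\<pi> \<one> ?w c)"
    by (rule differential_add[OF atlased_N atlased_M smooth_map_at_\<pi>[OF one_closed] t[OF assms(1)] t[OF w] t[OF d]])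
  also have "d\<pi> \<one> ?w = (\<lambda>c. (-1) *\<^sub>R d\<pi> \<one> w c)"
    by (rule differential_scale[OF atlased_N atlased_M smooth_map_at_\<pi>[OF one_closed] t[OF assms(2)] t[OF w]])
  finally have "d\<pi> \<one> ?d = zero_vec" by (simp add: assms(3))
  then have "?d = zero_vec" using d\<pi>_\<mm>_nonzero[OF d] by blast
  then show ?thesis by (simp add: fun_eq_iff)
qed

text \<open>
  The curve is the horizontal lift of the geodesic of \<open>X\<close> with initial velocity \<open>d\<pi> \<one> y\<close>. It has the
  2-jet of the geodesic of \<open>Y\<close> with initial velocity \<open>y\<close>, so its tangent lift has the velocity
  prescribed by \<open>Y\<close> at time \<open>0\<close>, and its projection satisfies the geodesic equation of \<open>X\<close> there.
\<close>

lemma horizontal_curve: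
  assumes y: "y \<in> \<mm>" "y \<noteq> zero_vec"
  obtains \<epsilon> C where "\<epsilon> > 0" "C 0 = \<one>" "\<forall>t\<in>{-\<epsilon><..<\<epsilon>}. smooth_into_at N C t"
    "velocity N C 0 = y" "\<forall>t\<in>{-\<epsilon><..<\<epsilon>}. left_velocity G N C t \<in> \<mm> - {zero_vec}"
    "velocity (slit_bundle N) (tangent_lift N C) 0 = Y (\<one>, y)"
    "velocity (slit_bundle M) (tangent_lift M (\<lambda>t. \<pi> (C t))) 0 = X (\<pi> \<one>, d\<pi> \<one> y)"
proof -
  have y': "y \<in> \<mm> - {zero_vec}" using y by simp
  from bspec[OF \<eta>[unfolded spray_vector_field_def] y']
  obtain \<epsilon> c C where \<epsilon>: "\<epsilon> > 0" and c: "geodesic M X {-\<epsilon><..<\<epsilon>} c" "c 0 = \<pi> \<one>" "velocity M c 0 = d\<pi> \<one> y"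
    and C: "horizontal_lift G N H \<mm> {-\<epsilon><..<\<epsilon>} c C"
    and wC': "\<forall>d. ((\<lambda>t. left_velocity G N C t d) has_vector_derivative - \<eta> y d) (at 0)"
    by (elim exE conjE)
  note wC = wC'[rule_format]
  have y'': "y \<in> lie_algebra G N - {zero_vec}"
    using y \<mm>_tangent by (auto simp: lie_algebra_def)
  from bspec[OF \<eta>'[unfolded group_spray_vector_field_def] y'']
  obtain \<delta> D where \<delta>: "\<delta> > 0" and D: "geodesic N Y {-\<delta><..<\<delta>} D" "D 0 = \<one>" "velocity N D 0 = y"
    and wD': "\<forall>d. ((\<lambda>t. left_velocity G N D t d) has_vector_derivative - \<eta>' y d) (at 0)"
    by (elim exE conjE)
  note wD = wD'[rule_format]
  have I: "0 \<in> {-\<epsilon><..<\<epsilon>}" "0 \<in> {-\<delta><..<\<delta>}" using \<epsilon> \<delta> by auto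
  have C0: "C 0 = \<one>" and Ce: "\<And>t. t \<in> {-\<epsilon><..<\<epsilon>} \<Longrightarrow> smooth_into_at N C t"
    and Cc: "\<And>t. t \<in> {-\<epsilon><..<\<epsilon>} \<Longrightarrow> c t = \<pi> (C t)"
    and Cm: "\<And>t. t \<in> {-\<epsilon><..<\<epsilon>} \<Longrightarrow> left_velocity G N C t \<in> \<mm> - {zero_vec}"
    using C smooth_curve_iff[OF atlased_N] unfolding horizontal_lift_def by blast+
  have ce: "smooth_into_at M c t" if "t \<in> {-\<epsilon><..<\<epsilon>}" for t
    using c(1) that smooth_curve_iff[OF atlased_M] unfolding geodesic_def by blast
  have De: "smooth_into_at N D 0"
    using D(1) I(2) smooth_curve_iff[OF atlased_N] unfolding geodesic_def by blast
  have m: "smooth_map_at N M \<pi> (C 0)" using smooth_map_at_\<pi> C0 by simp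
  have evI: "\<forall>\<^sub>F t in nhds 0. t \<in> {-\<epsilon><..<\<epsilon>}"
    using I by (intro eventually_nhds_in_open) auto
  have evc: "\<forall>\<^sub>F t in nhds 0. c t = \<pi> (C t)"
    using evI by (rule eventually_mono) (rule Cc)
  have "d\<pi> \<one> (velocity N C 0) = velocity M (\<lambda>t. \<pi> (C t)) 0"
    using velocity_compose[OF atlased_N Ce[OF I(1)] m] C0 by simp
  also have "\<dots> = velocity M c 0"
    by (rule velocity_cong_ev[OF evc ce[OF I(1)], symmetric])
  finally have "d\<pi> \<one> (velocity N C 0) = d\<pi> \<one> y" using c(3) by simp
  moreover have "velocity N C 0 \<in> \<mm>"
    using Cm[OF I(1)] left_velocity_at_one[OF Ce[OF I(1)] C0] by simp
  \<comment> \<open>The lift starts with the velocity \<open>y\<close> itself, because \<open>d\<pi>\<close> is injective on \<open>\<mm>\<close>.\<close>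
  ultimately have Cy: "velocity N C 0 = y"
    using d\<pi>_\<mm>_inj y(1) by blast
  have "velocity (slit_bundle N) (tangent_lift N C) 0 = velocity (slit_bundle N) (tangent_lift N D) 0"
  proof (rule second_order_jet[OF Ce[OF I(1)] C0 De D(2) _ wC])
    show "velocity N C 0 = velocity N D 0" using Cy D(3) by simp
    have "\<eta> y = \<eta>' y" using eq y' by blast
    then show "((\<lambda>t. left_velocity G N D t d) has_vector_derivative - \<eta> y d) (at 0)" for d
      using wD by simp
    show "velocity N C 0 \<noteq> zero_vec" using Cy y(2) by simp
  qed
  also have "\<dots> = Y (\<one>, y)"
    using geodesicD(3)[OF D(1) I(2)] D(2,3) by (simp add: tangent_lift_def)
  finally have YC: "velocity (slit_bundle N) (tangent_lift N C) 0 = Y (\<one>, y)" .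
  have "velocity (slit_bundle M) (tangent_lift M (\<lambda>t. \<pi> (C t))) 0 = velocity (slit_bundle M) (tangent_lift M c) 0"
    by (rule velocity_tangent_lift_cong[OF atlased_M evc ce[OF I(1)] geodesicD(2)[OF c(1) I(1)], symmetric])
  also have "\<dots> = X (\<pi> \<one>, d\<pi> \<one> y)"
    using geodesicD(3)[OF c(1) I(1)] c(2,3) by (simp add: tangent_lift_def)
  finally have XC: "velocity (slit_bundle M) (tangent_lift M (\<lambda>t. \<pi> (C t))) 0 = X (\<pi> \<one>, d\<pi> \<one> y)" .
  show ?thesis
    by (rule that[OF \<epsilon> C0 _ Cy _ YC XC]) (use Ce Cm in blast)+
qed

text \<open>
  Left translation moves the horizontal curve to an arbitrary base point. The invariance of \<open>Y\<close>
  under the left translations and of \<open>X\<close> under the action carries both second order equations along.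
\<close>

lemma translated_curve:
  assumes y: "y \<in> \<mm>" "y \<noteq> zero_vec" and g: "g \<in> carrier G"
  obtains \<epsilon> D where "\<epsilon> > 0" "\<forall>t\<in>{-\<epsilon><..<\<epsilon>}. smooth_into_at N D t"
    "\<forall>t\<in>{-\<epsilon><..<\<epsilon>}. tangent_lift N D t \<in> left_distribution G N \<mm> \<inter> slit"
    "tangent_lift N D 0 = (g, dL g \<one> y)"
    "velocity (slit_bundle N) (tangent_lift N D) 0 = Y (g, dL g \<one> y)"
    "velocity (slit_bundle M) (tangent_lift M (\<lambda>t. \<pi> (D t))) 0 = X (\<pi> g, d\<pi> g (dL g \<one> y))"
proof -
  obtain \<epsilon> C where \<epsilon>: "\<epsilon> > 0" and C0: "C 0 = \<one>" and Ce': "\<forall>t\<in>{-\<epsilon><..<\<epsilon>}. smooth_into_at N C t"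
    and Cy: "velocity N C 0 = y" and Cm': "\<forall>t\<in>{-\<epsilon><..<\<epsilon>}. left_velocity G N C t \<in> \<mm> - {zero_vec}"
    and CY: "velocity (slit_bundle N) (tangent_lift N C) 0 = Y (\<one>, y)"
    and CX: "velocity (slit_bundle M) (tangent_lift M (\<lambda>t. \<pi> (C t))) 0 = X (\<pi> \<one>, d\<pi> \<one> y)"
    by (rule horizontal_curve[OF y])
  note Ce = bspec[OF Ce'] and Cm = bspec[OF Cm']
  have I: "0 \<in> {-\<epsilon><..<\<epsilon>}" using \<epsilon> by simp
  have Cg: "C t \<in> carrier G" if "t \<in> {-\<epsilon><..<\<epsilon>}" for t
    using smooth_into_at_points[OF Ce[OF that]] by (simp add: points_N)
  define D where "D t = g \<otimes> C t" for t
  have De: "smooth_into_at N D t" if "t \<in> {-\<epsilon><..<\<epsilon>}" for t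
    unfolding D_def by (rule smooth_into_at_mult[OF smooth_into_at_const[OF g] Ce[OF that]])
  have Dv: "velocity N D t = dL g (C t) (velocity N C t)" if "t \<in> {-\<epsilon><..<\<epsilon>}" for t
    unfolding D_def by (rule velocity_left[OF g Ce[OF that]])
  have Dl: "velocity N D t = dL (D t) \<one> (left_velocity G N C t)" if "t \<in> {-\<epsilon><..<\<epsilon>}" for t
    using Dv[OF that] velocity_left_velocity[OF Ce[OF that]] dL_mult[OF g Cg[OF that] one_closed left_velocity_tangent[OF Ce[OF that]]]
      Cg[OF that] by (simp add: D_def)
  have Dg: "D t \<in> carrier G" if "t \<in> {-\<epsilon><..<\<epsilon>}" for t
    using Cg[OF that] g by (simp add: D_def)
  have D0: "D 0 = g" using C0 g by (simp add: D_def)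
  have y1: "y \<in> tangent_space N \<one>" using y \<mm>_tangent by blast
  have tD: "tangent_lift N D 0 = (g, dL g \<one> y)"
    using D0 Dv[OF I] C0 Cy by (simp add: tangent_lift_def)
  have nzD: "velocity N D t \<noteq> zero_vec" if "t \<in> {-\<epsilon><..<\<epsilon>}" for t
    using Dl[OF that] dL_nonzero[OF Dg[OF that] one_closed left_velocity_tangent[OF Ce[OF that]]] Cm[OF that] by auto
  have nzC: "velocity N C 0 \<noteq> zero_vec" using Cy y by simp
  have tC: "tangent_lift N C 0 = (\<one>, y)" using C0 Cy by (simp add: tangent_lift_def)
  have uN: "(\<one>, y) \<in> points (slit_bundle N)"
    using y y1 by (simp add: points_slit_bundle[OF atlased_N] points_N)
  have "velocity (slit_bundle N) (tangent_lift N D) 0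
      = differential (slit_bundle N) (slit_bundle N) (tangent_map N N (\<lambda>x. g \<otimes> x)) (tangent_lift N C 0)
          (velocity (slit_bundle N) (tangent_lift N C) 0)"
    unfolding D_def
    by (rule velocity_tangent_lift_compose[OF atlased_N atlased_N Ce[OF I] smooth_map_at_left[OF g] _ nzC])
       (use nzD[OF I] in \<open>simp_all add: D_def[abs_def] points_N\<close>)
  also have "\<dots> = Y (tangent_map N N (\<lambda>x. g \<otimes> x) (\<one>, y))"
    unfolding tC CY using Y g uN unfolding left_invariant_spray_def invariant_vector_field_def by metis
  finally have DY: "velocity (slit_bundle N) (tangent_lift N D) 0 = Y (g, dL g \<one> y)"
    using g by (simp add: tangent_map_def)
  let ?c = "\<lambda>t. \<pi> (C t)"
  have c: "smooth_into_at M ?c t" if "t \<in> {-\<epsilon><..<\<epsilon>}" for t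
    by (rule smooth_into_at_postcompose[OF atlased_N Ce[OF that] smooth_map_at_\<pi>[OF Cg[OF that]]])
  have cv: "velocity M ?c 0 = d\<pi> \<one> y"
    using velocity_compose[OF atlased_N Ce[OF I] smooth_map_at_\<pi>[OF Cg[OF I]]] C0 Cy by simp
  have nz: "d\<pi> \<one> y \<noteq> zero_vec" by (rule d\<pi>_\<mm>_nonzero[OF y])
  have tc: "tangent_lift M ?c 0 = (\<pi> \<one>, d\<pi> \<one> y)" using C0 cv by (simp add: tangent_lift_def)
  have uM: "(\<pi> \<one>, d\<pi> \<one> y) \<in> points (slit_bundle M)"
    using nz d\<pi>_tangent[OF one_closed y1] \<pi>_points[OF one_closed] by (simp add: points_slit_bundle[OF atlased_M])
  have gc: "velocity M (\<lambda>t. g <# ?c t) 0 = dA g (\<pi> \<one>) (d\<pi> \<one> y)"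
    using velocity_compose[OF atlased_M c[OF I] smooth_map_at_action[OF g smooth_into_at_points[OF c[OF I]]]] cv C0 by simp
  have nzg: "velocity M (\<lambda>t. g <# ?c t) 0 \<noteq> zero_vec"
    unfolding gc by (rule dA_nonzero[OF g one_closed d\<pi>_tangent[OF one_closed y1] nz])
  have ec: "smooth_into_at M (\<lambda>t. g <# ?c t) 0"
    by (rule smooth_into_at_postcompose[OF atlased_M c[OF I] smooth_map_at_action[OF g smooth_into_at_points[OF c[OF I]]]])
  have evI: "\<forall>\<^sub>F t in nhds 0. t \<in> {-\<epsilon><..<\<epsilon>}"
    using I by (intro eventually_nhds_in_open) auto
  have evc: "\<forall>\<^sub>F t in nhds 0. g <# ?c t = \<pi> (D t)"
    using evI by (rule eventually_mono) (simp add: D_def action_\<pi>[OF g Cg])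
  have "velocity (slit_bundle M) (tangent_lift M (\<lambda>t. \<pi> (D t))) 0
      = velocity (slit_bundle M) (tangent_lift M (\<lambda>t. g <# ?c t)) 0"
    by (rule velocity_tangent_lift_cong[OF atlased_M evc ec nzg, symmetric])
  also have "\<dots> = differential (slit_bundle M) (slit_bundle M) (tangent_map M M (\<lambda>A. g <# A)) (tangent_lift M ?c 0)
          (velocity (slit_bundle M) (tangent_lift M ?c) 0)"
    by (rule velocity_tangent_lift_compose[OF atlased_M atlased_M c[OF I] smooth_map_at_action[OF g] nzg])
       (use cv nz in simp_all)
  also have "\<dots> = X (tangent_map M M (\<lambda>A. g <# A) (\<pi> \<one>, d\<pi> \<one> y))"
    unfolding tc CX using X g uM unfolding homogeneous_spray_def invariant_vector_field_def by metis
  also have "tangent_map M M (\<lambda>A. g <# A) (\<pi> \<one>, d\<pi> \<one> y) = (\<pi> g, d\<pi> g (dL g \<one> y))"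
    using d\<pi>_dL[OF g one_closed y1] action_\<pi>[OF g one_closed] g by (simp add: tangent_map_def)
  finally have DX: "velocity (slit_bundle M) (tangent_lift M (\<lambda>t. \<pi> (D t))) 0 = X (\<pi> g, d\<pi> g (dL g \<one> y))" .
  show ?thesis
  proof (rule that[of \<epsilon> D])
    have "tangent_lift N D t \<in> left_distribution G N \<mm> \<inter> slit" if "t \<in> {-\<epsilon><..<\<epsilon>}" for t
      using left_distribution_mem[OF Dg[OF that], of "left_velocity G N C t" \<mm>] Cm[OF that] Dl[OF that] nzD[OF that]
      by (simp add: tangent_lift_def slit_def)
    then show "\<forall>t\<in>{-\<epsilon><..<\<epsilon>}. tangent_lift N D t \<in> left_distribution G N \<mm> \<inter> slit" by blast
    show "\<forall>t\<in>{-\<epsilon><..<\<epsilon>}. smooth_into_at N D t" using De by blast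
  qed (fact \<epsilon> tD DY DX)+
qed

text \<open>
  At the identity the Lie algebra of \<open>H\<close> lies in the kernel of \<open>d\<pi>\<close>, and \<open>d\<pi>\<close> is injective on
  \<open>\<mm>\<close>. As the two spaces span the Lie algebra of \<open>G\<close>, so do the kernel and \<open>\<mm>\<close>, and their sum is
  direct. Left translation carries this to \<open>p\<close>.
\<close>

lemma direct_sum_at:
  assumes p: "p \<in> carrier G"
  shows "direct_sum (tangent_space N p) (kernel_at N M \<pi> p) (fiber (left_distribution G N \<mm>) p)"
proof -
  let ?V = "dL p \<one> ` \<mm>"
  have fib: "fiber (left_distribution G N \<mm>) p = ?V"
    by (rule fiber_left_distribution[OF \<mm>_tangent p])
  have mL: "smooth_map_at N N (\<lambda>x. p \<otimes> x) \<one>" by (rule smooth_map_at_left[OF p one_closed])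
  note m\<pi> = smooth_map_at_\<pi>[OF p]
  note T = linear_subspace_tangent_space[OF atlased_N]
  note t = subsetD[OF \<mm>_tangent]
  have subT: "?V \<subseteq> tangent_space N p"
    using dL_tangent[OF p one_closed t] p by auto
  note ze = linear_subspaceD(1) and add = linear_subspaceD(2) and sc = linear_subspaceD(3)
  have K: "linear_subspace (kernel_at N M \<pi> p)"
    unfolding linear_subspace_def
  proof (intro conjI ballI allI)
    show "zero_vec \<in> kernel_at N M \<pi> p"
      using ze[OF T] differential_zero[OF atlased_N atlased_M m\<pi>] by (simp add: kernel_at_def)
    fix v assume v: "v \<in> kernel_at N M \<pi> p"
    show "(\<lambda>c. r *\<^sub>R v c) \<in> kernel_at N M \<pi> p" for r
      using v sc[OF T, of v p r] differential_scale[OF atlased_N atlased_M m\<pi>, of v r] by (simp add: kernel_at_def)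
    fix w assume w: "w \<in> kernel_at N M \<pi> p"
    show "(\<lambda>c. v c + w c) \<in> kernel_at N M \<pi> p"
      using v w add[OF T, of v p w] differential_add[OF atlased_N atlased_M m\<pi>, of v w] by (simp add: kernel_at_def)
  qed
  have V: "linear_subspace ?V"
    unfolding linear_subspace_def
  proof (intro conjI ballI allI)
    show "zero_vec \<in> ?V"
      by (rule image_eqI[OF _ ze[OF \<mm>_subspace]]) (simp add: differential_zero[OF atlased_N atlased_N mL])
    fix v assume "v \<in> ?V"
    then obtain a where a: "a \<in> \<mm>" "v = dL p \<one> a" by blast
    show "(\<lambda>c. r *\<^sub>R v c) \<in> ?V" for r
      by (rule image_eqI[OF _ sc[OF \<mm>_subspace a(1), of r]])
         (use differential_scale[OF atlased_N atlased_N mL t[OF a(1)] t[OF sc[OF \<mm>_subspace a(1), of r]]] a(2) in simp)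
    fix w assume "w \<in> ?V"
    then obtain b where b: "b \<in> \<mm>" "w = dL p \<one> b" by blast
    show "(\<lambda>c. v c + w c) \<in> ?V"
      by (rule image_eqI[OF _ add[OF \<mm>_subspace a(1) b(1)]])
         (use differential_add[OF atlased_N atlased_N mL t[OF a(1)] t[OF b(1)] t[OF add[OF \<mm>_subspace a(1) b(1)]]] a(2) b(2) in simp)
  qed
  have d\<pi>L: "d\<pi> p (dL p \<one> v) = dA p (\<pi> \<one>) (d\<pi> \<one> v)" if "v \<in> tangent_space N \<one>" for v
    using d\<pi>_dL[OF p one_closed that] p by simp
  have "kernel_at N M \<pi> p \<inter> ?V \<subseteq> {zero_vec}"
  proof
    fix w assume w: "w \<in> kernel_at N M \<pi> p \<inter> ?V"
    then obtain v where v: "v \<in> \<mm>" "w = dL p \<one> v" by blast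
    have "dA p (\<pi> \<one>) (d\<pi> \<one> v) = zero_vec"
      using w v d\<pi>L[OF t[OF v(1)]] by (simp add: kernel_at_def)
    then have "d\<pi> \<one> v = zero_vec"
      using dA_nonzero[OF p one_closed d\<pi>_tangent[OF one_closed t[OF v(1)]]] by blast
    then have "v = zero_vec" using d\<pi>_\<mm>_nonzero[OF v(1)] by blast
    then show "w \<in> {zero_vec}"
      using v(2) differential_zero[OF atlased_N atlased_N mL] by simp
  qed
  then have int: "kernel_at N M \<pi> p \<inter> ?V = {zero_vec}"
    using ze[OF K] ze[OF V] by blast
  have "tangent_space N p = {(\<lambda>c. a c + b c) |a b. a \<in> kernel_at N M \<pi> p \<and> b \<in> ?V}"
  proof (intro equalityI subsetI)
    fix w assume w: "w \<in> tangent_space N p"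
    let ?v = "dL (inv p) p w"
    have "?v \<in> tangent_space N \<one>"
      using dL_tangent[OF inv_closed[OF p] p w] p by simp
    then have "?v \<in> {(\<lambda>c. a c + b c) |a b. a \<in> lie_subalgebra G N H \<and> b \<in> \<mm>}"
      using \<mm> by (simp add: direct_sum_def lie_algebra_def)
    then obtain a b where ab: "a \<in> lie_subalgebra G N H" "b \<in> \<mm>" "?v = (\<lambda>c. a c + b c)"
      by (elim CollectE exE conjE)
    note a = d\<pi>_lie_subalgebra[OF ab(1)]
    have vt: "(\<lambda>c. a c + b c) \<in> tangent_space N \<one>"
      using \<open>?v \<in> tangent_space N \<one>\<close> ab(3) by simp
    have "w = dL p \<one> ?v"
      using dL_inverse[OF inv_closed[OF p] p w] p by simp
    also have "\<dots> = (\<lambda>c. dL p \<one> a c + dL p \<one> b c)"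
      unfolding ab(3) by (rule differential_add[OF atlased_N atlased_N mL a(1) t[OF ab(2)] vt])
    finally have 1: "w = (\<lambda>c. dL p \<one> a c + dL p \<one> b c)" .
    have "dL p \<one> a \<in> tangent_space N p"
      using dL_tangent[OF p one_closed a(1)] p by simp
    moreover have "d\<pi> p (dL p \<one> a) = zero_vec"
      unfolding d\<pi>L[OF a(1)] a(2)
      by (rule differential_zero[OF atlased_M atlased_M smooth_map_at_action[OF p \<pi>_points[OF one_closed]]])
    ultimately have "dL p \<one> a \<in> kernel_at N M \<pi> p"
      by (simp add: kernel_at_def)
    moreover have "dL p \<one> b \<in> ?V" using ab(2) by blast
    ultimately show "w \<in> {(\<lambda>c. a c + b c) |a b. a \<in> kernel_at N M \<pi> p \<and> b \<in> ?V}"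
      unfolding mem_Collect_eq using 1 by (intro exI conjI)
  next
    fix w assume "w \<in> {(\<lambda>c. a c + b c) |a b. a \<in> kernel_at N M \<pi> p \<and> b \<in> ?V}"
    then obtain a b where "a \<in> kernel_at N M \<pi> p" "b \<in> ?V" "w = (\<lambda>c. a c + b c)"
      by (elim CollectE exE conjE)
    moreover from this have "a \<in> tangent_space N p" "b \<in> tangent_space N p"
      using subT by (auto simp: kernel_at_def)
    ultimately show "w \<in> tangent_space N p" using add[OF T] by simp
  qed
  then show ?thesis
    unfolding direct_sum_def fib using K V int by blast
qed

text \<open>
  The tangent lift of the translated curve runs inside the distribution with velocity \<open>Y u\<close> at \<open>u\<close>.
\<close>

lemma tangent_to_distribution:
  assumes "u \<in> left_distribution G N \<mm> \<inter> slit"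
  shows "Y u \<in> tangent_space_of_subset (slit_bundle N) (left_distribution G N \<mm> \<inter> slit) u"
proof -
  from assms have "u \<in> left_distribution G N \<mm>" by blast
  then obtain g y where gy: "g \<in> carrier G" "y \<in> \<mm>" "u = (g, dL g \<one> y)"
    by (rule left_distribution_cases)
  have "y \<noteq> zero_vec"
    using assms gy differential_zero[OF atlased_N atlased_N smooth_map_at_left[OF gy(1) one_closed]] by (auto simp: slit_def)
  from translated_curve[OF gy(2) this gy(1)]
  obtain \<epsilon> D where \<epsilon>: "\<epsilon> > 0" and De: "\<forall>t\<in>{-\<epsilon><..<\<epsilon>}. smooth_into_at N D t"
    and DL: "\<forall>t\<in>{-\<epsilon><..<\<epsilon>}. tangent_lift N D t \<in> left_distribution G N \<mm> \<inter> slit"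
    and D0: "tangent_lift N D 0 = u" "velocity (slit_bundle N) (tangent_lift N D) 0 = Y u"
    unfolding gy(3) by metis
  note D = \<epsilon> bspec[OF De] bspec[OF DL] D0
  have "smooth_into_at (slit_bundle N) (tangent_lift N D) t" if "t \<in> {-\<epsilon><..<\<epsilon>}" for t
    by (rule smooth_into_at_tangent_lift[OF atlased_N D(2)[OF that]])
       (use D(3)[OF that] in \<open>simp add: slit_def tangent_lift_def\<close>)
  then have "smooth_curve (slit_bundle N) {-\<epsilon><..<\<epsilon>} (tangent_lift N D)"
    unfolding smooth_curve_iff[OF atlased_slit_bundle[OF atlased_N]] by (simp add: is_interval_oo)
  then show ?thesis
    unfolding tangent_space_of_subset_def mem_Collect_eq
    using D by (intro exI[of _ "tangent_lift N D"] exI[of _ \<epsilon>]) auto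
qed

text \<open>
  At each time the geodesic \<open>c\<close> and the translated curve \<open>D\<close> through its tangent vector have tangent
  lifts with the same velocity. Hence so have their projections, and for \<open>D\<close> this velocity is the
  value of \<open>X\<close>.
\<close>

lemma projected_geodesic:
  assumes c: "geodesic N Y I c" and h: "\<forall>t\<in>I. tangent_lift N c t \<in> left_distribution G N \<mm> \<inter> slit"
  shows "geodesic M X I (\<lambda>t. \<pi> (c t))"
  unfolding geodesic_def
proof (intro conjI ballI)
  have I: "open I" "is_interval I" and ce: "\<And>t. t \<in> I \<Longrightarrow> smooth_into_at N c t"
    using c smooth_curve_iff[OF atlased_N] unfolding geodesic_def by blast+
  have cg: "c t \<in> carrier G" if "t \<in> I" for t
    using smooth_into_at_points[OF ce[OF that]] by (simp add: points_N)
  show "smooth_curve M I (\<lambda>t. \<pi> (c t))"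
    unfolding smooth_curve_iff[OF atlased_M]
    using I smooth_into_at_postcompose[OF atlased_N ce smooth_map_at_\<pi>[OF cg]] by blast
  fix t assume t: "t \<in> I"
  from h t have "tangent_lift N c t \<in> left_distribution G N \<mm>" by blast
  then obtain g y where gy: "g \<in> carrier G" "y \<in> \<mm>" "tangent_lift N c t = (g, dL g \<one> y)"
    by (rule left_distribution_cases)
  have ctg: "c t = g" and cv: "velocity N c t = dL g \<one> y"
    using gy(3) by (auto simp: tangent_lift_def)
  have y0: "y \<noteq> zero_vec"
    using h t gy differential_zero[OF atlased_N atlased_N smooth_map_at_left[OF gy(1) one_closed]] by (auto simp: slit_def)
  have y1: "y \<in> tangent_space N \<one>" using gy(2) \<mm>_tangent by blast
  have nz: "d\<pi> g (dL g \<one> y) \<noteq> zero_vec"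
    using d\<pi>_dL[OF gy(1) one_closed y1] gy(1)
      dA_nonzero[OF gy(1) one_closed d\<pi>_tangent[OF one_closed y1] d\<pi>_\<mm>_nonzero[OF gy(2) y0]] by simp
  have \<pi>c: "velocity M (\<lambda>t. \<pi> (c t)) t = d\<pi> g (dL g \<one> y)"
    using velocity_compose[OF atlased_N ce[OF t] smooth_map_at_\<pi>[OF cg[OF t]]] ctg cv by simp
  show "velocity M (\<lambda>t. \<pi> (c t)) t \<noteq> zero_vec"
    unfolding \<pi>c by (rule nz)
  obtain \<epsilon> D where D: "\<epsilon> > 0" "\<forall>t\<in>{-\<epsilon><..<\<epsilon>}. smooth_into_at N D t"
    "tangent_lift N D 0 = (g, dL g \<one> y)"
    "velocity (slit_bundle N) (tangent_lift N D) 0 = Y (g, dL g \<one> y)"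
    "velocity (slit_bundle M) (tangent_lift M (\<lambda>t. \<pi> (D t))) 0 = X (\<pi> g, d\<pi> g (dL g \<one> y))"
    using translated_curve[OF gy(2) y0 gy(1)] by metis
  have D0: "D 0 = g" and Dv: "velocity N D 0 = dL g \<one> y" and De: "smooth_into_at N D 0"
    using D(1,2,3) by (auto simp: tangent_lift_def)
  have D\<pi>: "velocity M (\<lambda>t. \<pi> (D t)) 0 = d\<pi> g (dL g \<one> y)"
    using velocity_compose[OF atlased_N De] smooth_map_at_\<pi>[OF gy(1)] D0 Dv by simp
  have nzL: "dL g \<one> y \<noteq> zero_vec" by (rule dL_nonzero[OF gy(1) one_closed y1 y0])
  have m: "\<And>q. q \<in> points N \<Longrightarrow> smooth_map_at N M \<pi> q" using smooth_map_at_\<pi> points_N by simp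
  have "velocity (slit_bundle M) (tangent_lift M (\<lambda>t. \<pi> (c t))) t
      = differential (slit_bundle N) (slit_bundle M) (tangent_map N M \<pi>) (tangent_lift N c t)
          (velocity (slit_bundle N) (tangent_lift N c) t)"
    by (rule velocity_tangent_lift_compose[OF atlased_N atlased_M ce[OF t] m]) (use \<pi>c nz cv nzL in simp_all)
  also have "velocity (slit_bundle N) (tangent_lift N c) t = Y (g, dL g \<one> y)"
    using geodesicD(3)[OF c t] gy(3) by simp
  also have "\<dots> = velocity (slit_bundle N) (tangent_lift N D) 0"
    using D(4) by simp
  also have "tangent_lift N c t = tangent_lift N D 0"
    using gy(3) D(3) by simp
  also have "differential (slit_bundle N) (slit_bundle M) (tangent_map N M \<pi>) (tangent_lift N D 0)
          (velocity (slit_bundle N) (tangent_lift N D) 0) = velocity (slit_bundle M) (tangent_lift M (\<lambda>t. \<pi> (D t))) 0"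
    by (rule velocity_tangent_lift_compose[OF atlased_N atlased_M De m, symmetric]) (use D\<pi> nz Dv nzL in simp_all)
  also have "\<dots> = X (\<pi> g, d\<pi> g (dL g \<one> y))" by (rule D(5))
  also have "(\<pi> g, d\<pi> g (dL g \<one> y)) = tangent_lift M (\<lambda>t. \<pi> (c t)) t"
    using \<pi>c ctg by (simp add: tangent_lift_def)
  finally show "velocity (slit_bundle M) (tangent_lift M (\<lambda>t. \<pi> (c t))) t = X (tangent_lift M (\<lambda>t. \<pi> (c t)) t)" .
qed

end

theorem theoremB:
  fixes G :: "('g, 'z) monoid_scheme"
    and N :: "('g, 'e::euclidean_space) manifold"
    and H :: "'g set"
    and M :: "('g set, 'f::euclidean_space) manifold"
    and X :: "('g set, 'f) spray"
    and Y :: "('g, 'e) spray"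
    and \<mm> :: "('g, 'e) tangent_vector set"
    and \<eta> \<eta>' :: "('g, 'e) tangent_vector \<Rightarrow> ('g, 'e) tangent_vector"
  assumes "lie_group G N"
    and "subgroup H G" and "closedin (mtop N) H"
    and "coset_manifold G N H M"
    and "homogeneous_spray G M X"
    and "direct_sum (lie_algebra G N) (lie_subalgebra G N H) \<mm>"
    and "spray_vector_field G N H M X \<mm> \<eta>"
    and "left_invariant_spray G N Y"
    and "group_spray_vector_field G N Y \<eta>'"
    and "\<forall>y\<in>\<mm> - {zero_vec}. \<eta> y = \<eta>' y"
  shows "spray_submersion N Y M X (\<lambda>g. g <#\<^bsub>G\<^esub> H) (left_distribution G N \<mm>)"
proof -
  interpret group G using assms(1) by (simp add: lie_group_def)
  interpret matching_sprays G N H M X Y \<mm> \<eta> \<eta>'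
    by (intro matching_sprays.intro matching_sprays_axioms.intro lie_group_quotient.intro lie_group_quotient_axioms.intro
        lie_group_mfd.intro lie_group_mfd_axioms.intro is_group assms)
  show ?thesis
    unfolding spray_submersion_def o_def
  proof (intro conjI ballI allI impI)
    show "smooth_manifold N" using assms(1) by (simp add: lie_group_def)
    show "spray_structure N Y" using assms(8) by (simp add: left_invariant_spray_def)
    show "smooth_manifold M" by (rule smooth_manifold_M)
    show "spray_structure M X" using assms(5) by (simp add: homogeneous_spray_def)
    show "smooth_submersion N M (\<lambda>g. g <#\<^bsub>G\<^esub> H)" by (rule submersion)
    show "distribution N (left_distribution G N \<mm>)"
      by (rule distribution_left_distribution[OF \<mm>_subspace \<mm>_tangent])
    show "direct_sum (tangent_space N p) (kernel_at N M (\<lambda>g. g <#\<^bsub>G\<^esub> H) p) (fiber (left_distribution G N \<mm>) p)"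
      if "p \<in> points N" for p
      using direct_sum_at that by (simp add: points_N)
    show "Y u \<in> tangent_space_of_subset (slit_bundle N) (left_distribution G N \<mm> \<inter> slit) u"
      if "u \<in> left_distribution G N \<mm> \<inter> slit" for u
      using that by (rule tangent_to_distribution)
    show "geodesic M X I (\<lambda>t. c t <#\<^bsub>G\<^esub> H)"
      if "geodesic N Y I c \<and> (\<forall>t\<in>I. tangent_lift N c t \<in> left_distribution G N \<mm> \<inter> slit)" for I c
      using that projected_geodesic by blast
  qed
qed

end
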